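(* Let $\mathcal{S}$ and $\mathcal{T}$ be triangulated categories and let $F:\mathcal{T}\to\mathcal{S}$, $G:\mathcal{S}\to\mathcal{T}$, $J:\mathcal{T}\to\mathcal{S}$ be triangulated functors such that $F$ is left adjoint to $G$ and $G$ is left adjoint to $J$. Let $\{B_n\}_{n\in\mathbb{N}}$ be a metric on $\mathcal{T}$. Let $\mathfrak{S}(\mathcal{T})$ be the completion of $\mathcal{T}$ with respect to $\{B_n\}_{n\in\mathbb{N}}$ and let $\mathfrak{S}(\mathcal{S})$ be the completion of $\mathcal{S}$ with respect to the preimage metric $\{G^{-1}(B_n)\}_{n\in\mathbb{N}}$. If $F$ and $J$ are fully faithful, then the functor $-\circ G:\mathfrak{S}(\mathcal{T})\to\mathfrak{S}(\mathcal{S})$ induced by precomposition with $G$ (the restriction of $-\circ G:\mathrm{Mod}\text{-}\mathcal{T}\to\mathrm{Mod}\text{-}\mathcal{S}$) is a well-defined triangulated equivalence, with a triangulated inverse $-\circ F:\mathfrak{S}(\mathcal{S})\to\mathfrak{S}(\mathcal{T})$.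
   Context: $\mathbb{N}=\{1,2,\dots\}$. All subcategories are full. Let $\mathcal{T}$ be a triangulated category with shift $\Sigma$. For subcategories $\mathcal{X},\mathcal{Z}\subseteq\mathcal{T}$, $\mathcal{X}*\mathcal{Z}$ is the subcategory of all objects $T$ admitting a distinguished triangle $X\to T\to Z\to\Sigma X$ with $X\in\mathcal{X}$, $Z\in\mathcal{Z}$. A metric on $\mathcal{T}$ is a non-increasing chain $B_1\supseteq B_2\supseteq\cdots$ of subcategories of $\mathcal{T}$ with $B_n*B_n=B_n$ and $0\in B_n$ for all $n$. A sequence $E_*=(E_1\to E_2\to\cdots)$ in $\mathcal{T}$ is a good Cauchy sequence if for all $i\in\mathbb{N}$, $j\in\mathbb{Z}$ there is $M\in\mathbb{N}$ such that for all $m'\ge m\ge M$ the cone $D_{m,m'}$ of the composite map $E_m\to E_{m'}$ satisfies $\Sigma^jD_{m,m'}\in B_i$. $\mathrm{Mod}\text{-}\mathcal{T}$ is the category of additive contravariant functors $\mathcal{T}\to\mathrm{Ab}$ and $Y:\mathcal{T}\to\mathrm{Mod}\text{-}\mathcal{T}$ is the Yoneda embedding. With respect to a given metric $\{B_n\}$: $\mathfrak{C}(\mathcal{T})=\bigcap_{j\in\mathbb{Z}}\bigcup_{i\in\mathbb{N}}Y(\Sigma^jB_i)^\perp$, where $\mathcal{C}^\perp$ is the subcategory of objects $X$ with $\mathrm{Hom}(C,X)=0$ for all $C\in\mathcal{C}$; $\mathfrak{L}(\mathcal{T})$ is the subcategory of $\mathrm{Mod}\text{-}\mathcal{T}$ of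 functors isomorphic to $\varinjlim Y(E_* )$ for some good Cauchy sequence $E_*$ in $\mathcal{T}$; and the completion is $\mathfrak{S}(\mathcal{T})=\mathfrak{C}(\mathcal{T})\cap\mathfrak{L}(\mathcal{T})$. By a theorem of Neeman, $\mathfrak{S}(\mathcal{T})$ is triangulated with shift $\Sigma E:=E\circ\Sigma^{-1}$ and with distinguished triangles those sequences $A\to B\to C\to\Sigma A$ in $\mathfrak{S}(\mathcal{T})$ isomorphic to the directed colimit in $\mathrm{Mod}\text{-}\mathcal{T}$ of the Yoneda image of a directed ($\mathbb{N}$-indexed) diagram of distinguished triangles $a_*\to b_*\to c_*\to\Sigma a_*$ in $\mathcal{T}$ in which $a_*,b_*,c_*,\Sigma a_*$ are good Cauchy sequences. For a triangulated functor $G:\mathcal{S}\to\mathcal{T}$ and a metric $\{B_n\}$ on $\mathcal{T}$, the preimage metric on $\mathcal{S}$ is the sequence of subcategories $G^{-1}(B_n)=\{X\in\mathcal{S}:G(X)\in B_n\}$, which is a metric on $\mathcal{S}$. *)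

theory Defs
  imports "HOL-Algebra.Weak_Morphisms"
begin

section \<open>Categories and functors\<close>

record ('o, 'm) cat =
  Obj :: "'o set"
  Arr :: "'m set"
  Dom :: "'m \<Rightarrow> 'o"
  Cod :: "'m \<Rightarrow> 'o"
  Ident :: "'o \<Rightarrow> 'm"
  Comp :: "'m \<Rightarrow> 'm \<Rightarrow> 'm" (infixl "\<cdot>\<index>" 70)

definition Hom :: "('o, 'm, 'x) cat_scheme \<Rightarrow> 'o \<Rightarrow> 'o \<Rightarrow> 'm set" where
  "Hom C A B = {f \<in> Arr C. Dom C f = A \<and> Cod C f = B}"

locale category =
  fixes C :: "('o, 'm, 'x) cat_scheme" (structure)
  assumes Dom_in_Obj: "f \<in> Arr C \<Longrightarrow> Dom C f \<in> Obj C"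
    and Cod_in_Obj: "f \<in> Arr C \<Longrightarrow> Cod C f \<in> Obj C"
    and Ident_in_Hom: "A \<in> Obj C \<Longrightarrow> Ident C A \<in> Hom C A A"
    and Comp_in_Hom: "\<lbrakk>f \<in> Hom C X Y; g \<in> Hom C Y Z\<rbrakk> \<Longrightarrow> g \<cdot> f \<in> Hom C X Z"
    and Comp_Ident_right: "f \<in> Hom C X Y \<Longrightarrow> f \<cdot> Ident C X = f"
    and Comp_Ident_left: "f \<in> Hom C X Y \<Longrightarrow> Ident C Y \<cdot> f = f"
    and Comp_assoc: "\<lbrakk>f \<in> Hom C W X; g \<in> Hom C X Y; h \<in> Hom C Y Z\<rbrakk>
      \<Longrightarrow> h \<cdot> (g \<cdot> f) = (h \<cdot> g) \<cdot> f"

definition iso_arr :: "('o, 'm, 'x) cat_scheme \<Rightarrow> 'm \<Rightarrow> bool" where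
  "iso_arr C f \<longleftrightarrow> f \<in> Arr C \<and>
     (\<exists>g \<in> Hom C (Cod C f) (Dom C f).
        g \<cdot>\<^bsub>C\<^esub> f = Ident C (Dom C f) \<and> f \<cdot>\<^bsub>C\<^esub> g = Ident C (Cod C f))"

definition zero_object :: "('o, 'm, 'x) cat_scheme \<Rightarrow> 'o \<Rightarrow> bool" where
  "zero_object C Z \<longleftrightarrow> Z \<in> Obj C \<and>
     (\<forall>A \<in> Obj C. (\<exists>!f. f \<in> Hom C A Z) \<and> (\<exists>!f. f \<in> Hom C Z A))"

record ('o, 'm, 'p, 'n) func =
  omap :: "'o \<Rightarrow> 'p"
  amap :: "'m \<Rightarrow> 'n"

locale cat_functor = C: category C + D: category D
  for C :: "('o, 'm, 'x) cat_scheme" and D :: "('p, 'n, 'y) cat_scheme"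
    and F :: "('o, 'm, 'p, 'n) func" +
  assumes omap_in_Obj: "A \<in> Obj C \<Longrightarrow> omap F A \<in> Obj D"
    and amap_in_Hom: "f \<in> Hom C X Y \<Longrightarrow> amap F f \<in> Hom D (omap F X) (omap F Y)"
    and amap_Ident: "A \<in> Obj C \<Longrightarrow> amap F (Ident C A) = Ident D (omap F A)"
    and amap_Comp: "\<lbrakk>f \<in> Hom C X Y; g \<in> Hom C Y Z\<rbrakk>
      \<Longrightarrow> amap F (g \<cdot>\<^bsub>C\<^esub> f) = amap F g \<cdot>\<^bsub>D\<^esub> amap F f"

definition func_id :: "('o, 'm, 'o, 'm) func" where
  "func_id = \<lparr>omap = id, amap = id\<rparr>"

definition func_comp ::
  "('p, 'n, 'q, 'l) func \<Rightarrow> ('o, 'm, 'p, 'n) func \<Rightarrow> ('o, 'm, 'q, 'l) func" (infixl "\<circ>\<^sub>F" 55) where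
  "G \<circ>\<^sub>F F = \<lparr>omap = omap G \<circ> omap F, amap = amap G \<circ> amap F\<rparr>"

definition nat_iso ::
  "('o, 'm, 'x) cat_scheme \<Rightarrow> ('p, 'n, 'y) cat_scheme \<Rightarrow>
   ('o, 'm, 'p, 'n) func \<Rightarrow> ('o, 'm, 'p, 'n) func \<Rightarrow> ('o \<Rightarrow> 'n) \<Rightarrow> bool" where
  "nat_iso C D F G \<phi> \<longleftrightarrow> cat_functor C D F \<and> cat_functor C D G \<and>
     (\<forall>A \<in> Obj C. \<phi> A \<in> Hom D (omap F A) (omap G A) \<and> iso_arr D (\<phi> A)) \<and>
     (\<forall>A B. \<forall>f \<in> Hom C A B. \<phi> B \<cdot>\<^bsub>D\<^esub> amap F f = amap G f \<cdot>\<^bsub>D\<^esub> \<phi> A)"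

definition fully_faithful ::
  "('o, 'm, 'x) cat_scheme \<Rightarrow> ('p, 'n, 'y) cat_scheme \<Rightarrow> ('o, 'm, 'p, 'n) func \<Rightarrow> bool" where
  "fully_faithful C D F \<longleftrightarrow>
     (\<forall>A \<in> Obj C. \<forall>B \<in> Obj C. bij_betw (amap F) (Hom C A B) (Hom D (omap F A) (omap F B)))"

text \<open>\<open>left_adjoint C D F G\<close>: the functor \<open>F\<close> from \<open>C\<close> to \<open>D\<close> is left adjoint to \<open>G\<close>.\<close>

definition left_adjoint ::
  "('o, 'm, 'x) cat_scheme \<Rightarrow> ('p, 'n, 'y) cat_scheme \<Rightarrow>
   ('o, 'm, 'p, 'n) func \<Rightarrow> ('p, 'n, 'o, 'm) func \<Rightarrow> bool" where
  "left_adjoint C D F G \<longleftrightarrow> cat_functor C D F \<and> cat_functor D C G \<and>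
     (\<exists>\<Phi>. (\<forall>A \<in> Obj C. \<forall>B \<in> Obj D.
              bij_betw (\<Phi> A B) (Hom D (omap F A) B) (Hom C A (omap G B))) \<and>
          (\<forall>A' A B B'. \<forall>f \<in> Hom C A' A. \<forall>h \<in> Hom D (omap F A) B. \<forall>k \<in> Hom D B B'.
              \<Phi> A' B' (k \<cdot>\<^bsub>D\<^esub> h \<cdot>\<^bsub>D\<^esub> amap F f) = amap G k \<cdot>\<^bsub>C\<^esub> \<Phi> A B h \<cdot>\<^bsub>C\<^esub> f))"

definition quasi_inverse ::
  "('o, 'm, 'x) cat_scheme \<Rightarrow> ('p, 'n, 'y) cat_scheme \<Rightarrow>
   ('o, 'm, 'p, 'n) func \<Rightarrow> ('p, 'n, 'o, 'm) func \<Rightarrow> bool" where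
  "quasi_inverse C D H K \<longleftrightarrow> cat_functor C D H \<and> cat_functor D C K \<and>
     (\<exists>\<eta>. nat_iso C C (K \<circ>\<^sub>F H) func_id \<eta>) \<and> (\<exists>\<epsilon>. nat_iso D D (H \<circ>\<^sub>F K) func_id \<epsilon>)"

text \<open>A diagram indexed by the natural numbers is given by objects \<open>E n\<close> and arrows
  \<open>e n\<close> from \<open>E n\<close> to \<open>E (Suc n)\<close>; \<open>chain_map C E e m k\<close> is the composite from
  \<open>E m\<close> to \<open>E (m + k)\<close>. Indices start at 0, so that \<open>E n\<close> is the
  \<open>(n + 1)\<close>-st member of the sequence.\<close>

definition chain :: "('o, 'm, 'x) cat_scheme \<Rightarrow> (nat \<Rightarrow> 'o) \<Rightarrow> (nat \<Rightarrow> 'm) \<Rightarrow> bool" where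
  "chain C E e \<longleftrightarrow> (\<forall>n. E n \<in> Obj C \<and> e n \<in> Hom C (E n) (E (Suc n)))"

primrec chain_map ::
  "('o, 'm, 'x) cat_scheme \<Rightarrow> (nat \<Rightarrow> 'o) \<Rightarrow> (nat \<Rightarrow> 'm) \<Rightarrow> nat \<Rightarrow> nat \<Rightarrow> 'm" where
  "chain_map C E e m 0 = Ident C (E m)"
| "chain_map C E e m (Suc k) = e (m + k) \<cdot>\<^bsub>C\<^esub> chain_map C E e m k"

definition cocone ::
  "('o, 'm, 'x) cat_scheme \<Rightarrow> (nat \<Rightarrow> 'o) \<Rightarrow> (nat \<Rightarrow> 'm) \<Rightarrow> 'o \<Rightarrow> (nat \<Rightarrow> 'm) \<Rightarrow> bool" where
  "cocone C E e X i \<longleftrightarrow> X \<in> Obj C \<and>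
     (\<forall>n. i n \<in> Hom C (E n) X \<and> i (Suc n) \<cdot>\<^bsub>C\<^esub> e n = i n)"

definition is_colimit ::
  "('o, 'm, 'x) cat_scheme \<Rightarrow> (nat \<Rightarrow> 'o) \<Rightarrow> (nat \<Rightarrow> 'm) \<Rightarrow> 'o \<Rightarrow> (nat \<Rightarrow> 'm) \<Rightarrow> bool" where
  "is_colimit C E e X i \<longleftrightarrow> chain C E e \<and> cocone C E e X i \<and>
     (\<forall>Z k. cocone C E e Z k \<longrightarrow> (\<exists>!t. t \<in> Hom C X Z \<and> (\<forall>n. t \<cdot>\<^bsub>C\<^esub> i n = k n)))"


section \<open>Additive and triangulated categories\<close>

record ('o, 'm) ab_cat = "('o, 'm) cat" +
  Add :: "'m \<Rightarrow> 'm \<Rightarrow> 'm"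
  Zero :: "'o \<Rightarrow> 'o \<Rightarrow> 'm"

definition hom_group :: "('o, 'm, 'x) ab_cat_scheme \<Rightarrow> 'o \<Rightarrow> 'o \<Rightarrow> 'm monoid" where
  "hom_group C A B = \<lparr>carrier = Hom C A B, mult = Add C, one = Zero C A B\<rparr>"

locale preadditive_category = category C
  for C :: "('o, 'm, 'x) ab_cat_scheme" (structure) +
  assumes hom_group: "\<lbrakk>A \<in> Obj C; B \<in> Obj C\<rbrakk> \<Longrightarrow> comm_group (hom_group C A B)"
    and Comp_Add_left: "\<lbrakk>f \<in> Hom C X Y; g \<in> Hom C Y Z; g' \<in> Hom C Y Z\<rbrakk>
      \<Longrightarrow> Add C g g' \<cdot> f = Add C (g \<cdot> f) (g' \<cdot> f)"
    and Comp_Add_right: "\<lbrakk>f \<in> Hom C X Y; f' \<in> Hom C X Y; g \<in> Hom C Y Z\<rbrakk>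
      \<Longrightarrow> g \<cdot> Add C f f' = Add C (g \<cdot> f) (g \<cdot> f')"

locale additive_category = preadditive_category C
  for C :: "('o, 'm, 'x) ab_cat_scheme" (structure) +
  assumes ex_zero_object: "\<exists>Z. zero_object C Z"
    and ex_biproduct: "\<lbrakk>A \<in> Obj C; B \<in> Obj C\<rbrakk> \<Longrightarrow>
      \<exists>P \<in> Obj C. \<exists>i \<in> Hom C A P. \<exists>j \<in> Hom C B P. \<exists>p \<in> Hom C P A. \<exists>q \<in> Hom C P B.
        p \<cdot> i = Ident C A \<and> q \<cdot> j = Ident C B \<and> p \<cdot> j = Zero C B A \<and> q \<cdot> i = Zero C A B \<and>
        Add C (i \<cdot> p) (j \<cdot> q) = Ident C P"

locale additive_functor = cat_functor C D F
  for C :: "('o, 'm, 'x) ab_cat_scheme" and D :: "('p, 'n, 'y) ab_cat_scheme"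
    and F :: "('o, 'm, 'p, 'n) func" +
  assumes amap_Add: "\<lbrakk>f \<in> Hom C X Y; g \<in> Hom C X Y\<rbrakk>
      \<Longrightarrow> amap F (Add C f g) = Add D (amap F f) (amap F g)"

text \<open>An element \<open>(f, g, h)\<close> of \<open>Tri T\<close> is a distinguished triangle with
  \<open>f\<close> from \<open>A\<close> to \<open>B\<close>, \<open>g\<close> from \<open>B\<close> to \<open>C\<close>
  and \<open>h\<close> from \<open>C\<close> to \<open>\<Sigma> A\<close>.\<close>

record ('o, 'm) tri_cat = "('o, 'm) ab_cat" +
  Shift :: "('o, 'm, 'o, 'm) func"
  Tri :: "('m \<times> 'm \<times> 'm) set"

abbreviation Sigma_obj :: "('o, 'm, 'x) tri_cat_scheme \<Rightarrow> 'o \<Rightarrow> 'o" where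
  "Sigma_obj T \<equiv> omap (Shift T)"

abbreviation Sigma_arr :: "('o, 'm, 'x) tri_cat_scheme \<Rightarrow> 'm \<Rightarrow> 'm" where
  "Sigma_arr T \<equiv> amap (Shift T)"

definition is_triangle :: "('o, 'm, 'x) tri_cat_scheme \<Rightarrow> 'm \<Rightarrow> 'm \<Rightarrow> 'm \<Rightarrow> bool" where
  "is_triangle T f g h \<longleftrightarrow>
     (\<exists>A B C. f \<in> Hom T A B \<and> g \<in> Hom T B C \<and> h \<in> Hom T C (Sigma_obj T A))"

text \<open>The shift is an automorphism of the category, so that all its integral powers are
  literally defined.\<close>

locale triangulated_category = additive_category T
  for T :: "('o, 'm, 'x) tri_cat_scheme" (structure) +
  assumes Shift_additive: "additive_functor T T (Shift T)"
    and Shift_bij_Obj: "bij_betw (Sigma_obj T) (Obj T) (Obj T)"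
    and Shift_bij_Arr: "bij_betw (Sigma_arr T) (Arr T) (Arr T)"
    and Tri_is_triangle: "(f, g, h) \<in> Tri T \<Longrightarrow> is_triangle T f g h"
    and Tri_iso: "\<lbrakk>(f, g, h) \<in> Tri T; is_triangle T f' g' h';
        a \<in> Hom T (Dom T f) (Dom T f'); iso_arr T a;
        b \<in> Hom T (Dom T g) (Dom T g'); iso_arr T b;
        c \<in> Hom T (Dom T h) (Dom T h'); iso_arr T c;
        b \<cdot> f = f' \<cdot> a; c \<cdot> g = g' \<cdot> b; Sigma_arr T a \<cdot> h = h' \<cdot> c\<rbrakk>
      \<Longrightarrow> (f', g', h') \<in> Tri T"
    and TR1_Ident: "\<lbrakk>X \<in> Obj T; zero_object T Z\<rbrakk>
      \<Longrightarrow> (Ident T X, Zero T X Z, Zero T Z (Sigma_obj T X)) \<in> Tri T"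
    and TR1_cone: "f \<in> Arr T \<Longrightarrow> \<exists>g h. (f, g, h) \<in> Tri T"
    and TR2: "is_triangle T f g h \<Longrightarrow> (f, g, h) \<in> Tri T \<longleftrightarrow>
      (g, h, inv\<^bsub>hom_group T (Sigma_obj T (Dom T f)) (Sigma_obj T (Cod T f))\<^esub> (Sigma_arr T f)) \<in> Tri T"
    and TR3: "\<lbrakk>(f, g, h) \<in> Tri T; (f', g', h') \<in> Tri T;
        a \<in> Hom T (Dom T f) (Dom T f'); b \<in> Hom T (Dom T g) (Dom T g'); b \<cdot> f = f' \<cdot> a\<rbrakk>
      \<Longrightarrow> \<exists>c \<in> Hom T (Dom T h) (Dom T h'). c \<cdot> g = g' \<cdot> b \<and> Sigma_arr T a \<cdot> h = h' \<cdot> c"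
    and TR4: "\<lbrakk>f \<in> Hom T X Y; g \<in> Hom T Y Z;
        (f, f', f'') \<in> Tri T; (g, g', g'') \<in> Tri T; (g \<cdot> f, h', h'') \<in> Tri T\<rbrakk>
      \<Longrightarrow> \<exists>u \<in> Hom T (Cod T f') (Cod T h'). \<exists>v \<in> Hom T (Cod T h') (Cod T g').
            (u, v, Sigma_arr T f' \<cdot> g'') \<in> Tri T \<and>
            u \<cdot> f' = h' \<cdot> g \<and> h'' \<cdot> u = f'' \<and> v \<cdot> h' = g' \<and> g'' \<cdot> v = Sigma_arr T f \<cdot> h''"

text \<open>A triangulated functor is defined between any two categories carrying an additive structure,
  a shift and a class of distinguished triangles: it commutes with the shifts up to a natural
  isomorphism that turns distinguished triangles into distinguished triangles.\<close>

locale triangulated_functor = additive_functor S T F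
  for S :: "('o, 'm, 'x) tri_cat_scheme" and T :: "('p, 'n, 'y) tri_cat_scheme"
    and F :: "('o, 'm, 'p, 'n) func" +
  assumes shift_Tri: "\<exists>\<phi>. nat_iso S T (F \<circ>\<^sub>F Shift S) (Shift T \<circ>\<^sub>F F) \<phi> \<and>
     (\<forall>f g h. (f, g, h) \<in> Tri S \<longrightarrow> (amap F f, amap F g, \<phi> (Dom S f) \<cdot>\<^bsub>T\<^esub> amap F h) \<in> Tri T)"

definition triangulated_equivalence ::
  "('o, 'm, 'x) tri_cat_scheme \<Rightarrow> ('p, 'n, 'y) tri_cat_scheme \<Rightarrow> ('o, 'm, 'p, 'n) func \<Rightarrow> bool" where
  "triangulated_equivalence S T F \<longleftrightarrow> triangulated_functor S T F \<and> (\<exists>K. quasi_inverse S T F K)"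

definition triangulated_inverse ::
  "('o, 'm, 'x) tri_cat_scheme \<Rightarrow> ('p, 'n, 'y) tri_cat_scheme \<Rightarrow>
   ('o, 'm, 'p, 'n) func \<Rightarrow> ('p, 'n, 'o, 'm) func \<Rightarrow> bool" where
  "triangulated_inverse S T F K \<longleftrightarrow> triangulated_functor T S K \<and> quasi_inverse S T F K"

definition unshift :: "('o, 'm, 'x) tri_cat_scheme \<Rightarrow> ('o, 'm, 'o, 'm) func" where
  "unshift T = \<lparr>omap = inv_into (Obj T) (Sigma_obj T), amap = inv_into (Arr T) (Sigma_arr T)\<rparr>"

definition shift_pow :: "('o, 'm, 'x) tri_cat_scheme \<Rightarrow> int \<Rightarrow> 'o \<Rightarrow> 'o" where
  "shift_pow T j = (if 0 \<le> j then Sigma_obj T ^^ nat j else omap (unshift T) ^^ nat (- j))"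


section \<open>Metrics and good Cauchy sequences\<close>

text \<open>Full subcategories are represented by their sets of objects.\<close>

definition star :: "('o, 'm, 'x) tri_cat_scheme \<Rightarrow> 'o set \<Rightarrow> 'o set \<Rightarrow> 'o set" where
  "star T P Q = {X \<in> Obj T. \<exists>f g h. (f, g, h) \<in> Tri T \<and> Dom T f \<in> P \<and> Cod T f = X \<and> Cod T g \<in> Q}"

text \<open>As for sequences, \<open>B n\<close> is the \<open>(n + 1)\<close>-st member of the metric. Since
  \<open>star T (B n) (B n) = B n\<close> forces \<open>B n\<close> to be closed under isomorphism, it contains all
  zero objects as soon as it contains one.\<close>

definition is_metric :: "('o, 'm, 'x) tri_cat_scheme \<Rightarrow> (nat \<Rightarrow> 'o set) \<Rightarrow> bool" where
  "is_metric T B \<longleftrightarrow> (\<forall>n. B n \<subseteq> Obj T \<and> B (Suc n) \<subseteq> B n \<and> star T (B n) (B n) = B n \<and>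
     (\<exists>Z \<in> B n. zero_object T Z))"

definition preimage_metric ::
  "('o, 'm, 'x) tri_cat_scheme \<Rightarrow> ('o, 'm, 'p, 'n) func \<Rightarrow> (nat \<Rightarrow> 'p set) \<Rightarrow> nat \<Rightarrow> 'o set" where
  "preimage_metric S G B n = {X \<in> Obj S. omap G X \<in> B n}"

definition is_cone :: "('o, 'm, 'x) tri_cat_scheme \<Rightarrow> 'm \<Rightarrow> 'o \<Rightarrow> bool" where
  "is_cone T f D \<longleftrightarrow> (\<exists>g h. (f, g, h) \<in> Tri T \<and> Cod T g = D)"

definition good_cauchy ::
  "('o, 'm, 'x) tri_cat_scheme \<Rightarrow> (nat \<Rightarrow> 'o set) \<Rightarrow> (nat \<Rightarrow> 'o) \<Rightarrow> (nat \<Rightarrow> 'm) \<Rightarrow> bool" where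
  "good_cauchy T B E e \<longleftrightarrow> chain T E e \<and>
     (\<forall>i. \<forall>j :: int. \<exists>M. \<forall>m m'. M \<le> m \<and> m \<le> m' \<longrightarrow>
        (\<forall>D. is_cone T (chain_map T E e m (m' - m)) D \<longrightarrow> shift_pow T j D \<in> B i))"


section \<open>The category of additive presheaves\<close>

text \<open>The type \<open>'u\<close> plays the role of the universe of sets: \<open>Ab\<close> is the
  category of all abelian groups whose carrier is a set of elements of \<open>'u\<close>. A presheaf is
  an additive contravariant functor to \<open>Ab\<close>. Maps are extensional, so that natural
  transformations with the same components are equal.\<close>

record ('o, 'm, 'u) presheaf =
  grp :: "'o \<Rightarrow> 'u monoid"
  act :: "'m \<Rightarrow> 'u \<Rightarrow> 'u"

locale additive_presheaf =
  fixes C :: "('o, 'm, 'x) ab_cat_scheme" (structure) and E :: "('o, 'm, 'u) presheaf"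
  assumes grp_comm_group: "A \<in> Obj C \<Longrightarrow> comm_group (grp E A)"
    and act_hom: "f \<in> Hom C X Y \<Longrightarrow> act E f \<in> hom (grp E Y) (grp E X)"
    and act_Ident: "\<lbrakk>A \<in> Obj C; x \<in> carrier (grp E A)\<rbrakk> \<Longrightarrow> act E (Ident C A) x = x"
    and act_Comp: "\<lbrakk>f \<in> Hom C X Y; g \<in> Hom C Y Z; x \<in> carrier (grp E Z)\<rbrakk>
      \<Longrightarrow> act E (g \<cdot> f) x = act E f (act E g x)"
    and act_Add: "\<lbrakk>f \<in> Hom C X Y; g \<in> Hom C X Y; x \<in> carrier (grp E Y)\<rbrakk>
      \<Longrightarrow> act E (Add C f g) x = act E f x \<otimes>\<^bsub>grp E X\<^esub> act E g x"
    and grp_extensional: "grp E \<in> extensional (Obj C)"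
    and act_extensional: "act E \<in> extensional (Arr C)"
    and act_extensional_carrier: "f \<in> Hom C X Y \<Longrightarrow> act E f \<in> extensional (carrier (grp E Y))"

record ('o, 'm, 'u) presheaf_map =
  src :: "('o, 'm, 'u) presheaf"
  tgt :: "('o, 'm, 'u) presheaf"
  comps :: "'o \<Rightarrow> 'u \<Rightarrow> 'u"

locale natural_transformation =
  fixes C :: "('o, 'm, 'x) ab_cat_scheme" (structure) and \<eta> :: "('o, 'm, 'u) presheaf_map"
  assumes src: "additive_presheaf C (src \<eta>)"
    and tgt: "additive_presheaf C (tgt \<eta>)"
    and comps_hom: "A \<in> Obj C \<Longrightarrow> comps \<eta> A \<in> hom (grp (src \<eta>) A) (grp (tgt \<eta>) A)"
    and natural: "\<lbrakk>f \<in> Hom C X Y; x \<in> carrier (grp (src \<eta>) Y)\<rbrakk>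
      \<Longrightarrow> comps \<eta> X (act (src \<eta>) f x) = act (tgt \<eta>) f (comps \<eta> Y x)"
    and comps_extensional: "comps \<eta> \<in> extensional (Obj C)"
    and comps_extensional_carrier:
      "A \<in> Obj C \<Longrightarrow> comps \<eta> A \<in> extensional (carrier (grp (src \<eta>) A))"

definition PMod :: "('o, 'm, 'x) ab_cat_scheme \<Rightarrow>
    (('o, 'm, 'u) presheaf, ('o, 'm, 'u) presheaf_map) ab_cat" where
  "PMod C = \<lparr>
     Obj = {E. additive_presheaf C E},
     Arr = {\<eta>. natural_transformation C \<eta>},
     Dom = src,
     Cod = tgt,
     Ident = (\<lambda>E. \<lparr>src = E, tgt = E, comps = \<lambda>A \<in> Obj C. \<lambda>x \<in> carrier (grp E A). x\<rparr>),
     Comp = (\<lambda>\<eta> \<theta>. \<lparr>src = src \<theta>, tgt = tgt \<eta>,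
        comps = \<lambda>A \<in> Obj C. \<lambda>x \<in> carrier (grp (src \<theta>) A). comps \<eta> A (comps \<theta> A x)\<rparr>),
     Add = (\<lambda>\<eta> \<theta>. \<lparr>src = src \<eta>, tgt = tgt \<eta>,
        comps = \<lambda>A \<in> Obj C. \<lambda>x \<in> carrier (grp (src \<eta>) A).
          comps \<eta> A x \<otimes>\<^bsub>grp (tgt \<eta>) A\<^esub> comps \<theta> A x\<rparr>),
     Zero = (\<lambda>E E'. \<lparr>src = E, tgt = E',
        comps = \<lambda>A \<in> Obj C. \<lambda>x \<in> carrier (grp E A). \<one>\<^bsub>grp E' A\<^esub>\<rparr>)\<rparr>"

text \<open>Precomposition with a functor \<open>G\<close> defined on \<open>C\<close>, as a functor on presheaves.\<close>

definition presheaf_comp ::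
  "('o, 'm, 'x) cat_scheme \<Rightarrow> ('o, 'm, 'p, 'n) func \<Rightarrow>
   ('p, 'n, 'u) presheaf \<Rightarrow> ('o, 'm, 'u) presheaf" where
  "presheaf_comp C G E = \<lparr>grp = \<lambda>A \<in> Obj C. grp E (omap G A), act = \<lambda>f \<in> Arr C. act E (amap G f)\<rparr>"

definition precomp ::
  "('o, 'm, 'x) cat_scheme \<Rightarrow> ('o, 'm, 'p, 'n) func \<Rightarrow>
   (('p, 'n, 'u) presheaf, ('p, 'n, 'u) presheaf_map,
    ('o, 'm, 'u) presheaf, ('o, 'm, 'u) presheaf_map) func" where
  "precomp C G = \<lparr>omap = presheaf_comp C G,
     amap = \<lambda>\<eta>. \<lparr>src = presheaf_comp C G (src \<eta>), tgt = presheaf_comp C G (tgt \<eta>),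
       comps = \<lambda>A \<in> Obj C. comps \<eta> (omap G A)\<rparr>\<rparr>"

text \<open>Local smallness with respect to the universe \<open>'u\<close>: every Hom set embeds into
  \<open>'u\<close> by means of \<open>\<iota>\<close>. The Yoneda embedding transports the group structure of
  \<open>Hom C A X\<close> to the image of that set under \<open>\<iota>\<close>.\<close>

definition locally_small :: "('o, 'm, 'x) cat_scheme \<Rightarrow> ('m \<Rightarrow> 'u) \<Rightarrow> bool" where
  "locally_small C \<iota> \<longleftrightarrow> (\<forall>A \<in> Obj C. \<forall>B \<in> Obj C. inj_on \<iota> (Hom C A B))"

definition yoneda_obj ::
  "('o, 'm, 'x) ab_cat_scheme \<Rightarrow> ('m \<Rightarrow> 'u) \<Rightarrow> 'o \<Rightarrow> ('o, 'm, 'u) presheaf" where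
  "yoneda_obj C \<iota> X = \<lparr>
     grp = \<lambda>A \<in> Obj C. image_group \<iota> (hom_group C A X),
     act = \<lambda>f \<in> Arr C. \<lambda>y \<in> \<iota> ` Hom C (Cod C f) X.
       \<iota> (inv_into (Hom C (Cod C f) X) \<iota> y \<cdot>\<^bsub>C\<^esub> f)\<rparr>"

definition yoneda ::
  "('o, 'm, 'x) ab_cat_scheme \<Rightarrow> ('m \<Rightarrow> 'u) \<Rightarrow>
   ('o, 'm, ('o, 'm, 'u) presheaf, ('o, 'm, 'u) presheaf_map) func" where
  "yoneda C \<iota> = \<lparr>
     omap = yoneda_obj C \<iota>,
     amap = \<lambda>f. \<lparr>src = yoneda_obj C \<iota> (Dom C f), tgt = yoneda_obj C \<iota> (Cod C f),
       comps = \<lambda>A \<in> Obj C. \<lambda>y \<in> \<iota> ` Hom C A (Dom C f).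
         \<iota> (f \<cdot>\<^bsub>C\<^esub> inv_into (Hom C A (Dom C f)) \<iota> y)\<rparr>\<rparr>"


section \<open>The completion\<close>

definition perp :: "('o, 'm, 'x) ab_cat_scheme \<Rightarrow> 'o set \<Rightarrow> 'o set" where
  "perp M P = {X \<in> Obj M. \<forall>A \<in> P. Hom M A X = {Zero M A X}}"

definition compactly_supported ::
  "('o, 'm, 'x) tri_cat_scheme \<Rightarrow> ('m \<Rightarrow> 'u) \<Rightarrow> (nat \<Rightarrow> 'o set) \<Rightarrow> ('o, 'm, 'u) presheaf set" where
  "compactly_supported T \<iota> B =
     (\<Inter>j :: int. \<Union>i. perp (PMod T) (omap (yoneda T \<iota>) ` shift_pow T j ` B i))"

definition cauchy_colimits ::
  "('o, 'm, 'x) tri_cat_scheme \<Rightarrow> ('m \<Rightarrow> 'u) \<Rightarrow> (nat \<Rightarrow> 'o set) \<Rightarrow> ('o, 'm, 'u) presheaf set" where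
  "cauchy_colimits T \<iota> B = {X. \<exists>E e i. good_cauchy T B E e \<and>
     is_colimit (PMod T) (\<lambda>n. omap (yoneda T \<iota>) (E n)) (\<lambda>n. amap (yoneda T \<iota>) (e n)) X i}"

definition completion_objs ::
  "('o, 'm, 'x) tri_cat_scheme \<Rightarrow> ('m \<Rightarrow> 'u) \<Rightarrow> (nat \<Rightarrow> 'o set) \<Rightarrow> ('o, 'm, 'u) presheaf set" where
  "completion_objs T \<iota> B = compactly_supported T \<iota> B \<inter> cauchy_colimits T \<iota> B"

text \<open>The canonical isomorphism from \<open>Y (\<Sigma> a)\<close> to \<open>\<Sigma> (Y a) = Y a \<circ> \<Sigma>\<inverse>\<close>, which sends
  an arrow \<open>f\<close> from \<open>x\<close> to \<open>\<Sigma> a\<close> to the arrow \<open>\<Sigma>\<inverse> f\<close> from \<open>\<Sigma>\<inverse> x\<close> to \<open>a\<close>.\<close>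

definition yoneda_shift ::
  "('o, 'm, 'x) tri_cat_scheme \<Rightarrow> ('m \<Rightarrow> 'u) \<Rightarrow> 'o \<Rightarrow> ('o, 'm, 'u) presheaf_map" where
  "yoneda_shift T \<iota> a = \<lparr>
     src = omap (yoneda T \<iota>) (Sigma_obj T a),
     tgt = omap (precomp T (unshift T)) (omap (yoneda T \<iota>) a),
     comps = \<lambda>x \<in> Obj T. \<lambda>y \<in> \<iota> ` Hom T x (Sigma_obj T a).
       \<iota> (amap (unshift T) (inv_into (Hom T x (Sigma_obj T a)) \<iota> y))\<rparr>"

text \<open>Distinguished triangles of the completion. Given a directed diagram of distinguished
  triangles \<open>(p n, q n, r n)\<close> on \<open>a n\<close>, \<open>b n\<close>, \<open>c n\<close>, the colimits
  \<open>X\<close>, \<open>Y\<close>, \<open>Z\<close> of the Yoneda images of \<open>a\<close>, \<open>b\<close>, \<open>c\<close>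
  are taken with arbitrary universal cocones \<open>i\<close>, \<open>j\<close>, \<open>k\<close>, which
  builds in closure under isomorphism. The colimit of the Yoneda image of \<open>\<Sigma> a\<close> is
  identified with \<open>\<Sigma> X\<close> along \<open>yoneda_shift\<close>, and \<open>(f, g, h)\<close> are the induced
  maps between the colimits.\<close>

definition completion_Tri ::
  "('o, 'm, 'x) tri_cat_scheme \<Rightarrow> ('m \<Rightarrow> 'u) \<Rightarrow> (nat \<Rightarrow> 'o set) \<Rightarrow>
   (('o, 'm, 'u) presheaf_map \<times> ('o, 'm, 'u) presheaf_map \<times> ('o, 'm, 'u) presheaf_map) set" where
  "completion_Tri T \<iota> B = {(f, g, h).
     \<exists>X \<in> completion_objs T \<iota> B. \<exists>Y \<in> completion_objs T \<iota> B. \<exists>Z \<in> completion_objs T \<iota> B.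
     \<exists>a \<alpha> b \<beta> c \<gamma> p q r i j k.
       f \<in> Hom (PMod T) X Y \<and> g \<in> Hom (PMod T) Y Z \<and>
       h \<in> Hom (PMod T) Z (omap (precomp T (unshift T)) X) \<and>
       good_cauchy T B a \<alpha> \<and> good_cauchy T B b \<beta> \<and> good_cauchy T B c \<gamma> \<and>
       good_cauchy T B (\<lambda>n. Sigma_obj T (a n)) (\<lambda>n. Sigma_arr T (\<alpha> n)) \<and>
       (\<forall>n. (p n, q n, r n) \<in> Tri T \<and>
            p n \<in> Hom T (a n) (b n) \<and> q n \<in> Hom T (b n) (c n) \<and>
            r n \<in> Hom T (c n) (Sigma_obj T (a n)) \<and>
            p (Suc n) \<cdot>\<^bsub>T\<^esub> \<alpha> n = \<beta> n \<cdot>\<^bsub>T\<^esub> p n \<and>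
            q (Suc n) \<cdot>\<^bsub>T\<^esub> \<beta> n = \<gamma> n \<cdot>\<^bsub>T\<^esub> q n \<and>
            r (Suc n) \<cdot>\<^bsub>T\<^esub> \<gamma> n = Sigma_arr T (\<alpha> n) \<cdot>\<^bsub>T\<^esub> r n) \<and>
       is_colimit (PMod T) (\<lambda>n. omap (yoneda T \<iota>) (a n)) (\<lambda>n. amap (yoneda T \<iota>) (\<alpha> n)) X i \<and>
       is_colimit (PMod T) (\<lambda>n. omap (yoneda T \<iota>) (b n)) (\<lambda>n. amap (yoneda T \<iota>) (\<beta> n)) Y j \<and>
       is_colimit (PMod T) (\<lambda>n. omap (yoneda T \<iota>) (c n)) (\<lambda>n. amap (yoneda T \<iota>) (\<gamma> n)) Z k \<and>
       (\<forall>n. f \<cdot>\<^bsub>PMod T\<^esub> i n = j n \<cdot>\<^bsub>PMod T\<^esub> amap (yoneda T \<iota>) (p n) \<and>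
            g \<cdot>\<^bsub>PMod T\<^esub> j n = k n \<cdot>\<^bsub>PMod T\<^esub> amap (yoneda T \<iota>) (q n) \<and>
            h \<cdot>\<^bsub>PMod T\<^esub> k n =
              amap (precomp T (unshift T)) (i n) \<cdot>\<^bsub>PMod T\<^esub> yoneda_shift T \<iota> (a n)
                \<cdot>\<^bsub>PMod T\<^esub> amap (yoneda T \<iota>) (r n))}"

definition completion ::
  "('o, 'm, 'x) tri_cat_scheme \<Rightarrow> ('m \<Rightarrow> 'u) \<Rightarrow> (nat \<Rightarrow> 'o set) \<Rightarrow>
   (('o, 'm, 'u) presheaf, ('o, 'm, 'u) presheaf_map) tri_cat" where
  "completion T \<iota> B = \<lparr>
     Obj = completion_objs T \<iota> B,
     Arr = {\<eta> \<in> Arr (PMod T). src \<eta> \<in> completion_objs T \<iota> B \<and> tgt \<eta> \<in> completion_objs T \<iota> B},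
     Dom = Dom (PMod T),
     Cod = Cod (PMod T),
     Ident = Ident (PMod T),
     Comp = Comp (PMod T),
     Add = Add (PMod T),
     Zero = Zero (PMod T),
     Shift = precomp T (unshift T),
     Tri = completion_Tri T \<iota> B\<rparr>"

end

theory Submission
  imports Defs
begin

text \<open>
  Write \<open>H\<^sup>*\<close> for precomposition with \<open>H\<close>. The equivalence results from two facts about an
  adjunction \<open>H \<stileturn> K\<close> between triangulated categories with metrics that \<open>H\<close> and \<open>K\<close>
  respect; it is applied to \<open>F \<stileturn> G\<close> and to \<open>G \<stileturn> J\<close>. Both pairs respect the metrics: \<open>G\<close>
  by definition of the preimage metric, \<open>F\<close> and \<open>J\<close> because full faithfulness makes
  \<open>G F\<close> and \<open>G J\<close> isomorphic to the identity.

  First, \<open>H\<^sup>*\<close> is a triangulated functor between the completions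
  (\<open>triangulated_functor_precomp\<close>). A presheaf \<open>X\<close> that is the colimit of a sequence of
  representables \<open>Hom(-, E n)\<close> is mapped to the colimit of the presheaves
  \<open>Hom(H -, E n) = Hom(-, K (E n))\<close>, and \<open>K\<close> preserves good Cauchy sequences and
  triangles. For this argument colimits in the category of presheaves are described by elements
  (\<open>presentation\<close>): \<open>X\<close> is the colimit precisely if there are compatible elements
  \<open>\<xi> n\<close> of \<open>X\<close> at \<open>E n\<close> such that every element of \<open>X\<close> is a restriction of some
  \<open>\<xi> n\<close>, and a restriction of \<open>\<xi> n\<close> vanishes only if it vanishes at a later stage of the
  sequence. That colimits have this form (\<open>is_colimit_presentation\<close>) follows from the
  construction of one colimit which has it and whose values are groups of elements of the given
  universe (\<open>ex_presentation\<close>). Compact support is preserved because \<open>H\<close> commutes with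
  shifts and respects the metrics.

  Secondly, \<open>F\<^sup>*\<close> and \<open>G\<^sup>*\<close> are mutually inverse (\<open>quasi_inverse_precomp\<close>).
  The unit of \<open>F \<stileturn> G\<close> is invertible, whence \<open>F\<^sup>* G\<^sup>*\<close> is isomorphic to the identity. The
  counit \<open>F G s \<rightarrow> s\<close> is in general not invertible, but \<open>G\<close> inverts it, so that \<open>G\<close>
  annihilates its cone, which therefore lies in every member of the preimage metric. An object
  \<open>X\<close> of the completion of \<open>S\<close> is compactly supported, so it vanishes on all shifts of
  this cone; and \<open>X\<close>, as a sequential colimit of representables, is cohomological. Hence
  \<open>X\<close> sends the counit to an isomorphism (\<open>bij_betw_act_if_cone\<close>), and
  \<open>G\<^sup>* F\<^sup>*\<close> is isomorphic to the identity as well.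
\<close>

section \<open>Arrows, isomorphisms and adjunctions\<close>

lemma Hom_iff: "f \<in> Hom C A B \<longleftrightarrow> f \<in> Arr C \<and> Dom C f = A \<and> Cod C f = B"
  by (simp add: Hom_def)

lemma HomD:
  assumes "f \<in> Hom C A B"
  shows "f \<in> Arr C" "Dom C f = A" "Cod C f = B"
  using assms by (simp_all add: Hom_iff)

definition isomorphic :: "('o, 'm, 'x) cat_scheme \<Rightarrow> 'o \<Rightarrow> 'o \<Rightarrow> bool" where
  "isomorphic C X Y \<longleftrightarrow> (\<exists>f \<in> Hom C X Y. iso_arr C f)"

lemma iso_arrE:
  assumes "iso_arr C f"
  obtains g where "g \<in> Arr C" "Dom C g = Cod C f" "Cod C g = Dom C f"
    "g \<cdot>\<^bsub>C\<^esub> f = Ident C (Dom C f)" "f \<cdot>\<^bsub>C\<^esub> g = Ident C (Cod C f)"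
  using assms unfolding iso_arr_def by (auto simp: Hom_iff)

lemma iso_arrI:
  assumes "f \<in> Arr C" "g \<in> Arr C" "Dom C g = Cod C f" "Cod C g = Dom C f"
    "g \<cdot>\<^bsub>C\<^esub> f = Ident C (Dom C f)" "f \<cdot>\<^bsub>C\<^esub> g = Ident C (Cod C f)"
  shows "iso_arr C f"
  using assms unfolding iso_arr_def by (auto simp: Hom_iff)

context category
begin

text \<open>The axioms in terms of domains and codomains: all side conditions can be discharged by
  rewriting.\<close>

lemma Dom_Obj [simp]: "f \<in> Arr C \<Longrightarrow> Dom C f \<in> Obj C"
  by (rule Dom_in_Obj)

lemma Cod_Obj [simp]: "f \<in> Arr C \<Longrightarrow> Cod C f \<in> Obj C"
  by (rule Cod_in_Obj)

lemma Hom_Obj: "f \<in> Hom C A B \<Longrightarrow> A \<in> Obj C" "f \<in> Hom C A B \<Longrightarrow> B \<in> Obj C"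
  by (auto simp: Hom_iff)

lemma Ident_arr [simp]:
  "A \<in> Obj C \<Longrightarrow> Ident C A \<in> Arr C"
  "A \<in> Obj C \<Longrightarrow> Dom C (Ident C A) = A"
  "A \<in> Obj C \<Longrightarrow> Cod C (Ident C A) = A"
  using Ident_in_Hom by (auto simp: Hom_iff)

lemma Comp_arr [simp]:
  assumes "f \<in> Arr C" "g \<in> Arr C" "Cod C f = Dom C g"
  shows "g \<cdot> f \<in> Arr C" "Dom C (g \<cdot> f) = Dom C f" "Cod C (g \<cdot> f) = Cod C g"
  using Comp_in_Hom[of f "Dom C f" "Cod C f" g "Cod C g"] assms by (auto simp: Hom_iff)

lemma Comp_Ident [simp]:
  "\<lbrakk>f \<in> Arr C; Dom C f = X\<rbrakk> \<Longrightarrow> f \<cdot> Ident C X = f"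
  "\<lbrakk>f \<in> Arr C; Cod C f = X\<rbrakk> \<Longrightarrow> Ident C X \<cdot> f = f"
  using Comp_Ident_right Comp_Ident_left by (auto simp: Hom_iff)

lemma assoc [simp]:
  "\<lbrakk>f \<in> Arr C; g \<in> Arr C; h \<in> Arr C; Cod C f = Dom C g; Cod C g = Dom C h\<rbrakk>
    \<Longrightarrow> (h \<cdot> g) \<cdot> f = h \<cdot> (g \<cdot> f)"
  using Comp_assoc[of f "Dom C f" "Cod C f" g "Cod C g" h "Cod C h"] by (auto simp: Hom_iff)

lemma iso_arr_Ident [simp]: "X \<in> Obj C \<Longrightarrow> iso_arr C (Ident C X)"
  by (rule iso_arrI[of _ _ "Ident C X"]) auto

lemma iso_arr_Comp:
  assumes "iso_arr C f" "iso_arr C g" "Cod C f = Dom C g"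
  shows "iso_arr C (g \<cdot> f)"
proof -
  from assms obtain f' where f': "f' \<in> Arr C" "Dom C f' = Cod C f" "Cod C f' = Dom C f"
    "f' \<cdot> f = Ident C (Dom C f)" "f \<cdot> f' = Ident C (Cod C f)"
    by (blast elim: iso_arrE)
  from assms obtain g' where g': "g' \<in> Arr C" "Dom C g' = Cod C g" "Cod C g' = Dom C g"
    "g' \<cdot> g = Ident C (Dom C g)" "g \<cdot> g' = Ident C (Cod C g)"
    by (blast elim: iso_arrE)
  have arr: "f \<in> Arr C" "g \<in> Arr C" using assms unfolding iso_arr_def by auto
  have "(f' \<cdot> g') \<cdot> (g \<cdot> f) = f' \<cdot> ((g' \<cdot> g) \<cdot> f)" using arr f'(1-3) g'(1-3) assms(3) by simp
  moreover have "(g \<cdot> f) \<cdot> (f' \<cdot> g') = g \<cdot> ((f \<cdot> f') \<cdot> g')"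
    using arr f'(1-3) g'(1-3) assms(3) by simp
  ultimately show ?thesis
    using arr f' g' assms(3) by (intro iso_arrI[of _ _ "f' \<cdot> g'"]) simp_all
qed

lemma iso_arr_inverse:
  assumes "iso_arr C f" "g \<in> Arr C" "Dom C g = Cod C f" "Cod C g = Dom C f"
    "g \<cdot> f = Ident C (Dom C f)" "f \<cdot> g = Ident C (Cod C f)"
  shows "iso_arr C g"
  using assms by (intro iso_arrI[of _ _ f]) (auto simp: iso_arr_def)

lemma isomorphic_refl: "X \<in> Obj C \<Longrightarrow> isomorphic C X X"
  unfolding isomorphic_def by (rule bexI[of _ "Ident C X"]) (auto simp: Hom_iff)

lemma isomorphic_sym: "isomorphic C X Y \<Longrightarrow> isomorphic C Y X"
  unfolding isomorphic_def Bex_def Hom_iff by (metis iso_arr_inverse iso_arrE)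

lemma isomorphic_trans: "isomorphic C X Y \<Longrightarrow> isomorphic C Y Z \<Longrightarrow> isomorphic C X Z"
  unfolding isomorphic_def Bex_def Hom_iff by (metis Comp_arr iso_arr_Comp)

lemma isomorphic_Obj: "isomorphic C X Y \<Longrightarrow> X \<in> Obj C \<and> Y \<in> Obj C"
  unfolding isomorphic_def by (auto simp: Hom_iff)

text \<open>Yoneda's criterion for isomorphisms, in its two forms.\<close>

lemma iso_arr_if_bij_post:
  assumes f: "f \<in> Hom C X Y"
    and inj: "\<And>u v. u \<in> Hom C X X \<Longrightarrow> v \<in> Hom C X X \<Longrightarrow> f \<cdot> u = f \<cdot> v \<Longrightarrow> u = v"
    and surj: "\<exists>u \<in> Hom C Y X. f \<cdot> u = Ident C Y"
  shows "iso_arr C f"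
proof -
  from surj obtain u where u: "u \<in> Hom C Y X" "f \<cdot> u = Ident C Y" by blast
  note a = HomD[OF f] HomD[OF u(1)]
  have o: "X \<in> Obj C" "Y \<in> Obj C" using f Hom_Obj by auto
  have "f \<cdot> (u \<cdot> f) = (f \<cdot> u) \<cdot> f" using a by simp
  also have "\<dots> = f \<cdot> Ident C X" using a u(2) o by simp
  finally have "u \<cdot> f = Ident C X"
    using a o by - (rule inj; auto simp: Hom_iff)
  with u a show ?thesis by (intro iso_arrI[of _ _ u]) auto
qed

lemma iso_arr_if_bij_pre:
  assumes f: "f \<in> Hom C X Y"
    and inj: "\<And>u v. u \<in> Hom C Y Y \<Longrightarrow> v \<in> Hom C Y Y \<Longrightarrow> u \<cdot> f = v \<cdot> f \<Longrightarrow> u = v"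
    and surj: "\<exists>u \<in> Hom C Y X. u \<cdot> f = Ident C X"
  shows "iso_arr C f"
proof -
  from surj obtain u where u: "u \<in> Hom C Y X" "u \<cdot> f = Ident C X" by blast
  note a = HomD[OF f] HomD[OF u(1)]
  have o: "X \<in> Obj C" "Y \<in> Obj C" using f Hom_Obj by auto
  have "(f \<cdot> u) \<cdot> f = f \<cdot> (u \<cdot> f)" using a by simp
  also have "\<dots> = Ident C Y \<cdot> f" using a u(2) o by simp
  finally have "f \<cdot> u = Ident C Y"
    using a o by - (rule inj; auto simp: Hom_iff)
  with u a show ?thesis by (intro iso_arrI[of _ _ u]) auto
qed

end

context cat_functor
begin

lemma omap_Obj [simp]: "A \<in> Obj C \<Longrightarrow> omap F A \<in> Obj D"
  by (rule omap_in_Obj)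

lemma amap_arr [simp]:
  assumes "f \<in> Arr C"
  shows "amap F f \<in> Arr D" "Dom D (amap F f) = omap F (Dom C f)"
    "Cod D (amap F f) = omap F (Cod C f)"
  using amap_in_Hom[of f "Dom C f" "Cod C f"] assms by (auto simp: Hom_iff)

lemma amap_Id [simp]: "A \<in> Obj C \<Longrightarrow> amap F (Ident C A) = Ident D (omap F A)"
  by (rule amap_Ident)

lemma amap_comp [simp]:
  "\<lbrakk>f \<in> Arr C; g \<in> Arr C; Cod C f = Dom C g\<rbrakk>
    \<Longrightarrow> amap F (g \<cdot>\<^bsub>C\<^esub> f) = amap F g \<cdot>\<^bsub>D\<^esub> amap F f"
  using amap_Comp[of f "Dom C f" "Cod C f" g "Cod C g"] by (auto simp: Hom_iff)

lemma amap_iso_arr: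
  assumes "iso_arr C f"
  shows "iso_arr D (amap F f)"
proof -
  from assms obtain g where g: "g \<in> Arr C" "Dom C g = Cod C f" "Cod C g = Dom C f"
    "g \<cdot>\<^bsub>C\<^esub> f = Ident C (Dom C f)" "f \<cdot>\<^bsub>C\<^esub> g = Ident C (Cod C f)"
    by (blast elim: iso_arrE)
  have f: "f \<in> Arr C" using assms unfolding iso_arr_def by simp
  from g f show ?thesis
    by (intro iso_arrI[of _ _ "amap F g"]) (auto simp flip: amap_comp)
qed

lemma omap_isomorphic: "isomorphic C X Y \<Longrightarrow> isomorphic D (omap F X) (omap F Y)"
  unfolding isomorphic_def using amap_iso_arr amap_in_Hom by blast

lemma chain_omap:
  assumes "chain C E e"
  shows "chain D (\<lambda>n. omap F (E n)) (\<lambda>n. amap F (e n))"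
  using assms amap_in_Hom unfolding chain_def by auto

lemma chain_map_amap:
  assumes "chain C E e"
  shows "chain_map C E e m k \<in> Hom C (E m) (E (m + k)) \<and>
    chain_map D (\<lambda>n. omap F (E n)) (\<lambda>n. amap F (e n)) m k = amap F (chain_map C E e m k)"
proof (induction k)
  case 0
  then show ?case using assms by (auto simp: chain_def Hom_iff)
next
  case (Suc k)
  have "e (m + k) \<in> Hom C (E (m + k)) (E (Suc (m + k)))"
    using assms unfolding chain_def by blast
  with Suc show ?case by (auto simp: Hom_iff)
qed

end

lemma cat_functor_comp:
  assumes "cat_functor C D F" "cat_functor D E G"
  shows "cat_functor C E (G \<circ>\<^sub>F F)"
proof -
  interpret F: cat_functor C D F by fact
  interpret G: cat_functor D E G by fact
  show ?thesis
    by unfold_locales (auto simp: func_comp_def Hom_iff)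
qed

lemma cat_functor_id: "category C \<Longrightarrow> cat_functor C C func_id"
  by (simp add: cat_functor_def cat_functor_axioms_def func_id_def)

context category
begin

lemma chain_map_Hom: "chain C E e \<Longrightarrow> chain_map C E e m k \<in> Hom C (E m) (E (m + k))"
  using cat_functor.chain_map_amap[OF cat_functor_id[OF category_axioms]] by blast

lemma chain_map_add:
  assumes "chain C E e"
  shows "chain_map C E e m (k + l) = chain_map C E e (m + k) l \<cdot> chain_map C E e m k"
proof (induction l)
  case 0
  then show ?case using chain_map_Hom[OF assms, of m k] by (auto simp: Hom_iff)
next
  case (Suc l)
  have "e (m + (k + l)) \<in> Hom C (E (m + (k + l))) (E (Suc (m + (k + l))))"
    using assms unfolding chain_def by blast
  then show ?case
    using Suc chain_map_Hom[OF assms, of m k] chain_map_Hom[OF assms, of "m + k" l]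
    by (auto simp: Hom_iff add.assoc)
qed

end

text \<open>Adjunctions are used in terms of unit and counit, which makes all identities equations
  between composites.\<close>

locale adjoint_pair = H: cat_functor C D H + K: cat_functor D C K
  for C :: "('o, 'm, 'x) cat_scheme" and D :: "('p, 'n, 'y) cat_scheme"
    and H :: "('o, 'm, 'p, 'n) func" and K :: "('p, 'n, 'o, 'm) func" +
  fixes \<eta> :: "'o \<Rightarrow> 'm" and \<epsilon> :: "'p \<Rightarrow> 'n"
  assumes unit_Hom: "A \<in> Obj C \<Longrightarrow> \<eta> A \<in> Hom C A (omap K (omap H A))"
    and counit_Hom: "X \<in> Obj D \<Longrightarrow> \<epsilon> X \<in> Hom D (omap H (omap K X)) X"
    and unit_natural: "u \<in> Arr C \<Longrightarrow> amap K (amap H u) \<cdot>\<^bsub>C\<^esub> \<eta> (Dom C u) = \<eta> (Cod C u) \<cdot>\<^bsub>C\<^esub> u"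
    and counit_natural:
      "v \<in> Arr D \<Longrightarrow> \<epsilon> (Cod D v) \<cdot>\<^bsub>D\<^esub> amap H (amap K v) = v \<cdot>\<^bsub>D\<^esub> \<epsilon> (Dom D v)"
    and triangle_left: "A \<in> Obj C \<Longrightarrow> \<epsilon> (omap H A) \<cdot>\<^bsub>D\<^esub> amap H (\<eta> A) = Ident D (omap H A)"
    and triangle_right: "X \<in> Obj D \<Longrightarrow> amap K (\<epsilon> X) \<cdot>\<^bsub>C\<^esub> \<eta> (omap K X) = Ident C (omap K X)"
begin

lemma unit_arr [simp]:
  assumes "A \<in> Obj C"
  shows "\<eta> A \<in> Arr C" "Dom C (\<eta> A) = A" "Cod C (\<eta> A) = omap K (omap H A)"
  using unit_Hom[OF assms] by (auto simp: Hom_iff)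

lemma counit_arr [simp]:
  assumes "X \<in> Obj D"
  shows "\<epsilon> X \<in> Arr D" "Dom D (\<epsilon> X) = omap H (omap K X)" "Cod D (\<epsilon> X) = X"
  using counit_Hom[OF assms] by (auto simp: Hom_iff)

lemma transpose_left:
  assumes "f \<in> Hom D (omap H A) X" "A \<in> Obj C"
  shows "\<epsilon> X \<cdot>\<^bsub>D\<^esub> amap H (amap K f \<cdot>\<^bsub>C\<^esub> \<eta> A) = f"
proof -
  note f = HomD[OF assms(1)]
  have X: "X \<in> Obj D" using f by auto
  have "\<epsilon> X \<cdot>\<^bsub>D\<^esub> amap H (amap K f \<cdot>\<^bsub>C\<^esub> \<eta> A)
    = (\<epsilon> X \<cdot>\<^bsub>D\<^esub> amap H (amap K f)) \<cdot>\<^bsub>D\<^esub> amap H (\<eta> A)"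
    using f X assms(2) by simp
  also have "\<dots> = f \<cdot>\<^bsub>D\<^esub> (\<epsilon> (omap H A) \<cdot>\<^bsub>D\<^esub> amap H (\<eta> A))"
    using f X assms(2) counit_natural[OF f(1)] by simp
  finally show ?thesis using f assms(2) triangle_left by simp
qed

lemma transpose_right:
  assumes "g \<in> Hom C A (omap K X)" "X \<in> Obj D"
  shows "amap K (\<epsilon> X \<cdot>\<^bsub>D\<^esub> amap H g) \<cdot>\<^bsub>C\<^esub> \<eta> A = g"
proof -
  note g = HomD[OF assms(1)]
  have A: "A \<in> Obj C" using g by auto
  have "amap K (\<epsilon> X \<cdot>\<^bsub>D\<^esub> amap H g) \<cdot>\<^bsub>C\<^esub> \<eta> A
    = amap K (\<epsilon> X) \<cdot>\<^bsub>C\<^esub> (amap K (amap H g) \<cdot>\<^bsub>C\<^esub> \<eta> A)"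
    using g A assms(2) by simp
  also have "\<dots> = (amap K (\<epsilon> X) \<cdot>\<^bsub>C\<^esub> \<eta> (omap K X)) \<cdot>\<^bsub>C\<^esub> g"
    using g A assms(2) unit_natural[OF g(1)] by simp
  finally show ?thesis using g assms(2) triangle_right by simp
qed

lemma transpose_inject:
  assumes "f \<in> Hom D (omap H A) X" "f' \<in> Hom D (omap H A) X" "A \<in> Obj C"
    and "amap K f \<cdot>\<^bsub>C\<^esub> \<eta> A = amap K f' \<cdot>\<^bsub>C\<^esub> \<eta> A"
  shows "f = f'"
  using assms transpose_left by metis

text \<open>If the left adjoint is fully faithful, then composition with the unit is bijective on Hom
  sets, because it corresponds to the action of the left adjoint; so the unit is invertible.\<close>

lemma unit_iso:
  assumes "fully_faithful C D H" "A \<in> Obj C"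
  shows "iso_arr C (\<eta> A)"
proof (rule H.C.iso_arr_if_bij_post)
  show "\<eta> A \<in> Hom C A (omap K (omap H A))" using unit_Hom assms(2) .
next
  fix u v assume uv: "u \<in> Hom C A A" "v \<in> Hom C A A" "\<eta> A \<cdot>\<^bsub>C\<^esub> u = \<eta> A \<cdot>\<^bsub>C\<^esub> v"
  note a = HomD[OF uv(1)] HomD[OF uv(2)]
  have "amap K (amap H u) \<cdot>\<^bsub>C\<^esub> \<eta> A = amap K (amap H v) \<cdot>\<^bsub>C\<^esub> \<eta> A"
    using unit_natural[of u] unit_natural[of v] a uv(3) by simp
  then have "amap H u = amap H v"
    using a assms(2) by - (rule transpose_inject; auto simp: Hom_iff)
  moreover have "inj_on (amap H) (Hom C A A)"
    using assms unfolding fully_faithful_def bij_betw_def by blast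
  ultimately show "u = v" using uv by (auto dest: inj_onD)
next
  let ?KH = "omap K (omap H A)"
  have "\<epsilon> (omap H A) \<in> amap H ` Hom C ?KH A"
    using assms counit_Hom[of "omap H A"] H.omap_Obj K.omap_Obj
    unfolding fully_faithful_def bij_betw_def by blast
  then obtain u where u: "u \<in> Hom C ?KH A" "amap H u = \<epsilon> (omap H A)" by force
  note a = HomD[OF u(1)]
  have "\<eta> A \<cdot>\<^bsub>C\<^esub> u = amap K (\<epsilon> (omap H A)) \<cdot>\<^bsub>C\<^esub> \<eta> ?KH"
    using unit_natural[of u] a u(2) by simp
  then have "\<eta> A \<cdot>\<^bsub>C\<^esub> u = Ident C ?KH" using triangle_right[of "omap H A"] assms(2) by simp
  then show "\<exists>u \<in> Hom C ?KH A. \<eta> A \<cdot>\<^bsub>C\<^esub> u = Ident C ?KH" using u(1) by blast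
qed

text \<open>Dually for the counit of a fully faithful right adjoint.\<close>

lemma counit_iso:
  assumes "fully_faithful D C K" "X \<in> Obj D"
  shows "iso_arr D (\<epsilon> X)"
proof (rule H.D.iso_arr_if_bij_pre)
  show "\<epsilon> X \<in> Hom D (omap H (omap K X)) X" using counit_Hom assms(2) .
next
  fix u v assume uv: "u \<in> Hom D X X" "v \<in> Hom D X X" "u \<cdot>\<^bsub>D\<^esub> \<epsilon> X = v \<cdot>\<^bsub>D\<^esub> \<epsilon> X"
  note a = HomD[OF uv(1)] HomD[OF uv(2)]
  have "\<epsilon> X \<cdot>\<^bsub>D\<^esub> amap H (amap K u) = \<epsilon> X \<cdot>\<^bsub>D\<^esub> amap H (amap K v)"
    using counit_natural[of u] counit_natural[of v] a uv(3) by simp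
  moreover have "amap K u \<in> Hom C (omap K X) (omap K X)" "amap K v \<in> Hom C (omap K X) (omap K X)"
    using uv K.amap_in_Hom by auto
  ultimately have "amap K u = amap K v"
    using transpose_right[of _ "omap K X" X] assms(2) by metis
  moreover have "inj_on (amap K) (Hom D X X)"
    using assms unfolding fully_faithful_def bij_betw_def by blast
  ultimately show "u = v" using uv by (auto dest: inj_onD)
next
  let ?HK = "omap H (omap K X)"
  have "\<eta> (omap K X) \<in> amap K ` Hom D X ?HK"
    using assms unit_Hom[of "omap K X"] H.omap_Obj K.omap_Obj
    unfolding fully_faithful_def bij_betw_def by blast
  then obtain u where u: "u \<in> Hom D X ?HK" "amap K u = \<eta> (omap K X)" by force
  note a = HomD[OF u(1)]
  have "u \<cdot>\<^bsub>D\<^esub> \<epsilon> X = \<epsilon> ?HK \<cdot>\<^bsub>D\<^esub> amap H (\<eta> (omap K X))"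
    using counit_natural[of u] a u(2) by simp
  then have "u \<cdot>\<^bsub>D\<^esub> \<epsilon> X = Ident D ?HK" using triangle_left[of "omap K X"] assms(2) by simp
  then show "\<exists>u \<in> Hom D X ?HK. u \<cdot>\<^bsub>D\<^esub> \<epsilon> X = Ident D ?HK" using u(1) by blast
qed

end

lemma left_adjoint_pair:
  assumes "left_adjoint C D H K"
  obtains \<eta> \<epsilon> where "adjoint_pair C D H K \<eta> \<epsilon>"
proof -
  from assms obtain \<Phi> where H: "cat_functor C D H" and K: "cat_functor D C K"
    and bij: "\<And>A B. A \<in> Obj C \<Longrightarrow> B \<in> Obj D \<Longrightarrow>
      bij_betw (\<Phi> A B) (Hom D (omap H A) B) (Hom C A (omap K B))"
    and nat: "\<And>A' A B B' f h k. f \<in> Hom C A' A \<Longrightarrow> h \<in> Hom D (omap H A) B \<Longrightarrow> k \<in> Hom D B B' \<Longrightarrow>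
      \<Phi> A' B' (k \<cdot>\<^bsub>D\<^esub> h \<cdot>\<^bsub>D\<^esub> amap H f) = amap K k \<cdot>\<^bsub>C\<^esub> \<Phi> A B h \<cdot>\<^bsub>C\<^esub> f"
    unfolding left_adjoint_def by blast
  interpret H: cat_functor C D H by fact
  interpret K: cat_functor D C K by fact
  define \<eta> where "\<eta> A = \<Phi> A (omap H A) (Ident D (omap H A))" for A
  define \<epsilon> where
    "\<epsilon> X = inv_into (Hom D (omap H (omap K X)) X) (\<Phi> (omap K X) X) (Ident C (omap K X))" for X
  have \<eta>: "\<eta> A \<in> Hom C A (omap K (omap H A))" if "A \<in> Obj C" for A
    using bij[OF that, of "omap H A"] that H.D.Ident_in_Hom[of "omap H A"]
    unfolding \<eta>_def by (auto simp: bij_betw_def)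
  have \<epsilon>: "\<epsilon> X \<in> Hom D (omap H (omap K X)) X" "\<Phi> (omap K X) X (\<epsilon> X) = Ident C (omap K X)"
    if "X \<in> Obj D" for X
  proof -
    have "Ident C (omap K X) \<in> \<Phi> (omap K X) X ` Hom D (omap H (omap K X)) X"
      using bij[of "omap K X" X] that H.C.Ident_in_Hom[of "omap K X"] by (auto simp: bij_betw_def)
    then show "\<epsilon> X \<in> Hom D (omap H (omap K X)) X" "\<Phi> (omap K X) X (\<epsilon> X) = Ident C (omap K X)"
      unfolding \<epsilon>_def by (auto intro: inv_into_into f_inv_into_f)
  qed
  have \<Phi>_Hom: "\<Phi> A X h \<in> Hom C A (omap K X)" if "h \<in> Hom D (omap H A) X" "A \<in> Obj C" for A X h
    using bij[OF that(2), of X] that H.D.Hom_Obj(2)[OF that(1)] by (auto simp: bij_betw_def)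
  have post: "\<Phi> A Y (k \<cdot>\<^bsub>D\<^esub> h) = amap K k \<cdot>\<^bsub>C\<^esub> \<Phi> A X h"
    if "h \<in> Hom D (omap H A) X" "k \<in> Hom D X Y" "A \<in> Obj C" for A X Y h k
    using nat[of "Ident C A" A A h X k Y] that H.C.Ident_in_Hom[of A]
      HomD[OF that(1)] HomD[OF that(2)] HomD[OF \<Phi>_Hom[OF that(1,3)]] by simp
  have pre: "\<Phi> A' X (h \<cdot>\<^bsub>D\<^esub> amap H f) = \<Phi> A X h \<cdot>\<^bsub>C\<^esub> f"
    if "h \<in> Hom D (omap H A) X" "f \<in> Hom C A' A" for A A' X h f
  proof -
    have A: "A \<in> Obj C" and X: "X \<in> Obj D" using that H.C.Hom_Obj H.D.Hom_Obj by blast+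
    show ?thesis
      using nat[of f A' A h X "Ident D X" X] that A X H.D.Ident_in_Hom[of X]
        HomD[OF that(1)] HomD[OF that(2)] HomD[OF \<Phi>_Hom[OF that(1) A]] by simp
  qed
  have \<Phi>_eq: "\<Phi> A X h = amap K h \<cdot>\<^bsub>C\<^esub> \<eta> A" if "h \<in> Hom D (omap H A) X" "A \<in> Obj C" for A X h
    using post[of "Ident D (omap H A)" A "omap H A" h X] that H.D.Ident_in_Hom[of "omap H A"]
      HomD[OF that(1)] unfolding \<eta>_def by simp
  have inj: "h = h'" if "h \<in> Hom D (omap H A) X" "h' \<in> Hom D (omap H A) X" "A \<in> Obj C"
    "\<Phi> A X h = \<Phi> A X h'" for A X h h'
    using bij[OF that(3), of X] that H.D.Hom_Obj(2)[OF that(1)]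
    by (auto simp: bij_betw_def dest: inj_onD)
  have "adjoint_pair C D H K \<eta> \<epsilon>"
  proof (unfold_locales)
    fix A assume "A \<in> Obj C" then show "\<eta> A \<in> Hom C A (omap K (omap H A))" by (rule \<eta>)
  next
    fix X assume "X \<in> Obj D" then show "\<epsilon> X \<in> Hom D (omap H (omap K X)) X" by (rule \<epsilon>)
  next
    fix u assume u: "u \<in> Arr C"
    let ?A = "Dom C u" and ?B = "Cod C u"
    have Hu: "amap H u \<in> Hom D (omap H ?A) (omap H ?B)" using u by (auto simp: Hom_iff)
    have "amap K (amap H u) \<cdot>\<^bsub>C\<^esub> \<eta> ?A = \<Phi> ?A (omap H ?B) (Ident D (omap H ?B) \<cdot>\<^bsub>D\<^esub> amap H u)"
      using \<Phi>_eq[OF Hu] u by simp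
    also have "\<dots> = \<eta> ?B \<cdot>\<^bsub>C\<^esub> u"
      unfolding \<eta>_def using u by - (rule pre; auto simp: Hom_iff)
    finally show "amap K (amap H u) \<cdot>\<^bsub>C\<^esub> \<eta> ?A = \<eta> ?B \<cdot>\<^bsub>C\<^esub> u" .
  next
    fix v assume v: "v \<in> Arr D"
    let ?X = "Dom D v" and ?Y = "Cod D v"
    note e = HomD[OF \<epsilon>(1)[of ?X]] HomD[OF \<epsilon>(1)[of ?Y]]
    have "\<Phi> (omap K ?X) ?Y (\<epsilon> ?Y \<cdot>\<^bsub>D\<^esub> amap H (amap K v)) = Ident C (omap K ?Y) \<cdot>\<^bsub>C\<^esub> amap K v"
      using pre[of "\<epsilon> ?Y" "omap K ?Y" ?Y "amap K v" "omap K ?X"] \<epsilon>[of ?Y] v by (simp add: Hom_iff)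
    moreover have "\<Phi> (omap K ?X) ?Y (v \<cdot>\<^bsub>D\<^esub> \<epsilon> ?X) = amap K v \<cdot>\<^bsub>C\<^esub> Ident C (omap K ?X)"
      using post[of "\<epsilon> ?X" "omap K ?X" ?X v ?Y] \<epsilon>[of ?X] v by (simp add: Hom_iff)
    ultimately show "\<epsilon> ?Y \<cdot>\<^bsub>D\<^esub> amap H (amap K v) = v \<cdot>\<^bsub>D\<^esub> \<epsilon> ?X"
      using v e by - (rule inj[of _ "omap K ?X" ?Y]; auto simp: Hom_iff)
  next
    fix A assume A: "A \<in> Obj C"
    note e = HomD[OF \<epsilon>(1)[of "omap H A"]] and h = HomD[OF \<eta>[OF A]]
    have "\<Phi> A (omap H A) (\<epsilon> (omap H A) \<cdot>\<^bsub>D\<^esub> amap H (\<eta> A)) = \<eta> A"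
      using pre[of "\<epsilon> (omap H A)" "omap K (omap H A)" "omap H A" "\<eta> A" A] \<epsilon>[of "omap H A"] \<eta>[OF A]
        A h by simp
    moreover have "\<Phi> A (omap H A) (Ident D (omap H A)) = \<eta> A" unfolding \<eta>_def ..
    ultimately show "\<epsilon> (omap H A) \<cdot>\<^bsub>D\<^esub> amap H (\<eta> A) = Ident D (omap H A)"
      using A e h by - (rule inj[of _ A "omap H A"]; auto simp: Hom_iff)
  next
    fix X assume X: "X \<in> Obj D"
    show "amap K (\<epsilon> X) \<cdot>\<^bsub>C\<^esub> \<eta> (omap K X) = Ident C (omap K X)"
      using \<Phi>_eq[OF \<epsilon>(1)[OF X]] \<epsilon>(2)[OF X] X by simp
  qed
  then show thesis by (rule that)
qed

section \<open>Additive categories\<close>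

definition Neg :: "('o, 'm, 'x) ab_cat_scheme \<Rightarrow> 'm \<Rightarrow> 'm" where
  "Neg C f = inv\<^bsub>hom_group C (Dom C f) (Cod C f)\<^esub> f"

context preadditive_category
begin

lemma Add_arr [simp]:
  assumes "f \<in> Arr C" "g \<in> Arr C" "Dom C f = Dom C g" "Cod C f = Cod C g"
  shows "Add C f g \<in> Arr C" "Dom C (Add C f g) = Dom C g" "Cod C (Add C f g) = Cod C g"
proof -
  interpret G: comm_group "hom_group C (Dom C g) (Cod C g)" using hom_group assms by simp
  show "Add C f g \<in> Arr C" "Dom C (Add C f g) = Dom C g" "Cod C (Add C f g) = Cod C g"
    using G.m_closed[of f g] assms by (auto simp: hom_group_def Hom_iff)
qed

lemma Zero_arr [simp]:
  assumes "A \<in> Obj C" "B \<in> Obj C"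
  shows "Zero C A B \<in> Arr C" "Dom C (Zero C A B) = A" "Cod C (Zero C A B) = B"
proof -
  interpret G: comm_group "hom_group C A B" using hom_group assms by simp
  show "Zero C A B \<in> Arr C" "Dom C (Zero C A B) = A" "Cod C (Zero C A B) = B"
    using G.one_closed assms by (auto simp: hom_group_def Hom_iff)
qed

lemma neg_arr [simp]:
  assumes "f \<in> Arr C"
  shows "Neg C f \<in> Arr C" "Dom C (Neg C f) = Dom C f" "Cod C (Neg C f) = Cod C f"
proof -
  interpret G: comm_group "hom_group C (Dom C f) (Cod C f)" using hom_group assms by simp
  show "Neg C f \<in> Arr C" "Dom C (Neg C f) = Dom C f" "Cod C (Neg C f) = Cod C f"
    using G.inv_closed[of f] assms by (auto simp: hom_group_def Hom_iff Neg_def)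
qed

lemma Add_laws:
  assumes "f \<in> Hom C A B" "g \<in> Hom C A B" "h \<in> Hom C A B"
  shows Add_commute: "Add C f g = Add C g f"
    and Add_assoc: "Add C (Add C f g) h = Add C f (Add C g h)"
    and Add_Zero_left: "Add C (Zero C A B) f = f"
    and Add_Zero_right: "Add C f (Zero C A B) = f"
    and Add_neg_left: "Add C (Neg C f) f = Zero C A B"
    and Add_neg_right: "Add C f (Neg C f) = Zero C A B"
    and Add_eq_right: "Add C f g = f \<Longrightarrow> g = Zero C A B"
    and Add_left_cancel: "Add C f g = Add C f h \<Longrightarrow> g = h"
proof -
  interpret G: comm_group "hom_group C A B" using hom_group assms Hom_Obj by blast
  have s [simp]: "carrier (hom_group C A B) = Hom C A B" "mult (hom_group C A B) = Add C"
    "one (hom_group C A B) = Zero C A B" by (simp_all add: hom_group_def)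
  have d: "Dom C f = A" "Cod C f = B" using assms(1) by (auto simp: Hom_iff)
  show "Add C f g = Add C g f" using G.m_comm[of f g] assms by simp
  show "Add C (Add C f g) h = Add C f (Add C g h)" using G.m_assoc[of f g h] assms by simp
  show "Add C (Zero C A B) f = f" using G.l_one[of f] assms by simp
  show "Add C f (Zero C A B) = f" using G.r_one[of f] assms by simp
  show "Add C (Neg C f) f = Zero C A B" using G.l_inv[of f] assms d by (simp add: Neg_def)
  show "Add C f (Neg C f) = Zero C A B" using G.r_inv[of f] assms d by (simp add: Neg_def)
  show "Add C f g = f \<Longrightarrow> g = Zero C A B" using G.l_cancel_one[of f g] assms by simp
  show "Add C f g = Add C f h \<Longrightarrow> g = h" using G.Units_l_cancel[of f g h] assms by simp
qed

lemma Comp_Zero_left [simp]: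
  assumes "f \<in> Arr C" "B \<in> Obj C" "Cod C f = A"
  shows "Zero C A B \<cdot> f = Zero C (Dom C f) B"
proof -
  let ?z = "Zero C (Cod C f) B"
  have z: "?z \<in> Hom C (Cod C f) B" "f \<in> Hom C (Dom C f) (Cod C f)"
    "?z \<cdot> f \<in> Hom C (Dom C f) B" using assms by (auto simp: Hom_iff)
  have "Add C ?z ?z = ?z" using z Add_Zero_left by blast
  then have "Add C (?z \<cdot> f) (?z \<cdot> f) = ?z \<cdot> f" using Comp_Add_left z by metis
  then show ?thesis using Add_eq_right z assms(3) by blast
qed

lemma Comp_Zero_right [simp]:
  assumes "f \<in> Arr C" "A \<in> Obj C" "Dom C f = B"
  shows "f \<cdot> Zero C A B = Zero C A (Cod C f)"
proof -
  let ?z = "Zero C A (Dom C f)"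
  have z: "?z \<in> Hom C A (Dom C f)" "f \<in> Hom C (Dom C f) (Cod C f)"
    "f \<cdot> ?z \<in> Hom C A (Cod C f)" using assms by (auto simp: Hom_iff)
  have "Add C ?z ?z = ?z" using z Add_Zero_left by blast
  then have "Add C (f \<cdot> ?z) (f \<cdot> ?z) = f \<cdot> ?z" using Comp_Add_right z by metis
  then show ?thesis using Add_eq_right z assms(3) by blast
qed

lemma neg_eqI:
  assumes "f \<in> Hom C A B" "g \<in> Hom C A B" "Add C f g = Zero C A B"
  shows "g = Neg C f"
proof -
  have "Neg C f \<in> Hom C A B" using assms(1) by (auto simp: Hom_iff)
  then show ?thesis using Add_left_cancel[OF assms(1,2)] Add_neg_right assms by metis
qed

lemma Comp_neg:
  assumes "f \<in> Arr C" "g \<in> Arr C" "Cod C f = Dom C g"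
  shows "Neg C g \<cdot> f = Neg C (g \<cdot> f)" "g \<cdot> Neg C f = Neg C (g \<cdot> f)"
proof -
  have h: "f \<in> Hom C (Dom C f) (Dom C g)" "g \<in> Hom C (Dom C g) (Cod C g)"
    "Neg C f \<in> Hom C (Dom C f) (Dom C g)" "Neg C g \<in> Hom C (Dom C g) (Cod C g)"
    "g \<cdot> f \<in> Hom C (Dom C f) (Cod C g)" "Neg C g \<cdot> f \<in> Hom C (Dom C f) (Cod C g)"
    "g \<cdot> Neg C f \<in> Hom C (Dom C f) (Cod C g)"
    using assms by (auto simp: Hom_iff)
  have "Add C (g \<cdot> f) (Neg C g \<cdot> f) = Add C g (Neg C g) \<cdot> f"
    using Comp_Add_left[OF h(1) h(2) h(4)] by simp
  also have "\<dots> = Zero C (Dom C f) (Cod C g)" using Add_neg_right[OF h(2)] h assms by simp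
  finally show "Neg C g \<cdot> f = Neg C (g \<cdot> f)" using neg_eqI h by simp
  have "Add C (g \<cdot> f) (g \<cdot> Neg C f) = g \<cdot> Add C f (Neg C f)"
    using Comp_Add_right[OF h(1) h(3) h(2)] by simp
  also have "\<dots> = Zero C (Dom C f) (Cod C g)" using Add_neg_right[OF h(1)] h assms by simp
  finally show "g \<cdot> Neg C f = Neg C (g \<cdot> f)" using neg_eqI h by simp
qed

lemma neg_neg: "f \<in> Arr C \<Longrightarrow> Neg C (Neg C f) = f"
  using neg_eqI[of "Neg C f" "Dom C f" "Cod C f" f] Add_neg_left[of f "Dom C f" "Cod C f"]
  by (simp add: Hom_iff)

lemma iso_arr_neg_Ident: "X \<in> Obj C \<Longrightarrow> iso_arr C (Neg C (Ident C X))"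
  using Comp_neg[of "Neg C (Ident C X)" "Ident C X"] neg_neg[of "Ident C X"]
  by (intro iso_arrI[of _ _ "Neg C (Ident C X)"]) simp_all

lemma zero_object_eq:
  assumes "zero_object C Z" "f \<in> Hom C A B" "g \<in> Hom C A B" "A = Z \<or> B = Z"
  shows "f = g"
  using assms Hom_Obj[OF assms(2)] unfolding zero_object_def by blast

end

lemma (in additive_functor) amap_Zero:
  assumes "preadditive_category C" "preadditive_category D" "A \<in> Obj C" "B \<in> Obj C"
  shows "amap F (Zero C A B) = Zero D (omap F A) (omap F B)"
proof -
  interpret PC: preadditive_category C by fact
  interpret PD: preadditive_category D by fact
  let ?z = "Zero C A B"
  have z: "?z \<in> Hom C A B" using assms by (auto simp: Hom_iff)
  have "Add D (amap F ?z) (amap F ?z) = amap F ?z"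
    using amap_Add[OF z z] PC.Add_Zero_left[OF z z z] by simp
  then show ?thesis using PD.Add_eq_right amap_in_Hom[OF z] by blast
qed

section \<open>The category of additive presheaves\<close>

locale presheaf_over = preadditive_category C + additive_presheaf C E
  for C :: "('o, 'm, 'x) ab_cat_scheme" (structure) and E :: "('o, 'm, 'u) presheaf"
begin

lemma act_closed [simp]:
  "\<lbrakk>f \<in> Arr C; x \<in> carrier (grp E (Cod C f)); Dom C f = A\<rbrakk> \<Longrightarrow> act E f x \<in> carrier (grp E A)"
  using act_hom[of f "Dom C f" "Cod C f"] by (auto simp: Hom_iff hom_def)

lemma act_comp [simp]:
  "\<lbrakk>f \<in> Arr C; g \<in> Arr C; Cod C f = Dom C g; x \<in> carrier (grp E (Cod C g))\<rbrakk>
    \<Longrightarrow> act E (g \<cdot> f) x = act E f (act E g x)"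
  using act_Comp[of f "Dom C f" "Cod C f" g "Cod C g"] by (auto simp: Hom_iff)

lemma act_Id [simp]: "\<lbrakk>A \<in> Obj C; x \<in> carrier (grp E A)\<rbrakk> \<Longrightarrow> act E (Ident C A) x = x"
  by (rule act_Ident)

lemma one_carrier [simp]: "A \<in> Obj C \<Longrightarrow> \<one>\<^bsub>grp E A\<^esub> \<in> carrier (grp E A)"
  using grp_comm_group comm_group.axioms(1) comm_monoid.axioms(1) monoid.one_closed by metis

lemma mult_carrier [simp]:
  "\<lbrakk>A \<in> Obj C; x \<in> carrier (grp E A); y \<in> carrier (grp E A)\<rbrakk>
    \<Longrightarrow> x \<otimes>\<^bsub>grp E A\<^esub> y \<in> carrier (grp E A)"
  using grp_comm_group comm_group.axioms(1) comm_monoid.axioms(1) monoid.m_closed by metis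

lemma act_mult [simp]:
  "\<lbrakk>f \<in> Arr C; Cod C f = B; x \<in> carrier (grp E B); y \<in> carrier (grp E B)\<rbrakk>
    \<Longrightarrow> act E f (x \<otimes>\<^bsub>grp E B\<^esub> y) = act E f x \<otimes>\<^bsub>grp E (Dom C f)\<^esub> act E f y"
  using act_hom[of f "Dom C f" "Cod C f"] by (auto simp: Hom_iff hom_def)

lemma act_one [simp]:
  assumes "f \<in> Arr C" "Cod C f = B"
  shows "act E f \<one>\<^bsub>grp E B\<^esub> = \<one>\<^bsub>grp E (Dom C f)\<^esub>"
proof -
  interpret A: comm_group "grp E (Dom C f)" using grp_comm_group assms by simp
  interpret B: comm_group "grp E B" using grp_comm_group assms by auto
  show ?thesis
    using hom_one[OF act_hom[of f "Dom C f" B] B.group_axioms A.group_axioms] assms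
    by (simp add: Hom_iff)
qed

lemma act_Add [simp]:
  "\<lbrakk>f \<in> Arr C; g \<in> Arr C; Dom C f = Dom C g; Cod C f = Cod C g; x \<in> carrier (grp E (Cod C g))\<rbrakk>
    \<Longrightarrow> act E (Add C f g) x = act E f x \<otimes>\<^bsub>grp E (Dom C g)\<^esub> act E g x"
  using additive_presheaf.act_Add[OF additive_presheaf_axioms, of f "Dom C g" "Cod C g" g x]
  by (auto simp: Hom_iff)

lemma act_Zero [simp]:
  assumes "A \<in> Obj C" "B \<in> Obj C" "x \<in> carrier (grp E B)"
  shows "act E (Zero C A B) x = \<one>\<^bsub>grp E A\<^esub>"
proof -
  interpret G: comm_group "grp E A" using grp_comm_group assms by simp
  let ?z = "Zero C A B"
  have z: "?z \<in> Hom C A B" using assms by (simp add: Hom_iff)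
  have "act E ?z x \<otimes>\<^bsub>grp E A\<^esub> act E ?z x = act E (Add C ?z ?z) x" using assms by simp
  also have "\<dots> = act E ?z x" using Add_Zero_left[OF z z z] by simp
  finally show ?thesis using G.l_cancel_one assms by simp
qed

lemma act_eqI:
  assumes "f \<in> Hom C A B" "g \<in> Hom C A B" "x \<in> carrier (grp E B)"
  shows "act E (Add C f (Neg C g)) x = \<one>\<^bsub>grp E A\<^esub> \<longleftrightarrow> act E f x = act E g x"
proof -
  note a = HomD[OF assms(1)] HomD[OF assms(2)]
  interpret G: comm_group "grp E A" using grp_comm_group a by auto
  have c: "act E f x \<in> carrier (grp E A)" "act E g x \<in> carrier (grp E A)"
    "act E (Neg C g) x \<in> carrier (grp E A)"
    using a assms(3) by simp_all
  have "act E (Neg C g) x \<otimes>\<^bsub>grp E A\<^esub> act E g x = act E (Add C (Neg C g) g) x"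
    using a assms(3) by simp
  also have "\<dots> = \<one>\<^bsub>grp E A\<^esub>" using Add_neg_left[OF assms(2,2,2)] a assms(3) by auto
  finally have "act E (Neg C g) x = inv\<^bsub>grp E A\<^esub> act E g x"
    using G.inv_equality c by simp
  moreover have "act E (Add C f (Neg C g)) x = act E f x \<otimes>\<^bsub>grp E A\<^esub> act E (Neg C g) x"
    using a assms(3) by simp
  ultimately show ?thesis
    using c G.inv_equality[of "act E f x" "inv\<^bsub>grp E A\<^esub> act E g x"] G.r_inv by auto
qed

end

text \<open>Natural transformations are built with \<open>mk_map\<close>, which restricts the given components to
  the carriers, as the extensionality axioms demand.\<close>

definition mk_map :: "('o, 'm, 'x) ab_cat_scheme \<Rightarrow> ('o, 'm, 'u) presheaf \<Rightarrow> ('o, 'm, 'u) presheaf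
    \<Rightarrow> ('o \<Rightarrow> 'u \<Rightarrow> 'u) \<Rightarrow> ('o, 'm, 'u) presheaf_map" where
  "mk_map C X Y c = \<lparr>src = X, tgt = Y, comps = \<lambda>A \<in> Obj C. \<lambda>x \<in> carrier (grp X A). c A x\<rparr>"

lemma mk_map_simps [simp]:
  "src (mk_map C X Y c) = X" "tgt (mk_map C X Y c) = Y"
  "\<lbrakk>A \<in> Obj C; x \<in> carrier (grp X A)\<rbrakk> \<Longrightarrow> comps (mk_map C X Y c) A x = c A x"
  by (simp_all add: mk_map_def)

lemma PMod_simps [simp]:
  "Obj (PMod C) = {E. additive_presheaf C E}"
  "Arr (PMod C) = {\<eta>. natural_transformation C \<eta>}"
  "Dom (PMod C) = src"
  "Cod (PMod C) = tgt"
  "Ident (PMod C) E = mk_map C E E (\<lambda>A x. x)"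
  "\<eta> \<cdot>\<^bsub>PMod C\<^esub> \<theta> = mk_map C (src \<theta>) (tgt \<eta>) (\<lambda>A x. comps \<eta> A (comps \<theta> A x))"
  "Add (PMod C) \<eta> \<theta> = mk_map C (src \<eta>) (tgt \<eta>)
    (\<lambda>A x. comps \<eta> A x \<otimes>\<^bsub>grp (tgt \<eta>) A\<^esub> comps \<theta> A x)"
  "Zero (PMod C) E E' = mk_map C E E' (\<lambda>A x. \<one>\<^bsub>grp E' A\<^esub>)"
  by (simp_all add: PMod_def mk_map_def)

lemma Hom_PMod_iff:
  "\<eta> \<in> Hom (PMod C) X Y \<longleftrightarrow> natural_transformation C \<eta> \<and> src \<eta> = X \<and> tgt \<eta> = Y"
  by (simp add: Hom_iff)

lemma presheaf_map_eqI:
  fixes \<eta> \<theta> :: "('o, 'm, 'u) presheaf_map"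
  assumes "\<eta> \<in> Hom (PMod C) X Y" "\<theta> \<in> Hom (PMod C) X Y"
    and "\<And>A x. A \<in> Obj C \<Longrightarrow> x \<in> carrier (grp X A) \<Longrightarrow> comps \<eta> A x = comps \<theta> A x"
  shows "\<eta> = \<theta>"
proof -
  interpret \<eta>: natural_transformation C \<eta> using assms by (simp add: Hom_PMod_iff)
  interpret \<theta>: natural_transformation C \<theta> using assms by (simp add: Hom_PMod_iff)
  have s: "src \<eta> = X" "src \<theta> = X" "tgt \<eta> = Y" "tgt \<theta> = Y" using assms by (auto simp: Hom_PMod_iff)
  have "comps \<eta> A = comps \<theta> A" if "A \<in> Obj C" for A
    using \<eta>.comps_extensional_carrier[OF that] \<theta>.comps_extensional_carrier[OF that] s assms(3)[OF that]
    by (metis extensionalityI)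
  then have "comps \<eta> = comps \<theta>"
    using \<eta>.comps_extensional \<theta>.comps_extensional by (metis extensionalityI)
  with s show ?thesis by simp
qed

lemma comps_closed:
  "\<lbrakk>\<eta> \<in> Hom (PMod C) X Y; A \<in> Obj C; x \<in> carrier (grp X A)\<rbrakk> \<Longrightarrow> comps \<eta> A x \<in> carrier (grp Y A)"
  using natural_transformation.comps_hom[of C \<eta> A] by (auto simp: Hom_PMod_iff hom_def)

lemma comps_mult:
  "\<lbrakk>\<eta> \<in> Hom (PMod C) X Y; A \<in> Obj C; x \<in> carrier (grp X A); y \<in> carrier (grp X A)\<rbrakk>
    \<Longrightarrow> comps \<eta> A (x \<otimes>\<^bsub>grp X A\<^esub> y) = comps \<eta> A x \<otimes>\<^bsub>grp Y A\<^esub> comps \<eta> A y"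
  using natural_transformation.comps_hom[of C \<eta> A] by (auto simp: Hom_PMod_iff hom_def)

lemma comps_natural:
  "\<lbrakk>\<eta> \<in> Hom (PMod C) X Y; f \<in> Arr C; Dom C f = A; Cod C f = B; x \<in> carrier (grp X B)\<rbrakk>
    \<Longrightarrow> comps \<eta> A (act X f x) = act Y f (comps \<eta> B x)"
  using natural_transformation.natural[of C \<eta> f "Dom C f" "Cod C f" x]
  by (auto simp: Hom_PMod_iff Hom_iff)

lemma mk_map_Hom:
  assumes "preadditive_category C" "additive_presheaf C X" "additive_presheaf C Y"
    and "\<And>A x. A \<in> Obj C \<Longrightarrow> x \<in> carrier (grp X A) \<Longrightarrow> c A x \<in> carrier (grp Y A)"
    and "\<And>A x y. A \<in> Obj C \<Longrightarrow> x \<in> carrier (grp X A) \<Longrightarrow> y \<in> carrier (grp X A) \<Longrightarrow>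
      c A (x \<otimes>\<^bsub>grp X A\<^esub> y) = c A x \<otimes>\<^bsub>grp Y A\<^esub> c A y"
    and "\<And>f x. f \<in> Arr C \<Longrightarrow> x \<in> carrier (grp X (Cod C f)) \<Longrightarrow>
      c (Dom C f) (act X f x) = act Y f (c (Cod C f) x)"
  shows "mk_map C X Y c \<in> Hom (PMod C) X Y"
proof -
  interpret X: presheaf_over C X using assms by (simp add: presheaf_over_def)
  interpret Y: presheaf_over C Y using assms by (simp add: presheaf_over_def)
  have "natural_transformation C (mk_map C X Y c)"
  proof (rule natural_transformation.intro)
    fix A assume "A \<in> Obj C"
    then show "comps (mk_map C X Y c) A
      \<in> hom (grp (src (mk_map C X Y c)) A) (grp (tgt (mk_map C X Y c)) A)"
      using assms(4,5) by (auto simp: hom_def)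
  next
    fix f A B x
    assume "f \<in> Hom C A B" "x \<in> carrier (grp (src (mk_map C X Y c)) B)"
    then show "comps (mk_map C X Y c) A (act (src (mk_map C X Y c)) f x) =
      act (tgt (mk_map C X Y c)) f (comps (mk_map C X Y c) B x)"
      using assms(6) by (auto simp: Hom_iff)
  qed (use assms in \<open>auto simp: mk_map_def\<close>)
  then show ?thesis by (simp add: Hom_PMod_iff)
qed

lemma presheaf_over_src_tgt:
  assumes "preadditive_category C" "\<eta> \<in> Hom (PMod C) X Y"
  shows "presheaf_over C X" "presheaf_over C Y"
  using assms natural_transformation.src natural_transformation.tgt
  by (auto simp: presheaf_over_def Hom_PMod_iff)

lemma PMod_Comp_Hom:
  assumes "preadditive_category C" "\<theta> \<in> Hom (PMod C) X Y" "\<eta> \<in> Hom (PMod C) Y Z"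
  shows "\<eta> \<cdot>\<^bsub>PMod C\<^esub> \<theta> \<in> Hom (PMod C) X Z"
proof -
  interpret X: presheaf_over C X using presheaf_over_src_tgt assms by blast
  interpret Y: presheaf_over C Y using presheaf_over_src_tgt assms by blast
  interpret Z: presheaf_over C Z using presheaf_over_src_tgt assms by blast
  have "src \<theta> = X" "tgt \<eta> = Z" using assms by (simp_all add: Hom_PMod_iff)
  then show ?thesis
    using assms comps_closed[OF assms(2)] comps_closed[OF assms(3)]
      comps_mult[OF assms(2)] comps_mult[OF assms(3)]
      comps_natural[OF assms(2)] comps_natural[OF assms(3)]
      X.additive_presheaf_axioms Z.additive_presheaf_axioms
    by (simp, intro mk_map_Hom) auto
qed

lemma comps_Comp:
  assumes "\<theta> \<in> Hom (PMod C) X Y" "A \<in> Obj C" "x \<in> carrier (grp X A)"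
  shows "comps (\<eta> \<cdot>\<^bsub>PMod C\<^esub> \<theta>) A x = comps \<eta> A (comps \<theta> A x)"
  using assms by (auto simp: Hom_PMod_iff)

lemma comps_Ident: "\<lbrakk>A \<in> Obj C; x \<in> carrier (grp X A)\<rbrakk> \<Longrightarrow> comps (Ident (PMod C) X) A x = x"
  by simp

lemma PMod_Ident_Hom:
  assumes "preadditive_category C" "additive_presheaf C X"
  shows "Ident (PMod C) X \<in> Hom (PMod C) X X"
proof -
  interpret X: presheaf_over C X using assms by (simp add: presheaf_over_def)
  show ?thesis using assms by (simp, intro mk_map_Hom) auto
qed

lemma PMod_Add_Hom:
  assumes "preadditive_category C" "\<theta> \<in> Hom (PMod C) X Y" "\<eta> \<in> Hom (PMod C) X Y"
  shows "Add (PMod C) \<theta> \<eta> \<in> Hom (PMod C) X Y"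
proof -
  interpret X: presheaf_over C X using presheaf_over_src_tgt assms by blast
  interpret Y: presheaf_over C Y using presheaf_over_src_tgt assms by blast
  have s: "src \<theta> = X" "tgt \<theta> = Y" using assms by (simp_all add: Hom_PMod_iff)
  show ?thesis
    unfolding PMod_simps s
  proof (rule mk_map_Hom)
    fix A x y assume h: "A \<in> Obj C" "x \<in> carrier (grp X A)" "y \<in> carrier (grp X A)"
    interpret G: comm_group "grp Y A" using h Y.grp_comm_group by simp
    note c = comps_closed[OF assms(2) h(1,2)] comps_closed[OF assms(2) h(1,3)]
      comps_closed[OF assms(3) h(1,2)] comps_closed[OF assms(3) h(1,3)]
    show "comps \<theta> A (x \<otimes>\<^bsub>grp X A\<^esub> y) \<otimes>\<^bsub>grp Y A\<^esub> comps \<eta> A (x \<otimes>\<^bsub>grp X A\<^esub> y) =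
      comps \<theta> A x \<otimes>\<^bsub>grp Y A\<^esub> comps \<eta> A x \<otimes>\<^bsub>grp Y A\<^esub> (comps \<theta> A y \<otimes>\<^bsub>grp Y A\<^esub> comps \<eta> A y)"
      using c by (simp add: comps_mult[OF assms(2) h] comps_mult[OF assms(3) h] G.m_ac)
  qed (use assms X.additive_presheaf_axioms Y.additive_presheaf_axioms
        comps_closed[OF assms(2)] comps_closed[OF assms(3)]
        comps_natural[OF assms(2)] comps_natural[OF assms(3)] in auto)
qed

lemma category_PMod:
  assumes "preadditive_category C"
  shows "category (PMod C)"
proof
  fix f assume "f \<in> Arr (PMod C)"
  then show "Dom (PMod C) f \<in> Obj (PMod C)" "Cod (PMod C) f \<in> Obj (PMod C)"
    using natural_transformation.src natural_transformation.tgt by auto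
next
  fix X assume "X \<in> Obj (PMod C)"
  then show "Ident (PMod C) X \<in> Hom (PMod C) X X" using PMod_Ident_Hom[OF assms] by simp
next
  fix f X Y g Z assume h: "f \<in> Hom (PMod C) X Y" "g \<in> Hom (PMod C) Y Z"
  then show "g \<cdot>\<^bsub>PMod C\<^esub> f \<in> Hom (PMod C) X Z" by (rule PMod_Comp_Hom[OF assms])
next
  fix f X Y assume h: "f \<in> Hom (PMod C) X Y"
  note p = presheaf_over_src_tgt[OF assms h]
  note i = PMod_Ident_Hom[OF assms presheaf_over.axioms(2)]
  show "f \<cdot>\<^bsub>PMod C\<^esub> Ident (PMod C) X = f"
    by (rule presheaf_map_eqI[OF PMod_Comp_Hom[OF assms i[OF p(1)] h] h])
      (simp add: comps_Comp[OF i[OF p(1)]] comps_Ident del: PMod_simps(5,6))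
  show "Ident (PMod C) Y \<cdot>\<^bsub>PMod C\<^esub> f = f"
    by (rule presheaf_map_eqI[OF PMod_Comp_Hom[OF assms h i[OF p(2)]] h])
      (simp add: comps_Comp[OF h] comps_closed[OF h] comps_Ident del: PMod_simps(5,6))
next
  fix f W X g Y h Z
  assume h: "f \<in> Hom (PMod C) W X" "g \<in> Hom (PMod C) X Y" "h \<in> Hom (PMod C) Y Z"
  note gf = PMod_Comp_Hom[OF assms h(1,2)] and hg = PMod_Comp_Hom[OF assms h(2,3)]
  show "h \<cdot>\<^bsub>PMod C\<^esub> (g \<cdot>\<^bsub>PMod C\<^esub> f) = h \<cdot>\<^bsub>PMod C\<^esub> g \<cdot>\<^bsub>PMod C\<^esub> f"
    by (rule presheaf_map_eqI[OF PMod_Comp_Hom[OF assms gf h(3)] PMod_Comp_Hom[OF assms h(1) hg]])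
      (simp add: comps_Comp[OF h(1)] comps_Comp[OF gf] comps_Comp[OF h(2)] comps_closed[OF h(1)]
         del: PMod_simps(5,6))
qed

text \<open>A natural transformation is invertible as soon as its components are bijective: the inverse
  maps are automatically additive and natural.\<close>

lemma iso_arr_PModI:
  assumes C: "preadditive_category C" and \<eta>: "\<eta> \<in> Hom (PMod C) X Y"
    and bij: "\<And>A. A \<in> Obj C \<Longrightarrow> bij_betw (comps \<eta> A) (carrier (grp X A)) (carrier (grp Y A))"
  shows "iso_arr (PMod C) \<eta>"
proof -
  interpret X: presheaf_over C X using presheaf_over_src_tgt C \<eta> by blast
  interpret Y: presheaf_over C Y using presheaf_over_src_tgt C \<eta> by blast
  define c where "c A = inv_into (carrier (grp X A)) (comps \<eta> A)" for A
  have c: "c A y \<in> carrier (grp X A)" "comps \<eta> A (c A y) = y"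
    if "A \<in> Obj C" "y \<in> carrier (grp Y A)" for A y
    using bij[OF that(1)] that(2) unfolding c_def bij_betw_def
    by (metis inv_into_into, metis f_inv_into_f)
  have c': "c A (comps \<eta> A x) = x" if "A \<in> Obj C" "x \<in> carrier (grp X A)" for A x
    using bij[OF that(1)] that(2) unfolding c_def bij_betw_def by simp
  have \<theta>: "mk_map C Y X c \<in> Hom (PMod C) Y X" (is "?\<theta> \<in> _")
  proof (rule mk_map_Hom)
    fix A x y assume h: "A \<in> Obj C" "x \<in> carrier (grp Y A)" "y \<in> carrier (grp Y A)"
    have "comps \<eta> A (c A x \<otimes>\<^bsub>grp X A\<^esub> c A y) = x \<otimes>\<^bsub>grp Y A\<^esub> y"
      using c h comps_mult[OF \<eta>] by simp
    then show "c A (x \<otimes>\<^bsub>grp Y A\<^esub> y) = c A x \<otimes>\<^bsub>grp X A\<^esub> c A y"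
      using c' c h X.mult_carrier by metis
  next
    fix f x assume h: "f \<in> Arr C" "x \<in> carrier (grp Y (Cod C f))"
    have "comps \<eta> (Dom C f) (act X f (c (Cod C f) x)) = act Y f x"
      using c h comps_natural[OF \<eta>] by simp
    then show "c (Dom C f) (act Y f x) = act X f (c (Cod C f) x)"
      using c'[of "Dom C f" "act X f (c (Cod C f) x)"] c h by simp
  qed (use C X.additive_presheaf_axioms Y.additive_presheaf_axioms c in auto)
  have s: "src \<eta> = X" "tgt \<eta> = Y" using \<eta> by (simp_all add: Hom_PMod_iff)
  have "?\<theta> \<cdot>\<^bsub>PMod C\<^esub> \<eta> = Ident (PMod C) X"
    by (rule presheaf_map_eqI[OF PMod_Comp_Hom[OF C \<eta> \<theta>] PMod_Ident_Hom[OF C X.additive_presheaf_axioms]])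
      (simp add: comps_Comp[OF \<eta>] c' comps_closed[OF \<eta>] comps_Ident del: PMod_simps(5,6))
  moreover have "\<eta> \<cdot>\<^bsub>PMod C\<^esub> ?\<theta> = Ident (PMod C) Y"
    by (rule presheaf_map_eqI[OF PMod_Comp_Hom[OF C \<theta> \<eta>] PMod_Ident_Hom[OF C Y.additive_presheaf_axioms]])
      (simp add: comps_Comp[OF \<theta>] c comps_Ident del: PMod_simps(5,6))
  ultimately show ?thesis
    unfolding iso_arr_def using \<eta> \<theta> s by (auto simp: Hom_PMod_iff simp del: PMod_simps(5,6))
qed

lemma additive_functor_precomp:
  assumes C: "preadditive_category C" and D: "preadditive_category D" and H: "additive_functor C D H"
  shows "additive_functor (PMod D) (PMod C) (precomp C H)"
    and "additive_presheaf D E \<Longrightarrow> additive_presheaf C (presheaf_comp C H E)"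
proof -
  interpret H: additive_functor C D H by fact
  interpret PC: category "PMod C" by (rule category_PMod[OF C])
  interpret PD: category "PMod D" by (rule category_PMod[OF D])
  have obj: "additive_presheaf C (presheaf_comp C H E)" if "additive_presheaf D E" for E
  proof -
    interpret E: presheaf_over D E using that D by (simp add: presheaf_over_def)
    interpret C: preadditive_category C by fact
    have "act E (amap H f) \<in> hom (grp E (omap H (Cod C f))) (grp E (omap H (Dom C f)))"
      "act E (amap H f) \<in> extensional (carrier (grp E (omap H (Cod C f))))"
      if "f \<in> Arr C" for f
      using that E.act_hom[OF H.amap_in_Hom] E.act_extensional_carrier[OF H.amap_in_Hom]
      by (auto simp: Hom_iff)
    then show ?thesis
      using E.grp_comm_group H.amap_Add
      by (intro additive_presheaf.intro) (auto simp: presheaf_comp_def Hom_iff)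
  qed
  show "additive_presheaf D E \<Longrightarrow> additive_presheaf C (presheaf_comp C H E)" by (rule obj)
  have eq: "amap (precomp C H) \<eta> =
      mk_map C (presheaf_comp C H X) (presheaf_comp C H Y) (\<lambda>A. comps \<eta> (omap H A))"
    if "\<eta> \<in> Hom (PMod D) X Y" for \<eta> X Y
  proof -
    have "comps \<eta> (omap H A) = (\<lambda>x \<in> carrier (grp X (omap H A)). comps \<eta> (omap H A) x)"
      if "A \<in> Obj C" for A
      using \<open>\<eta> \<in> Hom (PMod D) X Y\<close> natural_transformation.comps_extensional_carrier[of D \<eta> "omap H A"] that
      by (auto simp: Hom_PMod_iff extensional_restrict)
    then show ?thesis using that
      by (auto simp: precomp_def mk_map_def Hom_PMod_iff presheaf_comp_def cong: restrict_cong)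
  qed
  have arr: "amap (precomp C H) \<eta> \<in> Hom (PMod C) (presheaf_comp C H X) (presheaf_comp C H Y)"
    if \<eta>: "\<eta> \<in> Hom (PMod D) X Y" for \<eta> X Y
  proof -
    interpret X: presheaf_over D X using presheaf_over_src_tgt D that by blast
    interpret Y: presheaf_over D Y using presheaf_over_src_tgt D that by blast
    show ?thesis
      unfolding eq[OF that] using C obj X.additive_presheaf_axioms Y.additive_presheaf_axioms
        comps_closed[OF \<eta>] comps_mult[OF \<eta>] comps_natural[OF \<eta>]
      by (intro mk_map_Hom) (auto simp: presheaf_comp_def)
  qed
  have app: "comps (amap (precomp C H) \<eta>) A x = comps \<eta> (omap H A) x" if "A \<in> Obj C" for \<eta> A x
    using that by (simp add: precomp_def)
  have car: "carrier (grp (presheaf_comp C H X) A) = carrier (grp X (omap H A))" if "A \<in> Obj C" for A X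
    using that by (simp add: presheaf_comp_def)
  show "additive_functor (PMod D) (PMod C) (precomp C H)"
  proof (unfold_locales)
    fix X assume "X \<in> Obj (PMod D)"
    then show "omap (precomp C H) X \<in> Obj (PMod C)" using obj by (simp add: precomp_def)
  next
    fix \<eta> X Y assume h: "\<eta> \<in> Hom (PMod D) X Y"
    show "amap (precomp C H) \<eta> \<in> Hom (PMod C) (omap (precomp C H) X) (omap (precomp C H) Y)"
      using arr[OF h] by (simp add: precomp_def)
  next
    fix X assume "X \<in> Obj (PMod D)"
    then have X: "additive_presheaf D X" by simp
    have "amap (precomp C H) (Ident (PMod D) X) = Ident (PMod C) (presheaf_comp C H X)"
      by (rule presheaf_map_eqI[OF arr[OF PMod_Ident_Hom[OF D X]] PMod_Ident_Hom[OF C obj[OF X]]])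
        (simp add: app car)
    then show "amap (precomp C H) (Ident (PMod D) X) = Ident (PMod C) (omap (precomp C H) X)"
      by (simp add: precomp_def del: PMod_simps)
  next
    fix \<eta> X Y \<theta> Z assume h: "\<eta> \<in> Hom (PMod D) X Y" "\<theta> \<in> Hom (PMod D) Y Z"
    show "amap (precomp C H) (\<theta> \<cdot>\<^bsub>PMod D\<^esub> \<eta>) = amap (precomp C H) \<theta> \<cdot>\<^bsub>PMod C\<^esub> amap (precomp C H) \<eta>"
      by (rule presheaf_map_eqI[OF arr[OF PMod_Comp_Hom[OF D h]] PMod_Comp_Hom[OF C arr[OF h(1)] arr[OF h(2)]]])
        (simp add: app car comps_Comp[OF arr[OF h(1)]] comps_Comp[OF h(1)] del: PMod_simps)
  next
    fix \<eta> X Y \<theta> assume h: "\<eta> \<in> Hom (PMod D) X Y" "\<theta> \<in> Hom (PMod D) X Y"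
    have s: "src \<eta> = X" "tgt \<eta> = Y" using h by (simp_all add: Hom_PMod_iff)
    show "amap (precomp C H) (Add (PMod D) \<eta> \<theta>)
      = Add (PMod C) (amap (precomp C H) \<eta>) (amap (precomp C H) \<theta>)"
      by (rule presheaf_map_eqI[OF arr[OF PMod_Add_Hom[OF D h]] PMod_Add_Hom[OF C arr[OF h(1)] arr[OF h(2)]]])
        (use arr[OF h(1)] s in \<open>simp add: app car Hom_PMod_iff\<close>, simp add: presheaf_comp_def)
  qed
qed

lemma presheaf_comp_simps [simp]:
  "A \<in> Obj C \<Longrightarrow> grp (presheaf_comp C H E) A = grp E (omap H A)"
  "f \<in> Arr C \<Longrightarrow> act (presheaf_comp C H E) f = act E (amap H f)"
  by (simp_all add: presheaf_comp_def)

lemma precomp_simps [simp]: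
  "omap (precomp C H) = presheaf_comp C H"
  "A \<in> Obj C \<Longrightarrow> comps (amap (precomp C H) \<eta>) A = comps \<eta> (omap H A)"
  by (simp_all add: precomp_def)

section \<open>The Yoneda embedding\<close>

locale small_category = preadditive_category C
  for C :: "('o, 'm, 'x) ab_cat_scheme" (structure) and \<iota> :: "'m \<Rightarrow> 'u" +
  assumes small: "locally_small C \<iota>"
begin

lemma inj: "\<lbrakk>A \<in> Obj C; B \<in> Obj C\<rbrakk> \<Longrightarrow> inj_on \<iota> (Hom C A B)"
  using small unfolding locally_small_def by blast

abbreviation yo where "yo X \<equiv> yoneda_obj C \<iota> X"

lemma inv_\<iota>: "f \<in> Hom C A B \<Longrightarrow> inv_into (Hom C A B) \<iota> (\<iota> f) = f"
  using inj Hom_Obj by (metis inv_into_f_f)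

lemma yo_carrier: "A \<in> Obj C \<Longrightarrow> carrier (grp (yo X) A) = \<iota> ` Hom C A X"
  by (simp add: yoneda_obj_def image_group_def hom_group_def)

lemma yo_one: "A \<in> Obj C \<Longrightarrow> \<one>\<^bsub>grp (yo X) A\<^esub> = \<iota> (Zero C A X)"
  by (simp add: yoneda_obj_def image_group_def hom_group_def)

lemma yo_mult:
  "\<lbrakk>f \<in> Hom C A X; g \<in> Hom C A X\<rbrakk> \<Longrightarrow> \<iota> f \<otimes>\<^bsub>grp (yo X) A\<^esub> \<iota> g = \<iota> (Add C f g)"
  using Hom_Obj(1) by (simp add: yoneda_obj_def image_group_def hom_group_def inv_\<iota>)

lemma yo_act: "\<lbrakk>f \<in> Arr C; g \<in> Hom C (Cod C f) X\<rbrakk> \<Longrightarrow> act (yo X) f (\<iota> g) = \<iota> (g \<cdot> f)"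
  by (simp add: yoneda_obj_def inv_\<iota>)

lemma additive_presheaf_yo:
  assumes "X \<in> Obj C"
  shows "additive_presheaf C (yo X)"
proof (rule additive_presheaf.intro)
  fix A assume A: "A \<in> Obj C"
  have Hom_Add: "Add C f g \<in> Hom C A X" if "f \<in> Hom C A X" "g \<in> Hom C A X" for f g
    using that by (auto simp: Hom_iff)
  have Hom_neg: "Neg C f \<in> Hom C A X" if "f \<in> Hom C A X" for f using that by (auto simp: Hom_iff)
  have zero: "Zero C A X \<in> Hom C A X" using A assms by (simp add: Hom_iff)
  show "comm_group (grp (yo X) A)"
  proof (rule comm_groupI)
    fix x assume "x \<in> carrier (grp (yo X) A)"
    then obtain f where f: "f \<in> Hom C A X" "x = \<iota> f" using A yo_carrier by auto
    then show "\<exists>y \<in> carrier (grp (yo X) A). y \<otimes>\<^bsub>grp (yo X) A\<^esub> x = \<one>\<^bsub>grp (yo X) A\<^esub>"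
      using A yo_carrier yo_mult yo_one Hom_neg Add_neg_left[OF f(1,1,1)]
      by (intro bexI[of _ "\<iota> (Neg C f)"]) auto
  qed (use A yo_carrier yo_mult yo_one Hom_Add zero Add_assoc Add_commute Add_Zero_left Add_Zero_right in
      \<open>auto 4 4\<close>)
next
  fix f A B assume f: "f \<in> Hom C A B"
  note o = Hom_Obj[OF f] and a = HomD[OF f]
  have [simp]: "g \<cdot> f \<in> Hom C A X" if "g \<in> Hom C B X" for g
    using Comp_in_Hom f that by blast
  have [simp]: "Add C g h \<in> Hom C B X" if "g \<in> Hom C B X" "h \<in> Hom C B X" for g h
    using that by (auto simp: Hom_iff)
  show "act (yo X) f \<in> hom (grp (yo X) B) (grp (yo X) A)"
    using o a f
    by (auto simp: hom_def yo_carrier yo_mult yo_act Comp_Add_left intro!: imageI intro: Comp_in_Hom)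
  show "act (yo X) f \<in> extensional (carrier (grp (yo X) B))"
    using o a by (simp add: yoneda_obj_def image_group_def hom_group_def)
next
  fix A x assume "A \<in> Obj C" "x \<in> carrier (grp (yo X) A)"
  then show "act (yo X) (Ident C A) x = x"
    by (auto simp: yo_carrier yo_act Comp_Ident_right)
next
  fix f A B g D x assume h: "f \<in> Hom C A B" "g \<in> Hom C B D" "x \<in> carrier (grp (yo X) D)"
  then obtain k where k: "k \<in> Hom C D X" "x = \<iota> k" using Hom_Obj yo_carrier by auto
  have "k \<cdot> g \<in> Hom C B X" using Comp_in_Hom h k by blast
  with h k HomD[OF h(1)] HomD[OF h(2)] HomD[OF k(1)]
  show "act (yo X) (g \<cdot> f) x = act (yo X) f (act (yo X) g x)"
    by (simp add: yo_act)
next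
  fix f A B g x assume h: "f \<in> Hom C A B" "g \<in> Hom C A B" "x \<in> carrier (grp (yo X) B)"
  then obtain k where k: "k \<in> Hom C B X" "x = \<iota> k" using Hom_Obj yo_carrier by auto
  have "k \<cdot> f \<in> Hom C A X" "k \<cdot> g \<in> Hom C A X" using Comp_in_Hom h k by blast+
  with h k HomD[OF h(1)] HomD[OF h(2)] HomD[OF k(1)]
  show "act (yo X) (Add C f g) x = act (yo X) f x \<otimes>\<^bsub>grp (yo X) A\<^esub> act (yo X) g x"
    by (simp add: yo_act yo_mult Comp_Add_right[OF h(1,2) k(1)])
qed (auto simp: yoneda_obj_def)

text \<open>The Yoneda lemma: \<open>ymap X A \<xi>\<close> is the map from \<open>yo A\<close> to \<open>X\<close> that corresponds to
  the element \<open>\<xi>\<close> of \<open>X\<close> at \<open>A\<close>.\<close>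

definition ymap where
  "ymap X A \<xi> = mk_map C (yo A) X (\<lambda>B y. act X (inv_into (Hom C B A) \<iota> y) \<xi>)"

lemma ymap_simps [simp]:
  "src (ymap X A \<xi>) = yo A" "tgt (ymap X A \<xi>) = X"
  by (simp_all add: ymap_def)

lemma ymap_apply: "f \<in> Hom C B A \<Longrightarrow> comps (ymap X A \<xi>) B (\<iota> f) = act X f \<xi>"
  using Hom_Obj(1) by (simp add: ymap_def yo_carrier inv_\<iota>)

lemma ymap_Hom:
  assumes "additive_presheaf C X" "A \<in> Obj C" "\<xi> \<in> carrier (grp X A)"
  shows "ymap X A \<xi> \<in> Hom (PMod C) (yo A) X"
proof -
  interpret X: presheaf_over C X using assms preadditive_category_axioms by (simp add: presheaf_over_def)
  show ?thesis unfolding ymap_def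
  proof (rule mk_map_Hom)
    fix B x y assume h: "B \<in> Obj C" "x \<in> carrier (grp (yo A) B)" "y \<in> carrier (grp (yo A) B)"
    then obtain f g where "f \<in> Hom C B A" "g \<in> Hom C B A" "x = \<iota> f" "y = \<iota> g"
      using yo_carrier by auto
    moreover from this have "Add C f g \<in> Hom C B A" by (auto simp: Hom_iff)
    ultimately show "act X (inv_into (Hom C B A) \<iota> (x \<otimes>\<^bsub>grp (yo A) B\<^esub> y)) \<xi> =
       act X (inv_into (Hom C B A) \<iota> x) \<xi> \<otimes>\<^bsub>grp X B\<^esub> act X (inv_into (Hom C B A) \<iota> y) \<xi>"
      using assms(3) by (auto simp: yo_mult inv_\<iota> Hom_iff)
  next
    fix f x assume h: "f \<in> Arr C" "x \<in> carrier (grp (yo A) (Cod C f))"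
    then obtain g where g: "g \<in> Hom C (Cod C f) A" "x = \<iota> g" using yo_carrier by auto
    then have "g \<cdot> f \<in> Hom C (Dom C f) A" using h by (auto simp: Hom_iff)
    with g h show "act X (inv_into (Hom C (Dom C f) A) \<iota> (act (yo A) f x)) \<xi> =
       act X f (act X (inv_into (Hom C (Cod C f) A) \<iota> x) \<xi>)"
      using assms(3) HomD[OF g(1)] by (simp add: yo_act inv_\<iota>)
  next
    fix B x assume h: "B \<in> Obj C" "x \<in> carrier (grp (yo A) B)"
    then obtain f where "f \<in> Hom C B A" "x = \<iota> f" using yo_carrier by auto
    then show "act X (inv_into (Hom C B A) \<iota> x) \<xi> \<in> carrier (grp X B)"
      using assms(3) by (auto simp: inv_\<iota> Hom_iff)
  qed (use assms additive_presheaf_yo preadditive_category_axioms in auto)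
qed

lemma yo_Ident: "A \<in> Obj C \<Longrightarrow> \<iota> (Ident C A) \<in> carrier (grp (yo A) A)"
  using yo_carrier Ident_in_Hom by simp

lemma yoneda_eqI:
  assumes "\<eta> \<in> Hom (PMod C) (yo A) X" "\<theta> \<in> Hom (PMod C) (yo A) X" "A \<in> Obj C"
    and "comps \<eta> A (\<iota> (Ident C A)) = comps \<theta> A (\<iota> (Ident C A))"
  shows "\<eta> = \<theta>"
proof (rule presheaf_map_eqI[OF assms(1,2)])
  fix B x assume B: "B \<in> Obj C" "x \<in> carrier (grp (yo A) B)"
  then obtain f where f: "f \<in> Hom C B A" "x = \<iota> f" using yo_carrier by auto
  note a = HomD[OF f(1)]
  have "x = act (yo A) f (\<iota> (Ident C A))"
    using f a assms(3) by (simp add: yo_act Hom_iff)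
  then show "comps \<eta> B x = comps \<theta> B x"
    using comps_natural[OF assms(1), of f B A "\<iota> (Ident C A)"]
      comps_natural[OF assms(2), of f B A "\<iota> (Ident C A)"]
      a assms(3,4) yo_Ident by simp
qed

lemma ymap_unique:
  assumes "\<eta> \<in> Hom (PMod C) (yo A) X" "A \<in> Obj C"
  shows "\<eta> = ymap X A (comps \<eta> A (\<iota> (Ident C A)))"
proof (rule yoneda_eqI[OF assms(1) _ assms(2)])
  interpret X: presheaf_over C X
    using presheaf_over_src_tgt(2)[OF preadditive_category_axioms assms(1)] .
  have c: "comps \<eta> A (\<iota> (Ident C A)) \<in> carrier (grp X A)"
    using comps_closed[OF assms yo_Ident[OF assms(2)]] .
  then show "ymap X A (comps \<eta> A (\<iota> (Ident C A))) \<in> Hom (PMod C) (yo A) X"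
    using ymap_Hom assms(2) X.additive_presheaf_axioms by blast
  show "comps \<eta> A (\<iota> (Ident C A)) = comps (ymap X A (comps \<eta> A (\<iota> (Ident C A)))) A (\<iota> (Ident C A))"
    using c assms(2) by (simp add: ymap_apply Ident_in_Hom)
qed

lemma yoneda_amap:
  assumes "f \<in> Hom C A B"
  shows "amap (yoneda C \<iota>) f = ymap (yo B) A (\<iota> f)"
proof -
  have "\<iota> (f \<cdot> inv_into (Hom C X A) \<iota> y) = act (yo B) (inv_into (Hom C X A) \<iota> y) (\<iota> f)"
    if "X \<in> Obj C" "y \<in> \<iota> ` Hom C X A" for X y
    using that assms by (auto simp: inv_\<iota>) (metis yo_act HomD(1,3))
  then show ?thesis
    using HomD[OF assms] yo_carrier
    by (auto simp: yoneda_def ymap_def mk_map_def cong: restrict_cong)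
qed

lemma yoneda_amap_Hom:
  assumes "f \<in> Hom C A B"
  shows "amap (yoneda C \<iota>) f \<in> Hom (PMod C) (yo A) (yo B)"
  unfolding yoneda_amap[OF assms]
  using assms Hom_Obj[OF assms] additive_presheaf_yo yo_carrier by (intro ymap_Hom) auto

lemma yoneda_amap_apply:
  assumes "f \<in> Hom C A B" "g \<in> Hom C X A"
  shows "comps (amap (yoneda C \<iota>) f) X (\<iota> g) = \<iota> (f \<cdot> g)"
  unfolding yoneda_amap[OF assms(1)] ymap_apply[OF assms(2)]
  using assms yo_act by (metis HomD(1,3))

lemma Hom_yoneda_trivial_iff:
  assumes "additive_presheaf C X" "A \<in> Obj C"
  shows "Hom (PMod C) (yo A) X = {Zero (PMod C) (yo A) X} \<longleftrightarrow> carrier (grp X A) = {\<one>\<^bsub>grp X A\<^esub>}"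
proof -
  interpret X: presheaf_over C X using assms preadditive_category_axioms by (simp add: presheaf_over_def)
  have z: "Zero (PMod C) (yo A) X \<in> Hom (PMod C) (yo A) X" (is "?z \<in> _")
  proof -
    interpret YA: presheaf_over C "yo A"
      using additive_presheaf_yo[OF assms(2)] preadditive_category_axioms by (simp add: presheaf_over_def)
    have "\<one>\<^bsub>grp X B\<^esub> = \<one>\<^bsub>grp X B\<^esub> \<otimes>\<^bsub>grp X B\<^esub> \<one>\<^bsub>grp X B\<^esub>" if "B \<in> Obj C" for B
      using X.grp_comm_group[OF that] comm_group.axioms(1) comm_monoid.axioms(1)
        monoid.l_one monoid.one_closed by metis
    then show ?thesis
      using assms YA.additive_presheaf_axioms preadditive_category_axioms
      by (simp, intro mk_map_Hom) auto
  qed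
  have z1: "comps ?z A (\<iota> (Ident C A)) = \<one>\<^bsub>grp X A\<^esub>"
    using yo_Ident assms(2) by simp
  have i: "\<iota> (Ident C A) \<in> carrier (grp (yo A) A)" using yo_Ident assms(2) .
  show ?thesis
  proof
    assume h: "Hom (PMod C) (yo A) X = {?z}"
    have "\<xi> = \<one>\<^bsub>grp X A\<^esub>" if "\<xi> \<in> carrier (grp X A)" for \<xi>
    proof -
      have "ymap X A \<xi> = ?z" using h ymap_Hom[OF assms that] by blast
      then show ?thesis
        using z1 ymap_apply[OF Ident_in_Hom[OF assms(2)], of X \<xi>] that assms(2) by simp
    qed
    then show "carrier (grp X A) = {\<one>\<^bsub>grp X A\<^esub>}" using X.one_carrier assms(2) by blast
  next
    assume h: "carrier (grp X A) = {\<one>\<^bsub>grp X A\<^esub>}"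
    have "\<eta> = ?z" if "\<eta> \<in> Hom (PMod C) (yo A) X" for \<eta>
      using yoneda_eqI[OF that z assms(2)] comps_closed[OF that assms(2) i] z1 h by auto
    then show "Hom (PMod C) (yo A) X = {?z}" using z by blast
  qed
qed

end

section \<open>Sequential colimits of representable presheaves\<close>

text \<open>Under the Yoneda lemma, a thread is the same as a cocone from the representables \<open>yo (E n)\<close>
  to \<open>X\<close>.\<close>

locale thread = presheaf_over C X
  for C :: "('o, 'm, 'x) ab_cat_scheme" (structure) and X :: "('o, 'm, 'u) presheaf" +
  fixes E :: "nat \<Rightarrow> 'o" and e :: "nat \<Rightarrow> 'm" and \<xi> :: "nat \<Rightarrow> 'u"
  assumes chain: "chain C E e"
    and \<xi>_carrier: "\<xi> n \<in> carrier (grp X (E n))"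
    and \<xi>_compat: "act X (e n) (\<xi> (Suc n)) = \<xi> n"
begin

lemma E_Obj [simp]: "E n \<in> Obj C"
  using chain unfolding chain_def by blast

lemma e_arr [simp]: "e n \<in> Arr C" "Dom C (e n) = E n" "Cod C (e n) = E (Suc n)"
  using chain unfolding chain_def Hom_iff by blast+

lemma chain_map_arr [simp]:
  "chain_map C E e n k \<in> Arr C" "Dom C (chain_map C E e n k) = E n"
  "Cod C (chain_map C E e n k) = E (n + k)"
  using chain_map_Hom[OF chain, of n k] by (auto simp: Hom_iff)

declare \<xi>_carrier [simp]

lemma act_chain_map: "act X (chain_map C E e n k) (\<xi> (n + k)) = \<xi> n"
  by (induction k) (simp_all add: \<xi>_compat)

lemma act_stage:
  assumes "f \<in> Hom C A (E n)"
  shows "act X f (\<xi> n) = act X (chain_map C E e n k \<cdot> f) (\<xi> (n + k))"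
  using HomD[OF assms] by (simp add: act_chain_map)

lemma common_stage:
  assumes "f \<in> Hom C A (E n)" "g \<in> Hom C A (E m)"
  obtains f' g' where "f' = chain_map C E e n m \<cdot> f" "g' = chain_map C E e m n \<cdot> g"
    "f' \<in> Hom C A (E (n + m))" "g' \<in> Hom C A (E (n + m))"
    "act X f (\<xi> n) = act X f' (\<xi> (n + m))" "act X g (\<xi> m) = act X g' (\<xi> (n + m))"
proof (rule that[OF refl refl])
  show "chain_map C E e n m \<cdot> f \<in> Hom C A (E (n + m))"
    "chain_map C E e m n \<cdot> g \<in> Hom C A (E (n + m))"
    using HomD[OF assms(1)] HomD[OF assms(2)] by (simp_all add: Hom_iff add.commute)
  show "act X f (\<xi> n) = act X (chain_map C E e n m \<cdot> f) (\<xi> (n + m))"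
    by (rule act_stage[OF assms(1)])
  show "act X g (\<xi> m) = act X (chain_map C E e m n \<cdot> g) (\<xi> (n + m))"
    using act_stage[OF assms(2), of n] by (simp add: add.commute)
qed

end

text \<open>A presentation is a thread whose cocone is a colimit objectwise: \<open>X\<close> is the union of the
  images of the \<open>yo (E n)\<close>, and an element of \<open>yo (E n)\<close> is mapped to zero only if it becomes
  zero in some \<open>yo (E (n + k))\<close>.\<close>

locale presentation = thread C X E e \<xi>
  for C :: "('o, 'm, 'x) ab_cat_scheme" (structure) and X :: "('o, 'm, 'u) presheaf"
    and E :: "nat \<Rightarrow> 'o" and e :: "nat \<Rightarrow> 'm" and \<xi> :: "nat \<Rightarrow> 'u" +
  assumes reached: "\<lbrakk>A \<in> Obj C; x \<in> carrier (grp X A)\<rbrakk> \<Longrightarrow>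
      \<exists>n. \<exists>f \<in> Hom C A (E n). x = act X f (\<xi> n)"
    and dies: "\<lbrakk>f \<in> Hom C A (E n); act X f (\<xi> n) = \<one>\<^bsub>grp X A\<^esub>\<rbrakk> \<Longrightarrow>
      \<exists>k. chain_map C E e n k \<cdot> f = Zero C A (E (n + k))"
begin

text \<open>This makes the map \<open>act X f (\<xi> n) \<mapsto> act Z f (\<zeta> n)\<close> well defined.\<close>

lemma eq_transfer:
  assumes "thread C Z E e \<zeta>" "f \<in> Hom C A (E n)" "g \<in> Hom C A (E m)"
    and "act X f (\<xi> n) = act X g (\<xi> m)"
  shows "act Z f (\<zeta> n) = act Z g (\<zeta> m)"
proof -
  interpret Z: thread C Z E e \<zeta> by fact
  obtain f' g' where f': "f' = chain_map C E e n m \<cdot> f" and g': "g' = chain_map C E e m n \<cdot> g"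
    and H: "f' \<in> Hom C A (E (n + m))" "g' \<in> Hom C A (E (n + m))"
    and X: "act X f (\<xi> n) = act X f' (\<xi> (n + m))" "act X g (\<xi> m) = act X g' (\<xi> (n + m))"
    by (rule common_stage[OF assms(2,3)])
  have Z: "act Z f (\<zeta> n) = act Z f' (\<zeta> (n + m))" "act Z g (\<zeta> m) = act Z g' (\<zeta> (n + m))"
    using Z.common_stage[OF assms(2,3)] f' g' by metis+
  let ?d = "Add C f' (Neg C g')"
  have d: "?d \<in> Hom C A (E (n + m))" using H by (auto simp: Hom_iff)
  have "act X ?d (\<xi> (n + m)) = \<one>\<^bsub>grp X A\<^esub>"
    using act_eqI[OF H] X assms(4) by simp
  then obtain k where k: "chain_map C E e (n + m) k \<cdot> ?d = Zero C A (E (n + m + k))"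
    using dies[OF d] by blast
  have "act Z ?d (\<zeta> (n + m)) = \<one>\<^bsub>grp Z A\<^esub>"
    unfolding Z.act_stage[OF d, of k] k using Hom_Obj[OF H(1)] by simp
  then show ?thesis using Z.act_eqI[OF H] Z by simp
qed

end

context small_category
begin

lemma omap_yoneda [simp]: "omap (yoneda C \<iota>) X = yo X"
  by (simp add: yoneda_def)

lemma cocone_thread:
  assumes "chain C E e"
    and "cocone (PMod C) (\<lambda>n. omap (yoneda C \<iota>) (E n)) (\<lambda>n. amap (yoneda C \<iota>) (e n)) Z k"
  defines "\<zeta> \<equiv> \<lambda>n. comps (k n) (E n) (\<iota> (Ident C (E n)))"
  shows "thread C Z E e \<zeta>" "k n = ymap Z (E n) (\<zeta> n)"
proof -
  have e: "E n \<in> Obj C" "e n \<in> Hom C (E n) (E (Suc n))" for n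
    using assms(1) unfolding chain_def by auto
  have k: "k n \<in> Hom (PMod C) (yo (E n)) Z" "k (Suc n) \<cdot>\<^bsub>PMod C\<^esub> amap (yoneda C \<iota>) (e n) = k n" for n
    using assms(2) unfolding cocone_def by auto
  have \<zeta>: "\<zeta> n \<in> carrier (grp Z (E n))" for n
    unfolding \<zeta>_def using comps_closed[OF k(1) e(1) yo_Ident[OF e(1)]] .
  show ymap: "k n = ymap Z (E n) (\<zeta> n)" for n
    unfolding \<zeta>_def by (rule ymap_unique[OF k(1) e(1)])
  have "act Z (e n) (\<zeta> (Suc n)) = \<zeta> n" for n
  proof -
    have i: "Ident C (E n) \<in> Hom C (E n) (E n)" "\<iota> (Ident C (E n)) \<in> carrier (grp (yo (E n)) (E n))"
      using e Ident_in_Hom yo_Ident by auto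
    have "\<zeta> n = comps (k (Suc n) \<cdot>\<^bsub>PMod C\<^esub> amap (yoneda C \<iota>) (e n)) (E n) (\<iota> (Ident C (E n)))"
      unfolding \<zeta>_def k ..
    also have "\<dots> = comps (k (Suc n)) (E n) (\<iota> (e n))"
      unfolding comps_Comp[OF yoneda_amap_Hom[OF e(2)] e(1) i(2)] yoneda_amap_apply[OF e(2) i(1)]
      using HomD[OF e(2)[of n]] by simp
    also have "\<dots> = act Z (e n) (\<zeta> (Suc n))"
      unfolding ymap[of "Suc n"] by (rule ymap_apply[OF e(2)])
    finally show ?thesis by simp
  qed
  then show "thread C Z E e \<zeta>"
    using assms(1) \<zeta> presheaf_over_src_tgt(2)[OF preadditive_category_axioms k(1)]
    by (simp add: thread_def thread_axioms_def)
qed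

lemma thread_cocone:
  assumes "thread C X E e \<xi>"
  shows "cocone (PMod C) (\<lambda>n. omap (yoneda C \<iota>) (E n)) (\<lambda>n. amap (yoneda C \<iota>) (e n)) X
    (\<lambda>n. ymap X (E n) (\<xi> n))"
proof -
  interpret thread C X E e \<xi> by fact
  have Hom: "ymap X (E n) (\<xi> n) \<in> Hom (PMod C) (yo (E n)) X" for n
    using ymap_Hom[OF additive_presheaf_axioms] by simp
  have e: "e n \<in> Hom C (E n) (E (Suc n))" for n by (simp add: Hom_iff)
  have "ymap X (E (Suc n)) (\<xi> (Suc n)) \<cdot>\<^bsub>PMod C\<^esub> amap (yoneda C \<iota>) (e n) = ymap X (E n) (\<xi> n)" for n
  proof (rule yoneda_eqI[OF _ Hom E_Obj])
    show "ymap X (E (Suc n)) (\<xi> (Suc n)) \<cdot>\<^bsub>PMod C\<^esub> amap (yoneda C \<iota>) (e n) \<in> Hom (PMod C) (yo (E n)) X"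
      by (rule PMod_Comp_Hom[OF preadditive_category_axioms yoneda_amap_Hom[OF e] Hom])
    show "comps (ymap X (E (Suc n)) (\<xi> (Suc n)) \<cdot>\<^bsub>PMod C\<^esub> amap (yoneda C \<iota>) (e n)) (E n)
        (\<iota> (Ident C (E n))) = comps (ymap X (E n) (\<xi> n)) (E n) (\<iota> (Ident C (E n)))"
      unfolding comps_Comp[OF yoneda_amap_Hom[OF e] E_Obj yo_Ident[OF E_Obj]]
        yoneda_amap_apply[OF e Ident_in_Hom[OF E_Obj]] ymap_apply[OF Ident_in_Hom[OF E_Obj]]
      using ymap_apply[OF e] by (simp add: \<xi>_compat)
  qed
  then show ?thesis
    unfolding cocone_def using Hom additive_presheaf_axioms by (simp del: PMod_simps(6))
qed

lemma chain_yoneda: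
  assumes "chain C E e"
  shows "chain (PMod C) (\<lambda>n. omap (yoneda C \<iota>) (E n)) (\<lambda>n. amap (yoneda C \<iota>) (e n))"
  using assms additive_presheaf_yo yoneda_amap_Hom unfolding chain_def by simp

lemma presentation_is_colimit:
  assumes "presentation C X E e \<xi>"
  shows "is_colimit (PMod C) (\<lambda>n. omap (yoneda C \<iota>) (E n)) (\<lambda>n. amap (yoneda C \<iota>) (e n)) X
    (\<lambda>n. ymap X (E n) (\<xi> n))"
proof -
  interpret presentation C X E e \<xi> by fact
  note i = preadditive_category_axioms
  have iHom: "ymap X (E n) (\<xi> n) \<in> Hom (PMod C) (yo (E n)) X" for n
    using ymap_Hom[OF additive_presheaf_axioms] by simp
  have "\<exists>!t. t \<in> Hom (PMod C) X Z \<and> (\<forall>n. t \<cdot>\<^bsub>PMod C\<^esub> ymap X (E n) (\<xi> n) = k n)"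
    if "cocone (PMod C) (\<lambda>n. omap (yoneda C \<iota>) (E n)) (\<lambda>n. amap (yoneda C \<iota>) (e n)) Z k" for Z k
  proof -
    define \<zeta> where "\<zeta> n = comps (k n) (E n) (\<iota> (Ident C (E n)))" for n
    have th: "thread C Z E e \<zeta>" and k: "\<And>n. k n = ymap Z (E n) (\<zeta> n)"
      using cocone_thread[OF chain that] unfolding \<zeta>_def by auto
    interpret Z: thread C Z E e \<zeta> by fact
    have kHom: "ymap Z (E n) (\<zeta> n) \<in> Hom (PMod C) (yo (E n)) Z" for n
      using ymap_Hom[OF Z.additive_presheaf_axioms] by simp
    define c where
      "c A x = (SOME z. \<exists>n. \<exists>f \<in> Hom C A (E n). x = act X f (\<xi> n) \<and> z = act Z f (\<zeta> n))" for A x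
    have c: "c A (act X f (\<xi> n)) = act Z f (\<zeta> n)" if "f \<in> Hom C A (E n)" for A f n
      unfolding c_def using that by (intro some_equality) (auto intro: eq_transfer[OF th])
    have t: "mk_map C X Z c \<in> Hom (PMod C) X Z" (is "?t \<in> _")
    proof (rule mk_map_Hom[OF i])
      fix A x assume "A \<in> Obj C" "x \<in> carrier (grp X A)"
      then obtain n f where "f \<in> Hom C A (E n)" "x = act X f (\<xi> n)" using reached by blast
      then show "c A x \<in> carrier (grp Z A)" using c by (auto simp: Hom_iff)
    next
      fix A x y assume h: "A \<in> Obj C" "x \<in> carrier (grp X A)" "y \<in> carrier (grp X A)"
      obtain n f where f: "f \<in> Hom C A (E n)" "x = act X f (\<xi> n)" using reached h by blast
      obtain m g where g: "g \<in> Hom C A (E m)" "y = act X g (\<xi> m)" using reached h by blast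
      obtain f' g' where fg: "f' \<in> Hom C A (E (n + m))" "g' \<in> Hom C A (E (n + m))"
        "x = act X f' (\<xi> (n + m))" "y = act X g' (\<xi> (n + m))"
        using common_stage[OF f(1) g(1)] f g by metis
      have s: "Add C f' g' \<in> Hom C A (E (n + m))" using fg by (auto simp: Hom_iff)
      have "x \<otimes>\<^bsub>grp X A\<^esub> y = act X (Add C f' g') (\<xi> (n + m))"
        unfolding fg(3,4) using HomD[OF fg(1)] HomD[OF fg(2)] by simp
      then show "c A (x \<otimes>\<^bsub>grp X A\<^esub> y) = c A x \<otimes>\<^bsub>grp Z A\<^esub> c A y"
        unfolding fg(3,4) using c[OF s] c[OF fg(1)] c[OF fg(2)] HomD[OF fg(1)] HomD[OF fg(2)] by simp
    next
      fix f x assume h: "f \<in> Arr C" "x \<in> carrier (grp X (Cod C f))"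
      then obtain n g where g: "g \<in> Hom C (Cod C f) (E n)" "x = act X g (\<xi> n)"
        using reached[OF Cod_Obj[OF h(1)] h(2)] by blast
      have gf: "g \<cdot> f \<in> Hom C (Dom C f) (E n)" using h HomD[OF g(1)] by (simp add: Hom_iff)
      have "act X f x = act X (g \<cdot> f) (\<xi> n)" using h HomD[OF g(1)] g(2) by simp
      then show "c (Dom C f) (act X f x) = act Z f (c (Cod C f) x)"
        using c[OF gf] c[OF g(1)] g(2) h HomD[OF g(1)] by simp
    qed (use additive_presheaf_axioms Z.additive_presheaf_axioms in auto)
    have tapp: "comps ?t A (act X f (\<xi> n)) = act Z f (\<zeta> n)" if f: "f \<in> Hom C A (E n)" for f A n
      using c[OF f] HomD[OF f] Hom_Obj(1)[OF f] by simp
    have "?t \<cdot>\<^bsub>PMod C\<^esub> ymap X (E n) (\<xi> n) = k n" for n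
      unfolding k
    proof (rule yoneda_eqI[OF PMod_Comp_Hom[OF i iHom t] kHom E_Obj])
      show "comps (?t \<cdot>\<^bsub>PMod C\<^esub> ymap X (E n) (\<xi> n)) (E n) (\<iota> (Ident C (E n)))
        = comps (ymap Z (E n) (\<zeta> n)) (E n) (\<iota> (Ident C (E n)))"
        unfolding comps_Comp[OF iHom E_Obj yo_Ident[OF E_Obj]] ymap_apply[OF Ident_in_Hom[OF E_Obj]]
        by (rule tapp[OF Ident_in_Hom[OF E_Obj]])
    qed
    moreover have "s = ?t"
      if s: "s \<in> Hom (PMod C) X Z" and sk: "\<forall>n. s \<cdot>\<^bsub>PMod C\<^esub> ymap X (E n) (\<xi> n) = k n" for s
    proof (rule presheaf_map_eqI[OF s t])
      fix A x assume h: "A \<in> Obj C" "x \<in> carrier (grp X A)"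
      then obtain n f where f: "f \<in> Hom C A (E n)" "x = act X f (\<xi> n)" using reached by blast
      have y: "\<iota> f \<in> carrier (grp (yo (E n)) A)" using f h yo_carrier by auto
      have "comps s A x = comps (s \<cdot>\<^bsub>PMod C\<^esub> ymap X (E n) (\<xi> n)) A (\<iota> f)"
        unfolding comps_Comp[OF iHom h(1) y] ymap_apply[OF f(1)] f(2) ..
      also have "\<dots> = act Z f (\<zeta> n)" using sk k ymap_apply[OF f(1)] by simp
      finally show "comps s A x = comps ?t A x" using tapp[OF f(1)] f(2) by simp
    qed
    ultimately show ?thesis using t by blast
  qed
  then show ?thesis
    unfolding is_colimit_def using chain_yoneda[OF chain] thread_cocone[OF thread_axioms] by blast
qed

end

text \<open>The elements of a sequential colimit of sets, each of which embeds into a type, can be coded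
  by elements of that type: it suffices to find a set \<open>S\<close> of representatives of all classes that
  embeds into the type. If the type is infinite, pairs of a natural number and an element of the
  type embed into it. If it is finite, then the number of classes reached at stage \<open>n\<close> is
  bounded, and a stage at which it is maximal reaches all of them.\<close>

lemma ex_colimit_codes:
  fixes A :: "nat \<Rightarrow> 'm set" and \<iota> :: "'m \<Rightarrow> 'u"
  assumes inj: "\<And>n. inj_on \<iota> (A n)"
    and R: "equiv (Sigma UNIV A) R"
    and step: "\<And>n f. f \<in> A n \<Longrightarrow> \<exists>g \<in> A (Suc n). ((n, f), (Suc n, g)) \<in> R"
  shows "\<exists>q :: nat \<times> 'm \<Rightarrow> 'u. \<forall>p \<in> Sigma UNIV A. \<forall>p' \<in> Sigma UNIV A. q p = q p' \<longleftrightarrow> (p, p') \<in> R"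
proof -
  have "\<exists>S (j :: nat \<times> 'm \<Rightarrow> 'u). S \<subseteq> Sigma UNIV A \<and> inj_on j S \<and> (\<forall>p \<in> Sigma UNIV A. \<exists>s \<in> S. (p, s) \<in> R)"
  proof (cases "finite (UNIV :: 'u set)")
    case False
    have "(card_of (UNIV :: nat set), card_of (UNIV :: 'u set)) \<in> ordLeq" using False infinite_iff_card_of_nat by blast
    then have "(card_of ((UNIV :: nat set) \<times> (UNIV :: 'u set)), card_of (UNIV :: 'u set)) \<in> ordIso"
      using False card_of_Times_infinite_simps(3) by blast
    then obtain h :: "nat \<times> 'u \<Rightarrow> 'u" where h: "inj h"
      using card_of_ordIso[of "(UNIV :: nat set) \<times> (UNIV :: 'u set)" "UNIV :: 'u set"]
      by (auto simp: bij_betw_def)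
    have "inj_on (\<lambda>(n, f). h (n, \<iota> f)) (Sigma UNIV A)"
      using h inj by (force simp: inj_on_def)
    moreover have "\<exists>s \<in> Sigma UNIV A. (p, s) \<in> R" if "p \<in> Sigma UNIV A" for p
      using R that unfolding equiv_def refl_on_def by blast
    ultimately show ?thesis by blast
  next
    case True
    define c where "c n = (\<lambda>f. R `` {(n, f)}) ` A n" for n
    have fin: "finite (A n)" for n
      using inj_on_finite[OF inj[of n], of UNIV] True by simp
    have bound: "card (c n) \<le> card (UNIV :: 'u set)" for n
      unfolding c_def using card_image_le[OF fin, of "\<lambda>f. R `` {(n, f)}"] card_inj_on_le[OF inj[of n], of UNIV] True
      by (meson le_trans subset_UNIV)
    have Suc: "c n \<subseteq> c (Suc n)" for n
    proof
      fix K assume "K \<in> c n"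
      then obtain f where f: "f \<in> A n" "K = R `` {(n, f)}" unfolding c_def by blast
      then obtain g where g: "g \<in> A (Suc n)" "((n, f), (Suc n, g)) \<in> R" using step by blast
      have "K = R `` {(Suc n, g)}" unfolding f(2) by (rule equiv_class_eq[OF R g(2)])
      then show "K \<in> c (Suc n)" unfolding c_def using g(1) by blast
    qed
    obtain N where N: "\<And>n. card (c n) \<le> card (c N)"
      using ex_has_greatest_nat[of "\<lambda>_. True" 0 "\<lambda>n. card (c n)" "Suc (card (UNIV :: 'u set))"] bound
      by (auto simp: less_Suc_eq_le)
    have cN: "c n \<subseteq> c N" for n
    proof -
      have "c N \<subseteq> c (max n N)" "c n \<subseteq> c (max n N)"
        using lift_Suc_mono_le[of c, OF Suc] by auto
      moreover have "finite (c (max n N))" unfolding c_def using fin by simp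
      ultimately show ?thesis using N[of "max n N"] card_seteq by metis
    qed
    have "\<exists>s \<in> {N} \<times> A N. (p, s) \<in> R" if pA: "p \<in> Sigma UNIV A" for p
    proof -
      obtain n f where p: "p = (n, f)" "f \<in> A n" using pA by auto
      then have "R `` {p} \<in> c N" using cN[of n] unfolding c_def by blast
      then obtain g where "g \<in> A N" "R `` {p} = R `` {(N, g)}" unfolding c_def by blast
      then show ?thesis using eq_equiv_class[OF _ R, of p "(N, g)"] by auto
    qed
    moreover have "inj_on (\<iota> \<circ> snd) ({N} \<times> A N)" using inj by (auto simp: inj_on_def)
    ultimately show ?thesis by (intro exI[of _ "{N} \<times> A N"]) auto
  qed
  then obtain S and j :: "nat \<times> 'm \<Rightarrow> 'u" where S: "S \<subseteq> Sigma UNIV A" "inj_on j S"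
    "\<And>p. p \<in> Sigma UNIV A \<Longrightarrow> \<exists>s \<in> S. (p, s) \<in> R" by blast
  define r where "r p = (SOME s. s \<in> S \<and> R `` {s} = R `` {p})" for p
  have r: "r p \<in> S \<and> R `` {r p} = R `` {p}" if "p \<in> Sigma UNIV A" for p
    unfolding r_def using S(3)[OF that] equiv_class_eq[OF R] by (metis (mono_tags, lifting) someI_ex)
  have r_eq: "r p = r p'" if "(p, p') \<in> R" for p p'
    unfolding r_def using equiv_class_eq[OF R that] by simp
  have "j (r p) = j (r p') \<longleftrightarrow> (p, p') \<in> R" if "p \<in> Sigma UNIV A" "p' \<in> Sigma UNIV A" for p p'
    using r[OF that(1)] r[OF that(2)] r_eq[of p p'] S(2) that eq_equiv_class[OF _ R, of p p']
    by (metis inj_onD)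
  then show ?thesis by (intro exI[of _ "j \<circ> r"]) auto
qed

context small_category
begin

text \<open>The colimit of a chain of representables exists inside the given universe: its elements at
  \<open>A\<close> are the germs of arrows from \<open>A\<close> to the objects of the chain, coded by
  \<open>q A\<close>.\<close>

lemma ex_presentation:
  assumes "chain C E e"
  shows "\<exists>(L :: ('o, 'm, 'u) presheaf) \<xi>. presentation C L E e \<xi>"
proof -
  define tr where "tr n N = chain_map C E e n (N - n)" for n N
  have E [simp]: "E n \<in> Obj C" for n using assms unfolding chain_def by blast
  have tr [simp]: "tr n N \<in> Arr C" "Dom C (tr n N) = E n" "n \<le> N \<Longrightarrow> Cod C (tr n N) = E N" for n N
    using chain_map_Hom[OF assms, of n "N - n"] by (auto simp: tr_def Hom_iff)
  have tr_refl [simp]: "tr n n = Ident C (E n)" for n by (simp add: tr_def)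
  have tr_comp: "tr M N \<cdot> (tr n M \<cdot> f) = tr n N \<cdot> f"
    if "n \<le> M" "M \<le> N" "f \<in> Arr C" "Cod C f = E n" for n M N f
  proof -
    have "tr M N \<cdot> tr n M = tr n N"
      using chain_map_add[OF assms, of n "M - n" "N - M"] that(1,2) by (simp add: tr_def)
    then show ?thesis using that assoc[of f "tr n M" "tr M N"] by simp
  qed
  \<comment> \<open>An arrow from \<open>A\<close> together with the stage it maps to represents a germ; two of them
    represent the same germ if they agree at a later stage \<open>N\<close>.\<close>
  define stages where "stages A = Sigma UNIV (\<lambda>n. Hom C A (E n))" for A
  define R where "R A = {((n, f), (m, g)). f \<in> Hom C A (E n) \<and> g \<in> Hom C A (E m) \<and>
    (\<exists>N. n \<le> N \<and> m \<le> N \<and> tr n N \<cdot> f = tr m N \<cdot> g)}" for A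
  have later: "tr n M \<cdot> f = tr m M \<cdot> g"
    if "f \<in> Hom C A (E n)" "g \<in> Hom C A (E m)" "tr n N \<cdot> f = tr m N \<cdot> g" "n \<le> N" "m \<le> N" "N \<le> M"
    for A n f m g N M
    using that tr_comp[of n N M f] tr_comp[of m N M g] HomD[OF that(1)] HomD[OF that(2)] by metis
  have equiv: "equiv (stages A) (R A)" for A
  proof (rule equivI)
    show "R A \<subseteq> stages A \<times> stages A" unfolding R_def stages_def by auto
    show "refl_on (stages A) (R A)" unfolding refl_on_def R_def stages_def by auto
    show "sym (R A)" unfolding sym_def R_def by (auto simp: eq_commute)
    show "trans (R A)"
    proof (rule transI)
      fix x y z assume h: "(x, y) \<in> R A" "(y, z) \<in> R A"
      obtain n f m g l k where s: "x = (n, f)" "y = (m, g)" "z = (l, k)"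
        by (cases x, cases y, cases z) auto
      from h obtain N M where f: "f \<in> Hom C A (E n)" and g: "g \<in> Hom C A (E m)" and k: "k \<in> Hom C A (E l)"
        and N: "n \<le> N" "m \<le> N" "tr n N \<cdot> f = tr m N \<cdot> g"
        and M: "m \<le> M" "l \<le> M" "tr m M \<cdot> g = tr l M \<cdot> k"
        unfolding R_def s by auto
      have "tr n (N + M) \<cdot> f = tr l (N + M) \<cdot> k"
        using later[OF f g N(3) N(1,2), of "N + M"] later[OF g k M(3) M(1,2), of "N + M"] by simp
      then show "(x, z) \<in> R A"
        unfolding R_def s using f k N M by (auto intro!: exI[of _ "N + M"])
    qed
  qed
  have "\<exists>q :: nat \<times> 'm \<Rightarrow> 'u. \<forall>p \<in> stages A. \<forall>p' \<in> stages A. q p = q p' \<longleftrightarrow> (p, p') \<in> R A"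
    if "A \<in> Obj C" for A
    unfolding stages_def
  proof (rule ex_colimit_codes)
    show "inj_on \<iota> (Hom C A (E n))" for n using inj that by simp
    show "equiv (Sigma UNIV (\<lambda>n. Hom C A (E n))) (R A)" using equiv unfolding stages_def .
    fix n f assume f: "f \<in> Hom C A (E n)"
    then have "tr n (Suc n) \<cdot> f \<in> Hom C A (E (Suc n))" by (auto simp: Hom_iff)
    with f show "\<exists>g \<in> Hom C A (E (Suc n)). ((n, f), (Suc n, g)) \<in> R A"
      unfolding R_def
      by (intro bexI[of _ "tr n (Suc n) \<cdot> f"]) (auto intro!: exI[of _ "Suc n"] simp: Hom_iff)
  qed
  then obtain q :: "'o \<Rightarrow> nat \<times> 'm \<Rightarrow> 'u" where q_R: "\<And>A p p'. A \<in> Obj C \<Longrightarrow> p \<in> stages A \<Longrightarrow>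
      p' \<in> stages A \<Longrightarrow> q A p = q A p' \<longleftrightarrow> (p, p') \<in> R A"
    by metis
  have q_eq: "q A (n, f) = q A (m, g) \<longleftrightarrow> (\<exists>N. n \<le> N \<and> m \<le> N \<and> tr n N \<cdot> f = tr m N \<cdot> g)"
    if "f \<in> Hom C A (E n)" "g \<in> Hom C A (E m)" for A n f m g
    using q_R[OF Hom_Obj(1)[OF that(1)], of "(n, f)" "(m, g)"] that unfolding stages_def R_def by auto
  have q_stage: "q A (n, f) = q A (N, tr n N \<cdot> f)" if f: "f \<in> Hom C A (E n)" and "n \<le> N" for A n f N
  proof (subst q_eq[OF f])
    show "tr n N \<cdot> f \<in> Hom C A (E N)" using HomD[OF f] that by (simp add: Hom_iff)
    show "\<exists>M. n \<le> M \<and> N \<le> M \<and> tr n M \<cdot> f = tr N M \<cdot> (tr n N \<cdot> f)"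
      using HomD[OF f] that tr_comp[of n N N f] by (intro exI[of _ N]) simp
  qed
  \<comment> \<open>The operations on codes choose representatives by \<open>r\<close>; the facts \<open>mul\<close> and
    \<open>ac\<close> below make them independent of that choice.\<close>
  define r where "r A x = inv_into (stages A) (q A) x" for A x
  have r: "\<exists>m g N. r A (q A (n, f)) = (m, g) \<and> g \<in> Hom C A (E m) \<and> m \<le> N \<and> n \<le> N \<and> tr m N \<cdot> g = tr n N \<cdot> f"
    if f: "f \<in> Hom C A (E n)" for A n f
  proof -
    have "q A (n, f) \<in> q A ` stages A" using f unfolding stages_def by auto
    then have "r A (q A (n, f)) \<in> stages A" "q A (r A (q A (n, f))) = q A (n, f)"
      unfolding r_def by (auto intro: inv_into_into f_inv_into_f)
    then show ?thesis
      using q_eq[OF _ f] unfolding stages_def by (cases "r A (q A (n, f))") auto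
  qed
  define mul where "mul A x y = (case r A x of (n, f) \<Rightarrow> case r A y of (m, g) \<Rightarrow>
    q A (n + m, Add C (tr n (n + m) \<cdot> f) (tr m (n + m) \<cdot> g)))" for A x y
  have mul: "mul A (q A (n, f)) (q A (n, g)) = q A (n, Add C f g)"
    if f: "f \<in> Hom C A (E n)" and g: "g \<in> Hom C A (E n)" for A n f g
  proof -
    obtain n' f' N where f': "r A (q A (n, f)) = (n', f')" "f' \<in> Hom C A (E n')" "n' \<le> N" "n \<le> N"
      "tr n' N \<cdot> f' = tr n N \<cdot> f" using r[OF f] by blast
    obtain m' g' M where g': "r A (q A (n, g)) = (m', g')" "g' \<in> Hom C A (E m')" "m' \<le> M" "n \<le> M"
      "tr m' M \<cdot> g' = tr n M \<cdot> g" using r[OF g] by blast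
    note a = HomD[OF f] HomD[OF g] HomD[OF f'(2)] HomD[OF g'(2)]
    define K where "K = n' + m' + N + M"
    have K: "tr n' K \<cdot> f' = tr n K \<cdot> f" "tr m' K \<cdot> g' = tr n K \<cdot> g"
      using later[OF f'(2) f f'(5,3,4)] later[OF g'(2) g g'(5,3,4)] unfolding K_def by auto
    let ?s = "Add C (tr n' (n' + m') \<cdot> f') (tr m' (n' + m') \<cdot> g')"
    have "tr (n' + m') K \<cdot> ?s = Add C (tr n' K \<cdot> f') (tr m' K \<cdot> g')"
      using Comp_Add_right[of "tr n' (n' + m') \<cdot> f'" A "E (n' + m')" "tr m' (n' + m') \<cdot> g'" "tr (n' + m') K" "E K"]
        a tr_comp[of n' "n' + m'" K f'] tr_comp[of m' "n' + m'" K g']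
      by (simp add: Hom_iff K_def)
    also have "\<dots> = tr n K \<cdot> Add C f g"
      using Comp_Add_right[of f A "E n" g "tr n K" "E K"] a K f'(4) by (simp add: Hom_iff K_def)
    finally have "q A (n' + m', ?s) = q A (n, Add C f g)"
      using a f'(4) by (subst q_eq) (auto simp: Hom_iff K_def intro!: exI[of _ K])
    then show ?thesis unfolding mul_def f'(1) g'(1) by simp
  qed
  define ac where "ac u x = (case r (Cod C u) x of (n, f) \<Rightarrow> q (Dom C u) (n, f \<cdot> u))" for u x
  have ac: "ac u (q A (n, f)) = q (Dom C u) (n, f \<cdot> u)"
    if f: "f \<in> Hom C A (E n)" and u: "u \<in> Arr C" "Cod C u = A" for A n f u
  proof -
    obtain n' f' N where f': "r A (q A (n, f)) = (n', f')" "f' \<in> Hom C A (E n')" "n' \<le> N" "n \<le> N"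
      "tr n' N \<cdot> f' = tr n N \<cdot> f" using r[OF f] by blast
    note a = HomD[OF f] HomD[OF f'(2)]
    have "tr n' N \<cdot> (f' \<cdot> u) = tr n N \<cdot> (f \<cdot> u)"
      using assoc[of u f' "tr n' N"] assoc[of u f "tr n N"] a u f' by simp
    then have "q (Dom C u) (n', f' \<cdot> u) = q (Dom C u) (n, f \<cdot> u)"
      using a u f'(3,4) by (subst q_eq) (auto simp: Hom_iff)
    then show ?thesis unfolding ac_def using u f'(1) by simp
  qed
  define L :: "('o, 'm, 'u) presheaf" where "L = \<lparr>
    grp = \<lambda>A \<in> Obj C. \<lparr>carrier = q A ` stages A, mult = mul A, one = q A (0, Zero C A (E 0))\<rparr>,
    act = \<lambda>u \<in> Arr C. \<lambda>x \<in> q (Cod C u) ` stages (Cod C u). ac u x\<rparr>"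
  have car: "carrier (grp L A) = q A ` stages A" if "A \<in> Obj C" for A using that by (simp add: L_def)
  have mult: "q A (n, f) \<otimes>\<^bsub>grp L A\<^esub> q A (n, g) = q A (n, Add C f g)"
    if "f \<in> Hom C A (E n)" "g \<in> Hom C A (E n)" for A n f g
    using mul[OF that] Hom_Obj(1)[OF that(1)] by (simp add: L_def)
  have one: "\<one>\<^bsub>grp L A\<^esub> = q A (n, Zero C A (E n))" if "A \<in> Obj C" for A n
    using that q_stage[of "Zero C A (E 0)" A 0 n] by (simp add: L_def Hom_iff)
  have act: "act L u (q A (n, f)) = q (Dom C u) (n, f \<cdot> u)"
    if "f \<in> Hom C A (E n)" "u \<in> Arr C" "Cod C u = A" for A n f u
    using ac[OF that] that by (auto simp: L_def stages_def)
  have mem: "q A (n, f) \<in> carrier (grp L A)" if "f \<in> Hom C A (E n)" for A n f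
    using car[OF Hom_Obj(1)[OF that]] that by (auto simp: stages_def)
  have rep: "\<exists>n f. f \<in> Hom C A (E n) \<and> x = q A (n, f)"
    if "A \<in> Obj C" "x \<in> carrier (grp L A)" for A x
    using that(2) car[OF that(1)] by (auto simp: stages_def)
  have common: "\<exists>n f g h. f \<in> Hom C A (E n) \<and> g \<in> Hom C A (E n) \<and> h \<in> Hom C A (E n) \<and>
      x = q A (n, f) \<and> y = q A (n, g) \<and> z = q A (n, h)"
    if xyz: "A \<in> Obj C" "x \<in> carrier (grp L A)" "y \<in> carrier (grp L A)" "z \<in> carrier (grp L A)" for A x y z
  proof -
    obtain n m k f g h where fgh: "f \<in> Hom C A (E n)" "g \<in> Hom C A (E m)" "h \<in> Hom C A (E k)"
      "x = q A (n, f)" "y = q A (m, g)" "z = q A (k, h)"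
      using rep[OF xyz(1,2)] rep[OF xyz(1,3)] rep[OF xyz(1,4)] by blast
    let ?N = "n + m + k"
    have "tr n ?N \<cdot> f \<in> Hom C A (E ?N)" "tr m ?N \<cdot> g \<in> Hom C A (E ?N)" "tr k ?N \<cdot> h \<in> Hom C A (E ?N)"
      using HomD[OF fgh(1)] HomD[OF fgh(2)] HomD[OF fgh(3)] by (simp_all add: Hom_iff)
    moreover have "x = q A (?N, tr n ?N \<cdot> f)" "y = q A (?N, tr m ?N \<cdot> g)" "z = q A (?N, tr k ?N \<cdot> h)"
      using q_stage[OF fgh(1), of ?N] q_stage[OF fgh(2), of ?N] q_stage[OF fgh(3), of ?N] fgh(4-6) by simp_all
    ultimately show ?thesis by blast
  qed
  have Add_Hom: "Add C f g \<in> Hom C A B" if "f \<in> Hom C A B" "g \<in> Hom C A B" for f g A B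
    using that by (auto simp: Hom_iff)
  have presheaf: "additive_presheaf C L"
  proof (rule additive_presheaf.intro)
    fix A assume A: "A \<in> Obj C"
    show "comm_group (grp L A)"
    proof (rule comm_groupI)
      fix x y z assume h: "x \<in> carrier (grp L A)" "y \<in> carrier (grp L A)" "z \<in> carrier (grp L A)"
      obtain n f g h where fg: "f \<in> Hom C A (E n)" "g \<in> Hom C A (E n)" "h \<in> Hom C A (E n)"
        "x = q A (n, f)" "y = q A (n, g)" "z = q A (n, h)" using common[OF A h] by blast
      show "x \<otimes>\<^bsub>grp L A\<^esub> y \<otimes>\<^bsub>grp L A\<^esub> z = x \<otimes>\<^bsub>grp L A\<^esub> (y \<otimes>\<^bsub>grp L A\<^esub> z)"
        using fg(4-6) mult[OF fg(1,2)] mult[OF fg(2,3)] mult[OF Add_Hom[OF fg(1,2)] fg(3)]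
          mult[OF fg(1) Add_Hom[OF fg(2,3)]] Add_assoc[OF fg(1-3)] by simp
    next
      fix x y assume h: "x \<in> carrier (grp L A)" "y \<in> carrier (grp L A)"
      obtain n f g where fg: "f \<in> Hom C A (E n)" "g \<in> Hom C A (E n)"
        "x = q A (n, f)" "y = q A (n, g)" using common[OF A h(1,2,2)] by blast
      show "x \<otimes>\<^bsub>grp L A\<^esub> y \<in> carrier (grp L A)"
        using fg mult[OF fg(1,2)] mem[OF Add_Hom[OF fg(1,2)]] by simp
      show "x \<otimes>\<^bsub>grp L A\<^esub> y = y \<otimes>\<^bsub>grp L A\<^esub> x"
        using fg mult[OF fg(1,2)] mult[OF fg(2,1)] Add_commute[OF fg(1,2,2)] by simp
    next
      have "Zero C A (E 0) \<in> Hom C A (E 0)" using A by (simp add: Hom_iff)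
      then show "\<one>\<^bsub>grp L A\<^esub> \<in> carrier (grp L A)" using one[OF A, of 0] mem by simp
    next
      fix x assume "x \<in> carrier (grp L A)"
      then obtain n f where f: "f \<in> Hom C A (E n)" "x = q A (n, f)"
        using rep[OF A] by blast
      have h: "Zero C A (E n) \<in> Hom C A (E n)" "Neg C f \<in> Hom C A (E n)"
        using f HomD[OF f(1)] A by (simp_all add: Hom_iff)
      show "\<one>\<^bsub>grp L A\<^esub> \<otimes>\<^bsub>grp L A\<^esub> x = x"
        using f mult[OF h(1) f(1)] one[OF A, of n] Add_Zero_left[OF f(1,1,1)] by simp
      show "\<exists>y \<in> carrier (grp L A). y \<otimes>\<^bsub>grp L A\<^esub> x = \<one>\<^bsub>grp L A\<^esub>"
        using f mult[OF h(2) f(1)] one[OF A, of n] Add_neg_left[OF f(1,1,1)] mem[OF h(2)]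
        by (intro bexI[of _ "q A (n, Neg C f)"]) simp_all
    qed
  next
    fix u A B assume u: "u \<in> Hom C A B"
    note o = Hom_Obj[OF u] and a = HomD[OF u]
    show "act L u \<in> hom (grp L B) (grp L A)"
    proof (rule homI)
      fix x assume "x \<in> carrier (grp L B)"
      then obtain n f where f: "f \<in> Hom C B (E n)" "x = q B (n, f)"
        using rep[OF o(2)] by blast
      then show "act L u x \<in> carrier (grp L A)"
        using act[OF f(1)] a mem[OF Comp_in_Hom[OF u f(1)]] by simp
    next
      fix x y assume h: "x \<in> carrier (grp L B)" "y \<in> carrier (grp L B)"
      obtain n f g where fg: "f \<in> Hom C B (E n)" "g \<in> Hom C B (E n)"
        "x = q B (n, f)" "y = q B (n, g)" using common[OF o(2) h(1,2,2)] by blast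
      show "act L u (x \<otimes>\<^bsub>grp L B\<^esub> y) = act L u x \<otimes>\<^bsub>grp L A\<^esub> act L u y"
        using fg(3,4) a act[OF fg(1)] act[OF fg(2)] act[OF Add_Hom[OF fg(1,2)]] mult[OF fg(1,2)]
          mult[OF Comp_in_Hom[OF u fg(1)] Comp_in_Hom[OF u fg(2)]] Comp_Add_left[OF u fg(1,2)] by simp
    qed
    show "act L u \<in> extensional (carrier (grp L B))"
      using a o car by (simp add: L_def)
  next
    fix A x assume A: "A \<in> Obj C" "x \<in> carrier (grp L A)"
    then obtain n f where f: "f \<in> Hom C A (E n)" "x = q A (n, f)"
      using rep by blast
    then show "act L (Ident C A) x = x" using A act[OF f(1)] HomD[OF f(1)] by simp
  next
    fix u A B v D x assume h: "u \<in> Hom C A B" "v \<in> Hom C B D" "x \<in> carrier (grp L D)"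
    then obtain n f where f: "f \<in> Hom C D (E n)" "x = q D (n, f)"
      using rep[OF Hom_Obj(2)[OF h(2)]] by blast
    then show "act L (v \<cdot> u) x = act L u (act L v x)"
      using act[OF f(1)] act[OF Comp_in_Hom[OF h(2) f(1)]] HomD[OF f(1)] HomD[OF h(1)] HomD[OF h(2)]
      by simp
  next
    fix u A B v x assume h: "u \<in> Hom C A B" "v \<in> Hom C A B" "x \<in> carrier (grp L B)"
    then obtain n f where f: "f \<in> Hom C B (E n)" "x = q B (n, f)"
      using rep[OF Hom_Obj(2)[OF h(2)]] by blast
    then show "act L (Add C u v) x = act L u x \<otimes>\<^bsub>grp L A\<^esub> act L v x"
      using act[OF f(1)] mult[OF Comp_in_Hom[OF h(1) f(1)] Comp_in_Hom[OF h(2) f(1)]]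
        HomD[OF f(1)] HomD[OF h(1)] HomD[OF h(2)] Comp_Add_right[OF h(1,2) f(1)]
      by simp
  qed (auto simp: L_def)
  define \<xi> where "\<xi> n = q (E n) (n, Ident C (E n))" for n
  have act_\<xi>: "act L f (\<xi> n) = q A (n, f)" if "f \<in> Hom C A (E n)" for A f n
    unfolding \<xi>_def using act[OF Ident_in_Hom[OF E], of f n] HomD[OF that] by simp
  have "presentation C L E e \<xi>"
  proof (intro presentation.intro thread.intro presheaf_over.intro thread_axioms.intro presentation_axioms.intro)
    fix n
    show "\<xi> n \<in> carrier (grp L (E n))" unfolding \<xi>_def by (rule mem[OF Ident_in_Hom[OF E]])
    have e: "e n \<in> Hom C (E n) (E (Suc n))" using assms unfolding chain_def by blast
    then have "tr n (Suc n) = e n" using HomD[OF e] by (simp add: tr_def)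
    then show "act L (e n) (\<xi> (Suc n)) = \<xi> n"
      using act_\<xi>[OF e] unfolding \<xi>_def using q_stage[OF Ident_in_Hom[OF E], of n "Suc n"] HomD[OF e] by simp
  next
    fix A x assume "A \<in> Obj C" "x \<in> carrier (grp L A)"
    then obtain n f where f: "f \<in> Hom C A (E n)" "x = q A (n, f)"
      using rep by blast
    then show "\<exists>n. \<exists>f \<in> Hom C A (E n). x = act L f (\<xi> n)"
      by (intro exI[of _ n] bexI[of _ f]) (simp_all add: act_\<xi>[OF f(1)])
  next
    fix f A n assume f: "f \<in> Hom C A (E n)" "act L f (\<xi> n) = \<one>\<^bsub>grp L A\<^esub>"
    have A: "A \<in> Obj C" by (rule Hom_Obj(1)[OF f(1)])
    have "q A (n, f) = q A (n, Zero C A (E n))" using f act_\<xi>[OF f(1)] one[OF A, of n] by simp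
    then obtain N where N: "n \<le> N" "tr n N \<cdot> f = tr n N \<cdot> Zero C A (E n)"
      using q_eq[OF f(1), of "Zero C A (E n)" n] A by (auto simp: Hom_iff)
    then show "\<exists>k. chain_map C E e n k \<cdot> f = Zero C A (E (n + k))"
      using A by (intro exI[of _ "N - n"]) (simp add: tr_def[symmetric])
  qed (use assms presheaf preadditive_category_axioms in auto)
  then show ?thesis by blast
qed

text \<open>Comparison with the colimit just constructed shows that every colimit of a chain of
  representables is computed objectwise.\<close>

lemma is_colimit_presentation:
  assumes "chain C E e"
    and "is_colimit (PMod C) (\<lambda>n. omap (yoneda C \<iota>) (E n)) (\<lambda>n. amap (yoneda C \<iota>) (e n)) X i"
  obtains \<xi> where "presentation C X E e \<xi>" "\<And>n. i n = ymap X (E n) (\<xi> n)"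
proof -
  note pre = preadditive_category_axioms
  obtain L :: "('o, 'm, 'u) presheaf" and \<zeta> where L: "presentation C L E e \<zeta>"
    using ex_presentation[OF assms(1)] by blast
  interpret L: presentation C L E e \<zeta> by fact
  have ci: "cocone (PMod C) (\<lambda>n. omap (yoneda C \<iota>) (E n)) (\<lambda>n. amap (yoneda C \<iota>) (e n)) X i"
    using assms(2) unfolding is_colimit_def by blast
  have cL: "cocone (PMod C) (\<lambda>n. omap (yoneda C \<iota>) (E n)) (\<lambda>n. amap (yoneda C \<iota>) (e n)) L
      (\<lambda>n. ymap L (E n) (\<zeta> n))"
    using presentation_is_colimit[OF L] unfolding is_colimit_def by blast
  define \<xi> where "\<xi> n = comps (i n) (E n) (\<iota> (Ident C (E n)))" for n
  have th: "thread C X E e \<xi>" and i: "\<And>n. i n = ymap X (E n) (\<xi> n)"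
    using cocone_thread[OF assms(1) ci] unfolding \<xi>_def by auto
  interpret X: thread C X E e \<xi> by fact
  obtain s where s: "s \<in> Hom (PMod C) X L" "\<And>n. s \<cdot>\<^bsub>PMod C\<^esub> i n = ymap L (E n) (\<zeta> n)"
    using assms(2) cL unfolding is_colimit_def by meson
  obtain t where t: "t \<in> Hom (PMod C) L X" "\<And>n. t \<cdot>\<^bsub>PMod C\<^esub> ymap L (E n) (\<zeta> n) = i n"
    using presentation_is_colimit[OF L] ci unfolding is_colimit_def by meson
  have iH: "i n \<in> Hom (PMod C) (yo (E n)) X" for n using ci unfolding cocone_def by simp
  have jH: "ymap L (E n) (\<zeta> n) \<in> Hom (PMod C) (yo (E n)) L" for n using cL unfolding cocone_def by simp
  interpret P: category "PMod C" by (rule category_PMod[OF pre])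
  have "t \<cdot>\<^bsub>PMod C\<^esub> s = Ident (PMod C) X"
  proof -
    have "\<exists>!u. u \<in> Hom (PMod C) X X \<and> (\<forall>n. u \<cdot>\<^bsub>PMod C\<^esub> i n = i n)"
      using assms(2) ci unfolding is_colimit_def by blast
    moreover have "(t \<cdot>\<^bsub>PMod C\<^esub> s) \<cdot>\<^bsub>PMod C\<^esub> i n = i n" for n
      using P.Comp_assoc[OF iH s(1) t(1)] s(2) t(2) by metis
    moreover have "Ident (PMod C) X \<cdot>\<^bsub>PMod C\<^esub> i n = i n" for n
      using P.Comp_Ident_left[OF iH] .
    moreover have "Ident (PMod C) X \<in> Hom (PMod C) X X"
      using PMod_Ident_Hom[OF pre X.additive_presheaf_axioms] .
    ultimately show ?thesis using PMod_Comp_Hom[OF pre s(1) t(1)] by blast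
  qed
  then have ts: "comps t A (comps s A x) = x" if "A \<in> Obj C" "x \<in> carrier (grp X A)" for A x
    using comps_Comp[OF s(1) that, of t] comps_Ident[OF that] by simp
  have sy: "comps s (E n) (\<xi> n) = \<zeta> n" for n
    using arg_cong[OF s(2)[of n], of "\<lambda>u. comps u (E n) (\<iota> (Ident C (E n)))"]
      comps_Comp[OF iH X.E_Obj yo_Ident[OF X.E_Obj]]
    by (simp add: \<xi>_def ymap_apply[OF Ident_in_Hom[OF X.E_Obj]] del: PMod_simps(6))
  have "presentation C X E e \<xi>"
  proof (intro presentation.intro th presentation_axioms.intro)
    fix A x assume h: "A \<in> Obj C" "x \<in> carrier (grp X A)"
    obtain n f where f: "f \<in> Hom C A (E n)" "comps s A x = act L f (\<zeta> n)"
      using L.reached[OF h(1) comps_closed[OF s(1) h]] by blast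
    note a = HomD[OF f(1)]
    have "comps s A x = comps s A (act X f (\<xi> n))"
      using f comps_natural[OF s(1) a] sy by simp
    moreover have "act X f (\<xi> n) \<in> carrier (grp X A)" using a by simp
    ultimately have "x = act X f (\<xi> n)"
      using ts[OF h] ts[OF h(1), of "act X f (\<xi> n)"] by metis
    then show "\<exists>n. \<exists>f \<in> Hom C A (E n). x = act X f (\<xi> n)" using f(1) by blast
  next
    fix f A n assume f: "f \<in> Hom C A (E n)" "act X f (\<xi> n) = \<one>\<^bsub>grp X A\<^esub>"
    note a = HomD[OF f(1)]
    have A: "A \<in> Obj C" by (rule Hom_Obj(1)[OF f(1)])
    interpret GX: comm_group "grp X A" using X.grp_comm_group A by simp
    interpret GL: comm_group "grp L A" using L.grp_comm_group A by simp
    have "comps s A \<one>\<^bsub>grp X A\<^esub> = \<one>\<^bsub>grp L A\<^esub>"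
      using hom_one[OF natural_transformation.comps_hom[of C s A]] s(1) A
        GX.group_axioms GL.group_axioms by (simp add: Hom_PMod_iff)
    then have "act L f (\<zeta> n) = \<one>\<^bsub>grp L A\<^esub>"
      using f comps_natural[OF s(1) a, of "\<xi> n"] sy by simp
    then show "\<exists>k. chain_map C E e n k \<cdot> f = Zero C A (E (n + k))" using L.dies f(1) by blast
  qed
  then show thesis using that i by blast
qed

end

locale additive_adjunction = adjoint_pair C D H K \<eta> \<epsilon> + PC: preadditive_category C +
    PD: preadditive_category D + HA: additive_functor C D H
  for C :: "('o, 'm, 'x) ab_cat_scheme" and D :: "('p, 'n, 'y) ab_cat_scheme"
    and H :: "('o, 'm, 'p, 'n) func" and K :: "('p, 'n, 'o, 'm) func"
    and \<eta> :: "'o \<Rightarrow> 'm" and \<epsilon> :: "'p \<Rightarrow> 'n"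

text \<open>Precomposition with a left adjoint turns the colimit of the representables of \<open>E n\<close> into
  the colimit of the representables of \<open>K (E n)\<close>: arrows \<open>g\<close> from \<open>A\<close> to
  \<open>K (E n)\<close> correspond to arrows \<open>\<epsilon> (E n) \<cdot> H g\<close> from \<open>H A\<close> to \<open>E n\<close>.\<close>

lemma (in additive_adjunction) presentation_precomp:
  assumes "presentation D X E e \<xi>"
  shows "presentation C (presheaf_comp C H X) (\<lambda>n. omap K (E n)) (\<lambda>n. amap K (e n))
    (\<lambda>n. act X (\<epsilon> (E n)) (\<xi> n))"
proof -
  note assms' = PC.preadditive_category_axioms PD.preadditive_category_axioms HA.additive_functor_axioms
  interpret X: presentation D X E e \<xi> by fact
  let ?HX = "presheaf_comp C H X"
  have ps: "additive_presheaf C ?HX"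
    using additive_functor_precomp(2)[OF assms' X.additive_presheaf_axioms] .
  have act: "act ?HX g (act X (\<epsilon> (E n)) (\<xi> n)) = act X (\<epsilon> (E n) \<cdot>\<^bsub>D\<^esub> amap H g) (\<xi> n)"
    if "g \<in> Hom C A (omap K (E n))" for A g n
    using HomD[OF that] by simp
  have e: "chain D E e" by (rule X.chain)
  show ?thesis
  proof (intro presentation.intro thread.intro presheaf_over.intro thread_axioms.intro
      presentation_axioms.intro)
    show "chain C (\<lambda>n. omap K (E n)) (\<lambda>n. amap K (e n))" by (rule K.chain_omap[OF e])
    fix n
    show "act X (\<epsilon> (E n)) (\<xi> n) \<in> carrier (grp ?HX (omap K (E n)))" by simp
    have "act ?HX (amap K (e n)) (act X (\<epsilon> (E (Suc n))) (\<xi> (Suc n)))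
      = act X (e n \<cdot>\<^bsub>D\<^esub> \<epsilon> (E n)) (\<xi> (Suc n))"
      using act[of "amap K (e n)" "omap K (E n)" "Suc n"] counit_natural[of "e n"]
      by (simp add: Hom_iff del: X.act_comp)
    then show "act ?HX (amap K (e n)) (act X (\<epsilon> (E (Suc n))) (\<xi> (Suc n))) = act X (\<epsilon> (E n)) (\<xi> n)"
      by (simp add: X.\<xi>_compat)
  next
    fix A x assume h: "A \<in> Obj C" "x \<in> carrier (grp ?HX A)"
    then obtain n f where f: "f \<in> Hom D (omap H A) (E n)" "x = act X f (\<xi> n)"
      using X.reached[of "omap H A" x] by force
    let ?g = "amap K f \<cdot>\<^bsub>C\<^esub> \<eta> A"
    have g: "?g \<in> Hom C A (omap K (E n))" using HomD[OF f(1)] h by (simp add: Hom_iff)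
    have "x = act ?HX ?g (act X (\<epsilon> (E n)) (\<xi> n))"
      unfolding act[OF g] transpose_left[OF f(1) h(1)] by (rule f(2))
    then show "\<exists>n. \<exists>f \<in> Hom C A (omap K (E n)). x = act ?HX f (act X (\<epsilon> (E n)) (\<xi> n))"
      using g by blast
  next
    fix g A n assume g: "g \<in> Hom C A (omap K (E n))"
      and one: "act ?HX g (act X (\<epsilon> (E n)) (\<xi> n)) = \<one>\<^bsub>grp ?HX A\<^esub>"
    note a = HomD[OF g]
    have A: "A \<in> Obj C" by (rule H.C.Hom_Obj(1)[OF g])
    let ?f = "\<epsilon> (E n) \<cdot>\<^bsub>D\<^esub> amap H g"
    have f: "?f \<in> Hom D (omap H A) (E n)" using a by (simp add: Hom_iff)
    have "act X ?f (\<xi> n) = \<one>\<^bsub>grp X (omap H A)\<^esub>" using one A act[OF g] by simp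
    then obtain k where k: "chain_map D E e n k \<cdot>\<^bsub>D\<^esub> ?f = Zero D (omap H A) (E (n + k))"
      using X.dies[OF f] by blast
    let ?c = "amap K (chain_map D E e n k) \<cdot>\<^bsub>C\<^esub> g"
    have c: "?c \<in> Hom C A (omap K (E (n + k)))" "Zero C A (omap K (E (n + k))) \<in> Hom C A (omap K (E (n + k)))"
      using a A by (simp_all add: Hom_iff)
    have "\<epsilon> (E (n + k)) \<cdot>\<^bsub>D\<^esub> amap H ?c
      = (\<epsilon> (E (n + k)) \<cdot>\<^bsub>D\<^esub> amap H (amap K (chain_map D E e n k))) \<cdot>\<^bsub>D\<^esub> amap H g"
      using a by simp
    also have "\<dots> = Zero D (omap H A) (E (n + k))"
      using a counit_natural[of "chain_map D E e n k"] k by simp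
    also have "\<dots> = \<epsilon> (E (n + k)) \<cdot>\<^bsub>D\<^esub> amap H (Zero C A (omap K (E (n + k))))"
      using A HA.amap_Zero[OF assms'(1,2)] by simp
    finally have "?c = Zero C A (omap K (E (n + k)))"
      using transpose_right[OF c(1) X.E_Obj] transpose_right[OF c(2) X.E_Obj] by metis
    then show "\<exists>k. chain_map C (\<lambda>n. omap K (E n)) (\<lambda>n. amap K (e n)) n k \<cdot>\<^bsub>C\<^esub> g
        = Zero C A (omap K (E (n + k)))"
      using K.chain_map_amap[OF e, of n k] by (intro exI[of _ k]) simp
  qed (use assms'(1) ps in auto)
qed

section \<open>Triangulated categories\<close>

context triangulated_category
begin

sublocale Sh: additive_functor T T "Shift T"
  by (rule Shift_additive)

lemma Sigma_unshift [simp]: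
  "A \<in> Obj T \<Longrightarrow> omap (unshift T) A \<in> Obj T"
  "A \<in> Obj T \<Longrightarrow> Sigma_obj T (omap (unshift T) A) = A"
  "A \<in> Obj T \<Longrightarrow> omap (unshift T) (Sigma_obj T A) = A"
  "f \<in> Arr T \<Longrightarrow> amap (unshift T) f \<in> Arr T"
  "f \<in> Arr T \<Longrightarrow> Sigma_arr T (amap (unshift T) f) = f"
  "f \<in> Arr T \<Longrightarrow> amap (unshift T) (Sigma_arr T f) = f"
  using Shift_bij_Obj Shift_bij_Arr unfolding unshift_def bij_betw_def
  by (auto intro: inv_into_into f_inv_into_f)

lemma Sigma_arr_inject: "\<lbrakk>f \<in> Arr T; g \<in> Arr T; Sigma_arr T f = Sigma_arr T g\<rbrakk> \<Longrightarrow> f = g"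
  using Sigma_unshift(6) by metis

lemma unshift_dom [simp]:
  assumes "f \<in> Arr T"
  shows "Dom T (amap (unshift T) f) = omap (unshift T) (Dom T f)"
    "Cod T (amap (unshift T) f) = omap (unshift T) (Cod T f)"
  using Sh.amap_arr[of "amap (unshift T) f"] Sigma_unshift assms Dom_Obj Cod_Obj by metis+

lemma additive_functor_unshift: "additive_functor T T (unshift T)"
proof (intro additive_functor.intro cat_functor.intro cat_functor_axioms.intro
    additive_functor_axioms.intro category_axioms)
  fix A assume "A \<in> Obj T"
  then show "omap (unshift T) A \<in> Obj T" by simp
  show "amap (unshift T) (Ident T A) = Ident T (omap (unshift T) A)"
    using \<open>A \<in> Obj T\<close> by - (rule Sigma_arr_inject; simp)
next
  fix f X Y assume "f \<in> Hom T X Y"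
  then show "amap (unshift T) f \<in> Hom T (omap (unshift T) X) (omap (unshift T) Y)"
    by (auto simp: Hom_iff)
next
  fix f X Y g Z assume "f \<in> Hom T X Y" "g \<in> Hom T Y Z"
  then show "amap (unshift T) (g \<cdot> f) = amap (unshift T) g \<cdot> amap (unshift T) f"
    by - (rule Sigma_arr_inject; auto simp: Hom_iff)
next
  fix f X Y g assume h: "f \<in> Hom T X Y" "g \<in> Hom T X Y"
  then have "Sigma_arr T (Add T (amap (unshift T) f) (amap (unshift T) g)) = Add T f g"
    using Sh.amap_Add[of "amap (unshift T) f" "omap (unshift T) X" "omap (unshift T) Y"
      "amap (unshift T) g"] by (auto simp: Hom_iff)
  with h show "amap (unshift T) (Add T f g) = Add T (amap (unshift T) f) (amap (unshift T) g)"
    by - (rule Sigma_arr_inject; auto simp: Hom_iff)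
qed

sublocale U: additive_functor T T "unshift T"
  by (rule additive_functor_unshift)

lemma shift_pow_0 [simp]: "shift_pow T 0 X = X"
  by (simp add: shift_pow_def)

lemma shift_pow_minus_1: "shift_pow T (- 1) X = omap (unshift T) X"
  by (simp add: shift_pow_def)

lemma shift_pow_Obj [simp]: "X \<in> Obj T \<Longrightarrow> shift_pow T j X \<in> Obj T"
proof -
  assume X: "X \<in> Obj T"
  have "(Sigma_obj T ^^ n) X \<in> Obj T" "(omap (unshift T) ^^ n) X \<in> Obj T" for n
    using X by (induction n) auto
  then show ?thesis by (simp add: shift_pow_def)
qed

lemma shift_pow_plus_1:
  assumes "X \<in> Obj T"
  shows "shift_pow T (j + 1) X = Sigma_obj T (shift_pow T j X)"
proof (cases "0 \<le> j")
  case True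
  then have "nat (j + 1) = Suc (nat j)" by simp
  with True show ?thesis by (simp add: shift_pow_def)
next
  case False
  have *: "shift_pow T j X = omap (unshift T) ((omap (unshift T) ^^ nat (- (j + 1))) X)"
  proof -
    have "nat (- j) = Suc (nat (- (j + 1)))" using False by simp
    then have "(omap (unshift T) ^^ nat (- j)) X = omap (unshift T) ((omap (unshift T) ^^ nat (- (j + 1))) X)"
      by (metis comp_apply funpow.simps(2))
    then show ?thesis using False unfolding shift_pow_def by simp
  qed
  have "(omap (unshift T) ^^ n) X \<in> Obj T" for n using assms by (induction n) auto
  then have "Sigma_obj T (shift_pow T j X) = (omap (unshift T) ^^ nat (- (j + 1))) X"
    unfolding * by simp
  also have "\<dots> = shift_pow T (j + 1) X"
    using False by (cases "j = -1") (simp_all add: shift_pow_def)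
  finally show ?thesis ..
qed

lemma shift_pow_less_1:
  assumes "X \<in> Obj T"
  shows "shift_pow T (j - 1) X = omap (unshift T) (shift_pow T j X)"
  using shift_pow_plus_1[OF assms, of "j - 1"] assms by simp

lemma shift_pow_Sigma:
  assumes "X \<in> Obj T"
  shows "shift_pow T j (Sigma_obj T X) = shift_pow T (j + 1) X"
proof (induction j rule: int_induct[of _ 0])
  case base
  then show ?case using shift_pow_plus_1[OF assms, of 0] by simp
next
  case (step1 i)
  then show ?case
    using shift_pow_plus_1[of "Sigma_obj T X" i] shift_pow_plus_1[of X "i + 1"] assms by simp
next
  case (step2 i)
  then show ?case
    using shift_pow_less_1[of "Sigma_obj T X" i] shift_pow_less_1[of X "i + 1"] assms by simp
qed

lemma shift_pow_isomorphic: "isomorphic T X Y \<Longrightarrow> isomorphic T (shift_pow T j X) (shift_pow T j Y)"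
proof (induction j rule: int_induct[of _ 0])
  case base
  then show ?case by simp
next
  case (step1 i)
  then show ?case using shift_pow_plus_1 isomorphic_Obj Sh.omap_isomorphic by metis
next
  case (step2 i)
  then show ?case using shift_pow_less_1 isomorphic_Obj U.omap_isomorphic by metis
qed

lemma Tri_arr:
  assumes "(f, g, h) \<in> Tri T"
  shows "f \<in> Arr T" "g \<in> Arr T" "h \<in> Arr T" "Dom T g = Cod T f" "Dom T h = Cod T g"
    "Cod T h = Sigma_obj T (Dom T f)"
  using Tri_is_triangle[OF assms] unfolding is_triangle_def by (auto simp: Hom_iff)

lemma is_triangleI:
  "\<lbrakk>f \<in> Arr T; g \<in> Arr T; h \<in> Arr T; Dom T g = Cod T f; Dom T h = Cod T g;
    Cod T h = Sigma_obj T (Dom T f)\<rbrakk> \<Longrightarrow> is_triangle T f g h"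
  unfolding is_triangle_def by (auto simp: Hom_iff)

lemma Tri_rotate:
  assumes "is_triangle T f g h"
  shows "(f, g, h) \<in> Tri T \<longleftrightarrow> (g, h, Neg T (Sigma_arr T f)) \<in> Tri T"
proof -
  have "f \<in> Arr T" using assms unfolding is_triangle_def by (auto simp: Hom_iff)
  then show ?thesis using TR2[OF assms] by (simp add: Neg_def)
qed

lemma Tri_rotate_back:
  assumes "(f, g, h) \<in> Tri T"
  shows "(Neg T (amap (unshift T) h), f, g) \<in> Tri T"
proof -
  note a = Tri_arr[OF assms]
  let ?k = "Neg T (amap (unshift T) h)"
  have k: "?k \<in> Arr T" "Dom T ?k = omap (unshift T) (Cod T g)" "Cod T ?k = Dom T f"
    using a by simp_all
  have "Neg T (Sigma_arr T ?k) = h"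
  proof -
    let ?u = "amap (unshift T) h"
    have u: "?u \<in> Hom T (omap (unshift T) (Cod T g)) (Dom T f)" "?k \<in> Hom T (omap (unshift T) (Cod T g)) (Dom T f)"
      using a k by (simp_all add: Hom_iff)
    have "Add T h (Sigma_arr T ?k) = Sigma_arr T (Add T ?u ?k)"
      using Sh.amap_Add[OF u] a by simp
    also have "\<dots> = Zero T (Dom T h) (Cod T h)"
      using Add_neg_right[OF u(1,1,1)] Sh.amap_Zero[OF preadditive_category_axioms preadditive_category_axioms] a by simp
    finally have "Sigma_arr T ?k = Neg T h"
      using a k by (intro neg_eqI[of _ "Dom T h" "Cod T h"]) (simp_all add: Hom_iff)
    then show ?thesis using neg_neg a by simp
  qed
  moreover have "is_triangle T ?k f g" using a k by (intro is_triangleI) simp_all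
  ultimately show ?thesis using Tri_rotate[of ?k f g] assms by simp
qed

text \<open>The axiom TR3, applied to a map into the triangle \<open>\<Sigma>\<inverse> Z \<rightarrow> d \<rightarrow> d \<rightarrow> Z\<close> with a zero
  object \<open>Z\<close>.\<close>

lemma weak_cokernel:
  assumes "(f, g, h) \<in> Tri T" "u \<in> Arr T" "Dom T u = Cod T f" "u \<cdot> f = Zero T (Dom T f) (Cod T u)"
  shows "\<exists>v \<in> Hom T (Cod T g) (Cod T u). v \<cdot> g = u"
proof -
  note a = Tri_arr[OF assms(1)]
  let ?d = "Cod T u"
  obtain Z where Z: "zero_object T Z" using ex_zero_object by blast
  then have ZO: "Z \<in> Obj T" unfolding zero_object_def by blast
  let ?z = "Zero T (omap (unshift T) Z) ?d"
  have "Neg T (Sigma_arr T ?z) = Zero T Z (Sigma_obj T ?d)"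
    using assms(2) ZO by (intro zero_object_eq[OF Z, of _ Z "Sigma_obj T ?d"]) (simp_all add: Hom_iff)
  moreover have "(Ident T ?d, Zero T ?d Z, Zero T Z (Sigma_obj T ?d)) \<in> Tri T"
    using TR1_Ident Z assms(2) by simp
  moreover have "is_triangle T ?z (Ident T ?d) (Zero T ?d Z)"
    using assms(2) ZO by (intro is_triangleI) simp_all
  ultimately have tri: "(?z, Ident T ?d, Zero T ?d Z) \<in> Tri T" using Tri_rotate by simp
  have "\<exists>c \<in> Hom T (Dom T h) (Dom T (Zero T ?d Z)).
      c \<cdot> g = Ident T ?d \<cdot> u \<and> Sigma_arr T (Zero T (Dom T f) (omap (unshift T) Z)) \<cdot> h = Zero T ?d Z \<cdot> c"
    using a assms ZO by (intro TR3[OF assms(1) tri]) (simp_all add: Hom_iff)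
  then show ?thesis using a assms(2) ZO by auto
qed

lemma iso_arr_left_right:
  assumes "c \<in> Arr T" "l \<in> Hom T (Cod T c) (Dom T c)" "r \<in> Hom T (Cod T c) (Dom T c)"
    "l \<cdot> c = Ident T (Dom T c)" "c \<cdot> r = Ident T (Cod T c)"
  shows "iso_arr T c"
proof -
  note a = HomD[OF assms(2)] HomD[OF assms(3)]
  have "l = l \<cdot> (c \<cdot> r)" using a assms(1,5) by simp
  also have "\<dots> = (l \<cdot> c) \<cdot> r" using assoc[of r c l] a assms(1) by simp
  finally have "l = r" using a assms(1,4) by simp
  then show ?thesis using a assms by (intro iso_arrI[of _ _ l]) simp_all
qed

text \<open>An endomorphism of a distinguished triangle that is the identity on the first two objects is
  invertible: the difference \<open>d\<close> of its third component and the identity factors through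
  \<open>h\<close>, and \<open>h\<close> kills \<open>d\<close>, so that \<open>d \<cdot> d = 0\<close>.\<close>

lemma Tri_unipotent:
  assumes tri: "(f, g, h) \<in> Tri T" and w: "w \<in> Hom T (Cod T g) (Cod T g)" "w \<cdot> g = g" "h \<cdot> w = h"
  shows "iso_arr T w"
proof -
  note a = Tri_arr[OF tri] HomD[OF w(1)]
  let ?D = "Cod T g" and ?I = "Ident T (Cod T g)"
  have D: "?D \<in> Obj T" using a by simp
  let ?d = "Add T w (Neg T ?I)"
  have I: "?I \<in> Hom T ?D ?D" "Neg T ?I \<in> Hom T ?D ?D" using D by (simp_all add: Hom_iff)
  have d: "?d \<in> Hom T ?D ?D" "Neg T ?d \<in> Hom T ?D ?D" using w(1) I a by (simp_all add: Hom_iff)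
  have dd: "?d \<in> Arr T" "Dom T ?d = ?D" "Cod T ?d = ?D" using HomD[OF d(1)] by auto
  have g: "g \<in> Hom T (Cod T f) ?D" "h \<in> Hom T ?D (Cod T h)" using a by (simp_all add: Hom_iff)
  have "?d \<cdot> g = Add T g (Neg T g)"
    using Comp_Add_left[OF g(1) w(1) I(2)] Comp_neg(1)[of g ?I] w(2) a D by simp
  then have "?d \<cdot> g = Zero T (Dom T g) (Cod T ?d)" using Add_neg_right[OF g(1,1,1)] a dd by simp
  moreover have "(g, h, Neg T (Sigma_arr T f)) \<in> Tri T" using Tri_rotate Tri_is_triangle tri by blast
  ultimately obtain x where x: "x \<in> Hom T (Cod T h) (Cod T ?d)" "x \<cdot> h = ?d"
    using weak_cokernel[of g h _ ?d] dd by metis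
  have "h \<cdot> ?d = Add T h (Neg T h)"
    using Comp_Add_right[OF w(1) I(2) g(2)] Comp_neg(2)[of ?I h] w(3) a D by simp
  then have hd: "h \<cdot> ?d = Zero T ?D (Cod T h)" using Add_neg_right[OF g(2,2,2)] by simp
  have "?d \<cdot> ?d = (x \<cdot> h) \<cdot> ?d" using x(2) by simp
  also have "\<dots> = x \<cdot> (h \<cdot> ?d)" by (rule assoc) (use a dd HomD[OF x(1)] in simp_all)
  also have "\<dots> = Zero T ?D ?D" unfolding hd using a D dd HomD[OF x(1)] by simp
  finally have sq: "?d \<cdot> ?d = Zero T ?D ?D" .
  have w_eq: "w = Add T ?d ?I"
    using Add_assoc[OF w(1) I(2) I(1)] Add_neg_left[OF I(1,1,1)] Add_Zero_right[OF w(1,1,1)] by simp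
  let ?v = "Add T ?I (Neg T ?d)"
  have v: "?v \<in> Hom T ?D ?D" using I d by (simp add: Hom_iff)
  have cancel: "Add T w (Neg T ?d) = ?I"
    using Add_assoc[OF I(1) d(1) d(2)] Add_commute[OF d(1) I(1) I(1)] Add_neg_right[OF d(1,1,1)]
      Add_Zero_right[OF I(1,1,1)] w_eq by simp
  have "w \<cdot> ?d = ?d"
    using arg_cong[OF w_eq, of "\<lambda>k. k \<cdot> ?d"] Comp_Add_left[OF d(1) d(1) I(1)] sq dd
      Add_Zero_left[OF d(1,1,1)] by simp
  then have "w \<cdot> ?v = ?I"
    using Comp_Add_right[OF I(1) d(2) w(1)] Comp_neg(2)[of ?d w] a dd cancel by simp
  moreover have "?d \<cdot> w = ?d"
    using arg_cong[OF w_eq, of "\<lambda>k. ?d \<cdot> k"] Comp_Add_right[OF d(1) I(1) d(1)] sq dd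
      Add_Zero_left[OF d(1,1,1)] by simp
  then have "?v \<cdot> w = ?I"
    using Comp_Add_left[OF w(1) I(1) d(2)] Comp_neg(1)[of w ?d] a dd cancel by simp
  ultimately show ?thesis using v a by (intro iso_arr_left_right[of w ?v ?v]) simp_all
qed

text \<open>The comparison maps in both directions provided by TR3 compose to endomorphisms of triangles
  of the preceding kind.\<close>

lemma is_cone_unique:
  assumes "is_cone T f X" "is_cone T f X'"
  shows "isomorphic T X X'"
proof -
  from assms obtain g h g' h' where t: "(f, g, h) \<in> Tri T" "(f, g', h') \<in> Tri T"
    and X: "Cod T g = X" "Cod T g' = X'" unfolding is_cone_def by blast
  note a = Tri_arr[OF t(1)] Tri_arr[OF t(2)]
  have *: "\<exists>c \<in> Hom T (Cod T g) (Cod T g'). c \<cdot> g = g' \<and> h' \<cdot> c = h"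
    if t: "(f, g, h) \<in> Tri T" "(f, g', h') \<in> Tri T" for g h g' h'
  proof -
    note a = Tri_arr[OF t(1)] Tri_arr[OF t(2)]
    have "\<exists>c \<in> Hom T (Dom T h) (Dom T h'). c \<cdot> g = g' \<cdot> Ident T (Cod T f)
        \<and> Sigma_arr T (Ident T (Dom T f)) \<cdot> h = h' \<cdot> c"
      using a by (intro TR3[OF t]) (simp_all add: Hom_iff)
    then show ?thesis using a by auto
  qed
  obtain c where c: "c \<in> Hom T X X'" "c \<cdot> g = g'" "h' \<cdot> c = h" using *[OF t] X by blast
  obtain d where d: "d \<in> Hom T X' X" "d \<cdot> g' = g" "h \<cdot> d = h'" using *[OF t(2,1)] X by blast
  note b = HomD[OF c(1)] HomD[OF d(1)]
  have "(d \<cdot> c) \<cdot> g = g" using assoc[of g c d] a b X c d by simp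
  moreover have "h \<cdot> (d \<cdot> c) = h" using assoc[of c d h] a b X c d by simp
  ultimately have dc: "iso_arr T (d \<cdot> c)" using Tri_unipotent[OF t(1), of "d \<cdot> c"] b X by (simp add: Hom_iff)
  have "(c \<cdot> d) \<cdot> g' = g'" using assoc[of g' d c] a b X c d by simp
  moreover have "h' \<cdot> (c \<cdot> d) = h'" using assoc[of d c h'] a b X c d by simp
  ultimately have cd: "iso_arr T (c \<cdot> d)" using Tri_unipotent[OF t(2), of "c \<cdot> d"] b X by (simp add: Hom_iff)
  obtain l where l: "l \<in> Arr T" "Dom T l = X" "Cod T l = X" "l \<cdot> (d \<cdot> c) = Ident T X"
    using iso_arrE[OF dc] b by auto
  obtain r where r: "r \<in> Arr T" "Dom T r = X'" "Cod T r = X'" "(c \<cdot> d) \<cdot> r = Ident T X'"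
    using iso_arrE[OF cd] b by auto
  have "iso_arr T c"
    using b l r assoc[of r d c] assoc[of c d l]
    by (intro iso_arr_left_right[of c "l \<cdot> d" "d \<cdot> r"]) (simp_all add: Hom_iff)
  then show ?thesis unfolding isomorphic_def using c(1) by blast
qed

lemma ex_cone: "f \<in> Arr T \<Longrightarrow> \<exists>X. is_cone T f X"
  using TR1_cone unfolding is_cone_def by blast

lemma is_cone_arr: "is_cone T f X \<Longrightarrow> f \<in> Arr T \<and> X \<in> Obj T"
  unfolding is_cone_def using Tri_arr by auto

lemma Tri_iso_first:
  assumes tri: "(f, g, h) \<in> Tri T" and f': "f' \<in> Arr T"
    and a: "a \<in> Hom T (Dom T f) (Dom T f')" "iso_arr T a"
    and b: "b \<in> Hom T (Cod T f) (Cod T f')" "iso_arr T b"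
    and sq: "b \<cdot> f = f' \<cdot> a"
  shows "is_cone T f' (Cod T g)"
proof -
  note t = Tri_arr[OF tri] HomD[OF a(1)] HomD[OF b(1)]
  obtain b' where b': "b' \<in> Arr T" "Dom T b' = Cod T b" "Cod T b' = Dom T b"
    "b' \<cdot> b = Ident T (Dom T b)" "b \<cdot> b' = Ident T (Cod T b)"
    using iso_arrE[OF b(2)] by blast
  have gb: "g \<cdot> (b' \<cdot> b) = (g \<cdot> b') \<cdot> b" using t b' by simp
  have "(f', g \<cdot> b', Sigma_arr T a \<cdot> h) \<in> Tri T"
  proof (rule Tri_iso[OF tri _ a(1,2) _ b(2) _ _ sq])
    show "is_triangle T f' (g \<cdot> b') (Sigma_arr T a \<cdot> h)"
      using t b' f' by (intro is_triangleI) simp_all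
    show "b \<in> Hom T (Dom T g) (Dom T (g \<cdot> b'))" using t b' by (simp add: Hom_iff)
    show "Ident T (Cod T g) \<in> Hom T (Dom T h) (Dom T (Sigma_arr T a \<cdot> h))"
      using t by (simp add: Hom_iff)
    show "iso_arr T (Ident T (Cod T g))" using t by simp
    show "Ident T (Cod T g) \<cdot> g = (g \<cdot> b') \<cdot> b" using t b' gb by simp
    show "Sigma_arr T a \<cdot> h = (Sigma_arr T a \<cdot> h) \<cdot> Ident T (Cod T g)" using t by simp
  qed
  then show ?thesis unfolding is_cone_def using t b' by (intro exI) auto
qed

lemma is_cone_iso:
  assumes "is_cone T f X" "f' \<in> Arr T"
    and "a \<in> Hom T (Dom T f) (Dom T f')" "iso_arr T a"
    and "b \<in> Hom T (Cod T f) (Cod T f')" "iso_arr T b"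
    and "b \<cdot> f = f' \<cdot> a"
  shows "is_cone T f' X"
  using assms Tri_iso_first unfolding is_cone_def by metis

lemma is_cone_of_iso:
  assumes "iso_arr T f" "zero_object T Z"
  shows "is_cone T f Z"
proof -
  have f: "f \<in> Arr T" using assms(1) unfolding iso_arr_def by simp
  have Z: "Z \<in> Obj T" using assms(2) unfolding zero_object_def by blast
  have "is_cone T (Ident T (Dom T f)) Z"
    unfolding is_cone_def using TR1_Ident[OF _ assms(2), of "Dom T f"] f Z by force
  then show ?thesis
    by (rule is_cone_iso[where a = "Ident T (Dom T f)" and b = f])
      (use f assms(1) in \<open>simp_all add: Hom_iff\<close>)
qed

text \<open>Rotating a triangle three times applies the shift to it and changes the sign of all arrows;
  the sign of the first arrow is absorbed by an automorphism of its codomain.\<close>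

lemma is_cone_Sigma:
  assumes "is_cone T f X"
  shows "is_cone T (Sigma_arr T f) (Sigma_obj T X)"
proof -
  from assms obtain g h where t: "(f, g, h) \<in> Tri T" and X: "Cod T g = X"
    unfolding is_cone_def by blast
  note a = Tri_arr[OF t]
  have "(g, h, Neg T (Sigma_arr T f)) \<in> Tri T" using t Tri_rotate Tri_is_triangle by blast
  then have "(h, Neg T (Sigma_arr T f), Neg T (Sigma_arr T g)) \<in> Tri T"
    using Tri_rotate Tri_is_triangle by blast
  then have "(Neg T (Sigma_arr T f), Neg T (Sigma_arr T g), Neg T (Sigma_arr T h)) \<in> Tri T"
    using Tri_rotate Tri_is_triangle by blast
  then have "is_cone T (Neg T (Sigma_arr T f)) (Sigma_obj T X)"
    unfolding is_cone_def using a X by (intro exI conjI) auto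
  then show ?thesis
  proof (rule is_cone_iso[where a = "Ident T (Sigma_obj T (Dom T f))" and b = "Neg T (Ident T (Sigma_obj T (Cod T f)))"])
    have f: "Sigma_arr T f \<in> Arr T" using a by simp
    have "Neg T (Ident T (Sigma_obj T (Cod T f))) \<cdot> Neg T (Sigma_arr T f)
      = Neg T (Neg T (Ident T (Sigma_obj T (Cod T f)) \<cdot> Sigma_arr T f))"
      using a Comp_neg(1)[of "Neg T (Sigma_arr T f)" "Ident T (Sigma_obj T (Cod T f))"]
      by simp
    then show "Neg T (Ident T (Sigma_obj T (Cod T f))) \<cdot> Neg T (Sigma_arr T f)
      = Sigma_arr T f \<cdot> Ident T (Sigma_obj T (Dom T f))"
      using a neg_neg[OF f] by simp
  qed (use a iso_arr_neg_Ident in \<open>simp_all add: Hom_iff\<close>)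
qed

end

lemma (in triangulated_functor) is_cone_amap:
  assumes "triangulated_category S" "is_cone S f X"
  shows "is_cone T (amap F f) (omap F X)"
proof -
  from assms(2) obtain g h where t: "(f, g, h) \<in> Tri S" "Cod S g = X" unfolding is_cone_def by blast
  from shift_Tri obtain \<phi> where "(amap F f, amap F g, \<phi> (Dom S f) \<cdot>\<^bsub>T\<^esub> amap F h) \<in> Tri T"
    using t by blast
  moreover have "Cod T (amap F g) = omap F X"
    using triangulated_category.Tri_arr(2)[OF assms(1) t(1)] t(2) by simp
  ultimately show ?thesis unfolding is_cone_def by blast
qed

lemma (in triangulated_functor) shift_pow_omap:
  assumes "triangulated_category S" "triangulated_category T" "X \<in> Obj S"
  shows "isomorphic T (omap F (shift_pow S j X)) (shift_pow T j (omap F X))"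
proof -
  interpret S: triangulated_category S by fact
  interpret T: triangulated_category T by fact
  from shift_Tri obtain \<phi> where "nat_iso S T (F \<circ>\<^sub>F Shift S) (Shift T \<circ>\<^sub>F F) \<phi>" by blast
  then have Sigma: "isomorphic T (omap F (Sigma_obj S Y)) (Sigma_obj T (omap F Y))" if "Y \<in> Obj S" for Y
    using that unfolding nat_iso_def isomorphic_def func_comp_def by auto
  have unshift: "isomorphic T (omap F (omap (unshift S) Y)) (omap (unshift T) (omap F Y))"
    if Y: "Y \<in> Obj S" for Y
    using T.U.omap_isomorphic[OF D.isomorphic_sym[OF Sigma[of "omap (unshift S) Y"]]] Y by simp
  show ?thesis
  proof (induction j rule: int_induct[of _ 0])
    case base
    then show ?case using assms(3) D.isomorphic_refl by simp
  next
    case (step1 i)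
    then show ?case
      using D.isomorphic_trans[OF Sigma[of "shift_pow S i X"] T.Sh.omap_isomorphic[OF step1(2)]] assms(3)
      by (simp add: S.shift_pow_plus_1 T.shift_pow_plus_1)
  next
    case (step2 i)
    then show ?case
      using D.isomorphic_trans[OF unshift[of "shift_pow S i X"] T.U.omap_isomorphic[OF step2(2)]] assms(3)
      by (simp add: S.shift_pow_less_1 T.shift_pow_less_1)
  qed
qed

section \<open>Good Cauchy sequences\<close>

text \<open>Metrics enter through the fact that their members are closed under isomorphism. As cones are
  unique up to isomorphism, conditions on all cones of an arrow can then be checked on one cone.\<close>

definition replete :: "('o, 'm, 'x) cat_scheme \<Rightarrow> (nat \<Rightarrow> 'o set) \<Rightarrow> bool" where
  "replete T B \<longleftrightarrow> (\<forall>i. B i \<subseteq> Obj T) \<and> (\<forall>i X Y. X \<in> B i \<longrightarrow> isomorphic T X Y \<longrightarrow> Y \<in> B i)"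

text \<open>If \<open>X\<close> is in \<open>B i\<close> and isomorphic to \<open>Y\<close>, then there is a triangle
  \<open>X \<rightarrow> Y \<rightarrow> 0 \<rightarrow> \<Sigma> X\<close>, and \<open>Y\<close> is in \<open>B i * B i = B i\<close>.\<close>

lemma (in triangulated_category) replete_metric:
  assumes "is_metric T B"
  shows "replete T B"
proof -
  have "Y \<in> B i" if X: "X \<in> B i" and XY: "isomorphic T X Y" for i X Y
  proof -
    from assms obtain Z where Z: "Z \<in> B i" "zero_object T Z" unfolding is_metric_def by blast
    from XY obtain f where f: "f \<in> Hom T X Y" "iso_arr T f" unfolding isomorphic_def by blast
    obtain g h where t: "(f, g, h) \<in> Tri T" "Cod T g = Z"
      using is_cone_of_iso[OF f(2) Z(2)] unfolding is_cone_def by blast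
    then have "Y \<in> star T (B i) (B i)"
      unfolding star_def using HomD[OF f(1)] X Z(1) by auto
    then show ?thesis using assms unfolding is_metric_def by blast
  qed
  then show ?thesis using assms unfolding replete_def is_metric_def by blast
qed

lemma replete_preimage:
  assumes "replete T B" "cat_functor S T G"
  shows "replete S (preimage_metric S G B)"
proof -
  interpret cat_functor S T G by fact
  show ?thesis
    using assms(1) omap_isomorphic C.isomorphic_Obj unfolding replete_def preimage_metric_def by blast
qed

text \<open>The offset \<open>s\<close> is 1 for the shift of a sequence and 0 for its image under another
  triangulated functor.\<close>

lemma good_cauchy_transfer:
  assumes "good_cauchy T B E e" "chain T' E' e'"
    and "\<And>n k X'. is_cone T' (chain_map T' E' e' n k) X' \<Longrightarrow>
      \<exists>X. is_cone T (chain_map T E e n k) X \<and>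
        (\<forall>i j. shift_pow T (j + s) X \<in> B i \<longrightarrow> shift_pow T' j X' \<in> B' i)"
  shows "good_cauchy T' B' E' e'"
  unfolding good_cauchy_def
proof (intro conjI allI assms(2))
  fix i j
  obtain M where M: "\<And>m m' X. M \<le> m \<and> m \<le> m' \<Longrightarrow> is_cone T (chain_map T E e m (m' - m)) X \<Longrightarrow>
      shift_pow T (j + s) X \<in> B i"
    using assms(1) unfolding good_cauchy_def by meson
  show "\<exists>M. \<forall>m m'. M \<le> m \<and> m \<le> m' \<longrightarrow>
      (\<forall>D. is_cone T' (chain_map T' E' e' m (m' - m)) D \<longrightarrow> shift_pow T' j D \<in> B' i)"
    using M assms(3) by (intro exI[of _ M]) blast
qed

lemma (in triangulated_category) good_cauchy_Sigma:
  assumes "replete T B" "good_cauchy T B E e"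
  shows "good_cauchy T B (\<lambda>n. Sigma_obj T (E n)) (\<lambda>n. Sigma_arr T (e n))"
proof -
  have c: "chain T E e" using assms(2) unfolding good_cauchy_def by blast
  show ?thesis
  proof (rule good_cauchy_transfer[where s = 1, OF assms(2)])
    show "chain T (\<lambda>n. Sigma_obj T (E n)) (\<lambda>n. Sigma_arr T (e n))" by (rule Sh.chain_omap[OF c])
    fix n k X' assume X': "is_cone T (chain_map T (\<lambda>n. Sigma_obj T (E n)) (\<lambda>n. Sigma_arr T (e n)) n k) X'"
    let ?m = "chain_map T E e n k"
    have m: "?m \<in> Arr T" "chain_map T (\<lambda>n. Sigma_obj T (E n)) (\<lambda>n. Sigma_arr T (e n)) n k = Sigma_arr T ?m"
      using Sh.chain_map_amap[OF c, of n k] by (auto simp: Hom_iff)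
    obtain X where X: "is_cone T ?m X" using ex_cone m(1) by blast
    have XO: "X \<in> Obj T" using is_cone_arr[OF X] by blast
    have "isomorphic T (Sigma_obj T X) X'"
      using is_cone_unique[OF is_cone_Sigma[OF X]] X' m(2) by simp
    then have "isomorphic T (shift_pow T (j + 1) X) (shift_pow T j X')" for j
      using shift_pow_isomorphic[of "Sigma_obj T X" X' j] shift_pow_Sigma[OF XO] by simp
    then show "\<exists>X. is_cone T ?m X \<and> (\<forall>i j. shift_pow T (j + 1) X \<in> B i \<longrightarrow> shift_pow T j X' \<in> B i)"
      using X assms(1) unfolding replete_def by blast
  qed
qed

text \<open>A triangulated functor maps a cone of a connecting arrow to a cone and commutes with shifts up
  to isomorphism.\<close>

lemma (in triangulated_functor) good_cauchy_omap:
  assumes "triangulated_category S" "triangulated_category T"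
    and "good_cauchy S B E e" "replete S B" "replete T B'"
    and B: "\<And>i X. X \<in> B i \<Longrightarrow> omap F X \<in> B' i"
  shows "good_cauchy T B' (\<lambda>n. omap F (E n)) (\<lambda>n. amap F (e n))"
proof -
  interpret S: triangulated_category S by fact
  interpret T: triangulated_category T by fact
  have c: "chain S E e" using assms(3) unfolding good_cauchy_def by blast
  show ?thesis
  proof (rule good_cauchy_transfer[where s = 0, OF assms(3)])
    show "chain T (\<lambda>n. omap F (E n)) (\<lambda>n. amap F (e n))" by (rule chain_omap[OF c])
    fix n k X' assume X': "is_cone T (chain_map T (\<lambda>n. omap F (E n)) (\<lambda>n. amap F (e n)) n k) X'"
    let ?m = "chain_map S E e n k"
    have m: "?m \<in> Arr S" "chain_map T (\<lambda>n. omap F (E n)) (\<lambda>n. amap F (e n)) n k = amap F ?m"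
      using chain_map_amap[OF c, of n k] by (auto simp: Hom_iff)
    obtain X where X: "is_cone S ?m X" using S.ex_cone m(1) by blast
    have XO: "X \<in> Obj S" using S.is_cone_arr[OF X] by blast
    have "isomorphic T (omap F X) X'"
      using T.is_cone_unique[OF is_cone_amap[OF assms(1) X]] X' m(2) by simp
    then have "isomorphic T (omap F (shift_pow S j X)) (shift_pow T j X')" for j
      using T.shift_pow_isomorphic D.isomorphic_trans shift_pow_omap[OF assms(1,2) XO] by blast
    then have "shift_pow T j X' \<in> B' i" if "shift_pow S j X \<in> B i" for i j
      using B[OF that] assms(5) unfolding replete_def by metis
    then show "\<exists>X. is_cone S ?m X \<and> (\<forall>i j. shift_pow S (j + 0) X \<in> B i \<longrightarrow> shift_pow T j X' \<in> B' i)"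
      using X by (intro exI[of _ X]) simp
  qed
qed

section \<open>The completion\<close>

locale metric_category = triangulated_category T + small_category T \<iota>
  for T :: "('o, 'm, 'x) tri_cat_scheme" (structure) and \<iota> :: "'m \<Rightarrow> 'u" +
  fixes B :: "nat \<Rightarrow> 'o set"
  assumes replete: "replete T B"
begin

abbreviation "compl_objs \<equiv> completion_objs T \<iota> B"

lemma B_Obj: "b \<in> B i \<Longrightarrow> b \<in> Obj T"
  using replete unfolding replete_def by blast

text \<open>By the Yoneda lemma, orthogonality to representables is vanishing on the objects that they
  represent.\<close>

lemma compactly_supported_iff:
  "X \<in> compactly_supported T \<iota> B \<longleftrightarrow> additive_presheaf T X \<and>
    (\<forall>j. \<exists>i. \<forall>b \<in> B i. carrier (grp X (shift_pow T j b)) = {\<one>\<^bsub>grp X (shift_pow T j b)\<^esub>})"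
proof -
  have "X \<in> perp (PMod T) (omap (yoneda T \<iota>) ` shift_pow T j ` B i) \<longleftrightarrow> additive_presheaf T X \<and>
      (\<forall>b \<in> B i. carrier (grp X (shift_pow T j b)) = {\<one>\<^bsub>grp X (shift_pow T j b)\<^esub>})" for i j
  proof -
    have "Hom (PMod T) (yo (shift_pow T j b)) X = {Zero (PMod T) (yo (shift_pow T j b)) X} \<longleftrightarrow>
        carrier (grp X (shift_pow T j b)) = {\<one>\<^bsub>grp X (shift_pow T j b)\<^esub>}"
      if "additive_presheaf T X" "b \<in> B i" for b
      by (rule Hom_yoneda_trivial_iff[OF that(1)]) (simp add: B_Obj[OF that(2)])
    then show ?thesis by (simp add: perp_def del: PMod_simps(8) cong: conj_cong ball_cong)
  qed
  then show ?thesis unfolding compactly_supported_def by auto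
qed

lemma cauchy_colimits_iff:
  "X \<in> cauchy_colimits T \<iota> B \<longleftrightarrow> (\<exists>E e \<xi>. good_cauchy T B E e \<and> presentation T X E e \<xi>)"
proof
  assume "X \<in> cauchy_colimits T \<iota> B"
  then obtain E e i where "good_cauchy T B E e"
    "is_colimit (PMod T) (\<lambda>n. omap (yoneda T \<iota>) (E n)) (\<lambda>n. amap (yoneda T \<iota>) (e n)) X i"
    unfolding cauchy_colimits_def by blast
  then show "\<exists>E e \<xi>. good_cauchy T B E e \<and> presentation T X E e \<xi>"
    using is_colimit_presentation[of E e X i] unfolding good_cauchy_def by metis
next
  assume "\<exists>E e \<xi>. good_cauchy T B E e \<and> presentation T X E e \<xi>"
  then show "X \<in> cauchy_colimits T \<iota> B"
    using presentation_is_colimit unfolding cauchy_colimits_def by blast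
qed

lemma compl_objs_iff:
  "X \<in> compl_objs \<longleftrightarrow> additive_presheaf T X \<and>
    (\<forall>j. \<exists>i. \<forall>b \<in> B i. carrier (grp X (shift_pow T j b)) = {\<one>\<^bsub>grp X (shift_pow T j b)\<^esub>}) \<and>
    (\<exists>E e \<xi>. good_cauchy T B E e \<and> presentation T X E e \<xi>)"
  unfolding completion_objs_def Int_iff compactly_supported_iff cauchy_colimits_iff by blast

lemma compl_objs_presheaf: "X \<in> compl_objs \<Longrightarrow> additive_presheaf T X"
  unfolding compl_objs_iff by blast

lemma completion_simps [simp]:
  "Obj (completion T \<iota> B) = compl_objs"
  "Dom (completion T \<iota> B) = src"
  "Cod (completion T \<iota> B) = tgt"
  "Ident (completion T \<iota> B) = Ident (PMod T)"
  "\<eta> \<cdot>\<^bsub>completion T \<iota> B\<^esub> \<theta> = \<eta> \<cdot>\<^bsub>PMod T\<^esub> \<theta>"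
  "Add (completion T \<iota> B) = Add (PMod T)"
  "Shift (completion T \<iota> B) = precomp T (unshift T)"
  "Tri (completion T \<iota> B) = completion_Tri T \<iota> B"
  by (simp_all add: completion_def del: PMod_simps(5-8))

lemma Hom_completion_iff:
  "\<eta> \<in> Hom (completion T \<iota> B) X Y \<longleftrightarrow> \<eta> \<in> Hom (PMod T) X Y \<and> X \<in> compl_objs \<and> Y \<in> compl_objs"
  by (auto simp: completion_def Hom_iff)

lemma category_completion: "category (completion T \<iota> B)"
proof -
  interpret P: category "PMod T" by (rule category_PMod[OF preadditive_category_axioms])
  show ?thesis
  proof
    fix f assume "f \<in> Arr (completion T \<iota> B)"
    then show "Dom (completion T \<iota> B) f \<in> Obj (completion T \<iota> B)"
      "Cod (completion T \<iota> B) f \<in> Obj (completion T \<iota> B)"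
      by (simp_all add: completion_def)
  next
    fix A assume "A \<in> Obj (completion T \<iota> B)"
    then show "Ident (completion T \<iota> B) A \<in> Hom (completion T \<iota> B) A A"
      using PMod_Ident_Hom[OF preadditive_category_axioms compl_objs_presheaf]
      by (simp add: Hom_completion_iff del: PMod_simps)
  qed (use P.Comp_in_Hom P.Comp_Ident_right P.Comp_Ident_left P.Comp_assoc
      in \<open>auto simp: Hom_completion_iff simp del: PMod_simps\<close>)
qed

lemma iso_arr_completion:
  assumes "iso_arr (PMod T) \<eta>" "\<eta> \<in> Hom (completion T \<iota> B) X Y"
  shows "iso_arr (completion T \<iota> B) \<eta>"
proof -
  from assms(1) obtain \<theta> where "\<theta> \<in> Hom (PMod T) (tgt \<eta>) (src \<eta>)"
    "\<theta> \<cdot>\<^bsub>PMod T\<^esub> \<eta> = Ident (PMod T) (src \<eta>)" "\<eta> \<cdot>\<^bsub>PMod T\<^esub> \<theta> = Ident (PMod T) (tgt \<eta>)"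
    unfolding iso_arr_def by (auto simp del: PMod_simps(5,6))
  moreover have "src \<eta> = X" "tgt \<eta> = Y" "X \<in> compl_objs" "Y \<in> compl_objs"
    using assms(2) unfolding Hom_completion_iff by (auto simp: Hom_iff)
  ultimately show ?thesis
    using assms(2) unfolding iso_arr_def
    by (auto simp: Hom_completion_iff HomD(1)[OF assms(2)] simp del: PMod_simps intro!: bexI[of _ \<theta>])
qed

text \<open>As the shift is an automorphism, its inverse is left adjoint to it with identities as unit and
  counit. So precomposition with the inverse is covered by the results on adjunctions.\<close>

lemma unshift_adjunction: "additive_adjunction T T (unshift T) (Shift T) (Ident T) (Ident T)"
  by (intro additive_adjunction.intro adjoint_pair.intro adjoint_pair_axioms.intro
      U.cat_functor_axioms Sh.cat_functor_axioms U.additive_functor_axioms preadditive_category_axioms)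
    (simp_all add: Hom_iff)

lemma presheaf_unshift:
  "additive_presheaf T X \<Longrightarrow> additive_presheaf T (presheaf_comp T (unshift T) X)"
  by (rule additive_functor_precomp(2)[OF preadditive_category_axioms preadditive_category_axioms
        additive_functor_unshift])

lemma compl_objs_unshift:
  assumes "X \<in> compl_objs"
  shows "presheaf_comp T (unshift T) X \<in> compl_objs"
proof -
  have X: "additive_presheaf T X" by (rule compl_objs_presheaf[OF assms])
  have "\<exists>i. \<forall>b \<in> B i. carrier (grp (presheaf_comp T (unshift T) X) (shift_pow T j b))
      = {\<one>\<^bsub>grp (presheaf_comp T (unshift T) X) (shift_pow T j b)\<^esub>}" for j
  proof -
    obtain i where "\<forall>b \<in> B i. carrier (grp X (shift_pow T (j - 1) b)) = {\<one>\<^bsub>grp X (shift_pow T (j - 1) b)\<^esub>}"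
      using assms unfolding compl_objs_iff by blast
    then show ?thesis using B_Obj by (intro exI[of _ i]) (simp add: shift_pow_less_1)
  qed
  moreover obtain E e \<xi> where E: "good_cauchy T B E e" "presentation T X E e \<xi>"
    using assms unfolding compl_objs_iff by blast
  ultimately show ?thesis
    using presheaf_unshift[OF X] good_cauchy_Sigma[OF replete E(1)]
      additive_adjunction.presentation_precomp[OF unshift_adjunction E(2)]
    unfolding compl_objs_iff by blast
qed

text \<open>The commutative squares in the definition of a distinguished triangle of the completion are
  equalities of natural transformations on representables, hence of elements.\<close>

lemma yoneda_square_iff:
  assumes "f \<in> Hom (PMod T) X Z" "p \<in> Hom T a b" "\<xi> \<in> carrier (grp X a)" "\<upsilon> \<in> carrier (grp Z b)"
  shows "f \<cdot>\<^bsub>PMod T\<^esub> ymap X a \<xi> = ymap Z b \<upsilon> \<cdot>\<^bsub>PMod T\<^esub> amap (yoneda T \<iota>) p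
    \<longleftrightarrow> comps f a \<xi> = act Z p \<upsilon>" (is "?l = ?r \<longleftrightarrow> _")
proof -
  interpret X: presheaf_over T X using presheaf_over_src_tgt(1)[OF preadditive_category_axioms assms(1)] .
  interpret Z: presheaf_over T Z using presheaf_over_src_tgt(2)[OF preadditive_category_axioms assms(1)] .
  note o = Hom_Obj[OF assms(2)] and a = HomD[OF assms(2)]
  have i: "ymap X a \<xi> \<in> Hom (PMod T) (yo a) X" "ymap Z b \<upsilon> \<in> Hom (PMod T) (yo b) Z"
    using ymap_Hom X.additive_presheaf_axioms Z.additive_presheaf_axioms assms(3,4) o by auto
  have l: "?l \<in> Hom (PMod T) (yo a) Z" by (rule PMod_Comp_Hom[OF preadditive_category_axioms i(1) assms(1)])
  have r: "?r \<in> Hom (PMod T) (yo a) Z"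
    by (rule PMod_Comp_Hom[OF preadditive_category_axioms yoneda_amap_Hom[OF assms(2)] i(2)])
  have "comps ?l a (\<iota> (Ident T a)) = comps f a \<xi>"
    using comps_Comp[OF i(1) o(1) yo_Ident[OF o(1)]] ymap_apply[OF Ident_in_Hom[OF o(1)]] assms(3) o by simp
  moreover have "comps ?r a (\<iota> (Ident T a)) = act Z p \<upsilon>"
    using comps_Comp[OF yoneda_amap_Hom[OF assms(2)] o(1) yo_Ident[OF o(1)], of "ymap Z b \<upsilon>"]
      yoneda_amap_apply[OF assms(2) Ident_in_Hom[OF o(1)]] ymap_apply[OF assms(2)] a
    by (simp del: PMod_simps(6))
  ultimately show ?thesis using yoneda_eqI[OF l r o(1)] by (metis (no_types))
qed

lemma yoneda_shift_ymap:
  assumes "a \<in> Obj T"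
  shows "yoneda_shift T \<iota> a = ymap (presheaf_comp T (unshift T) (yo a)) (Sigma_obj T a) (\<iota> (Ident T a))"
proof -
  have "\<iota> (amap (unshift T) (inv_into (Hom T x (Sigma_obj T a)) \<iota> y)) =
      act (presheaf_comp T (unshift T) (yo a)) (inv_into (Hom T x (Sigma_obj T a)) \<iota> y) (\<iota> (Ident T a))"
    if "x \<in> Obj T" "y \<in> \<iota> ` Hom T x (Sigma_obj T a)" for x y
  proof -
    from that obtain f where f: "f \<in> Hom T x (Sigma_obj T a)" "y = \<iota> f" by blast
    note a = HomD[OF f(1)]
    have "Ident T a \<in> Hom T (Cod T (amap (unshift T) f)) a" using a assms by (simp add: Hom_iff)
    then show ?thesis unfolding f(2) inv_\<iota>[OF f(1)] using yo_act[of "amap (unshift T) f" "Ident T a" a] a assms by simp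
  qed
  then show ?thesis
    by (auto simp: yoneda_shift_def ymap_def mk_map_def yo_carrier cong: restrict_cong)
qed

lemma yoneda_shift_square_iff:
  assumes "h \<in> Hom (PMod T) Z (omap (precomp T (unshift T)) X)" "r \<in> Hom T c (Sigma_obj T a)"
    and "a \<in> Obj T" "additive_presheaf T X" "\<zeta> \<in> carrier (grp Z c)" "\<xi> \<in> carrier (grp X a)"
  shows "h \<cdot>\<^bsub>PMod T\<^esub> ymap Z c \<zeta> = amap (precomp T (unshift T)) (ymap X a \<xi>)
      \<cdot>\<^bsub>PMod T\<^esub> yoneda_shift T \<iota> a \<cdot>\<^bsub>PMod T\<^esub> amap (yoneda T \<iota>) r
    \<longleftrightarrow> comps h c \<zeta> = act X (amap (unshift T) r) \<xi>"
proof -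
  note pre = preadditive_category_axioms
  interpret P: additive_functor "PMod T" "PMod T" "precomp T (unshift T)"
    by (rule additive_functor_precomp(1)[OF pre pre additive_functor_unshift])
  let ?X = "presheaf_comp T (unshift T) X" and ?Y = "presheaf_comp T (unshift T) (yo a)"
  let ?i = "amap (precomp T (unshift T)) (ymap X a \<xi>)"
  have SO: "Sigma_obj T a \<in> Obj T" using assms(3) by simp
  have id: "\<iota> (Ident T a) \<in> carrier (grp ?Y (Sigma_obj T a))" using yo_Ident[OF assms(3)] assms(3) by simp
  have i: "?i \<in> Hom (PMod T) ?Y ?X"
    using P.amap_in_Hom[OF ymap_Hom[OF assms(4,3,6)]] by simp
  have s: "yoneda_shift T \<iota> a \<in> Hom (PMod T) (yo (Sigma_obj T a)) ?Y"
    unfolding yoneda_shift_ymap[OF assms(3)]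
    by (rule ymap_Hom[OF presheaf_unshift[OF additive_presheaf_yo[OF assms(3)]] SO id])
  have \<xi>: "\<xi> \<in> carrier (grp ?X (Sigma_obj T a))" using assms(3,6) by simp
  have isq: "?i \<cdot>\<^bsub>PMod T\<^esub> yoneda_shift T \<iota> a = ymap ?X (Sigma_obj T a) \<xi>"
  proof (rule yoneda_eqI[OF PMod_Comp_Hom[OF pre s i] ymap_Hom[OF presheaf_unshift[OF assms(4)] SO \<xi>] SO])
    interpret X: presheaf_over T X using pre assms(4) by (simp add: presheaf_over_def)
    have "comps (yoneda_shift T \<iota> a) (Sigma_obj T a) (\<iota> (Ident T (Sigma_obj T a))) = \<iota> (Ident T a)"
      unfolding yoneda_shift_ymap[OF assms(3)] ymap_apply[OF Ident_in_Hom[OF SO]]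
      using yo_act[of "Ident T a" "Ident T a" a] assms(3) by (simp add: Hom_iff)
    then have "comps (?i \<cdot>\<^bsub>PMod T\<^esub> yoneda_shift T \<iota> a) (Sigma_obj T a) (\<iota> (Ident T (Sigma_obj T a))) = \<xi>"
      unfolding comps_Comp[OF s SO yo_Ident[OF SO]]
      using ymap_apply[OF Ident_in_Hom[OF assms(3)], of X \<xi>] assms(3,6) by simp
    moreover have "comps (ymap ?X (Sigma_obj T a) \<xi>) (Sigma_obj T a) (\<iota> (Ident T (Sigma_obj T a))) = \<xi>"
      unfolding ymap_apply[OF Ident_in_Hom[OF SO]] using assms(3,6) by simp
    ultimately show "comps (?i \<cdot>\<^bsub>PMod T\<^esub> yoneda_shift T \<iota> a) (Sigma_obj T a) (\<iota> (Ident T (Sigma_obj T a)))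
      = comps (ymap ?X (Sigma_obj T a) \<xi>) (Sigma_obj T a) (\<iota> (Ident T (Sigma_obj T a)))" by (simp only:)
  qed
  have h: "h \<in> Hom (PMod T) Z ?X" using assms(1) by simp
  show ?thesis
    unfolding isq yoneda_square_iff[OF h assms(2,5) \<xi>] using HomD[OF assms(2)] by simp
qed

text \<open>Triangles of the completion with all their data, in which colimits are replaced by
  presentations and commutative squares by equations between elements.\<close>

definition presented_triangle where
  "presented_triangle X a \<alpha> \<xi> Y b \<beta> \<upsilon> Z c \<gamma> \<zeta> p q r f g h \<longleftrightarrow>
    f \<in> Hom (PMod T) X Y \<and> g \<in> Hom (PMod T) Y Z \<and> h \<in> Hom (PMod T) Z (presheaf_comp T (unshift T) X) \<and>
    good_cauchy T B a \<alpha> \<and> good_cauchy T B b \<beta> \<and> good_cauchy T B c \<gamma> \<and>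
    (\<forall>n. (p n, q n, r n) \<in> Tri T \<and>
      p n \<in> Hom T (a n) (b n) \<and> q n \<in> Hom T (b n) (c n) \<and> r n \<in> Hom T (c n) (Sigma_obj T (a n)) \<and>
      p (Suc n) \<cdot> \<alpha> n = \<beta> n \<cdot> p n \<and> q (Suc n) \<cdot> \<beta> n = \<gamma> n \<cdot> q n \<and>
      r (Suc n) \<cdot> \<gamma> n = Sigma_arr T (\<alpha> n) \<cdot> r n) \<and>
    presentation T X a \<alpha> \<xi> \<and> presentation T Y b \<beta> \<upsilon> \<and> presentation T Z c \<gamma> \<zeta> \<and>
    (\<forall>n. comps f (a n) (\<xi> n) = act Y (p n) (\<upsilon> n) \<and> comps g (b n) (\<upsilon> n) = act Z (q n) (\<zeta> n) \<and>
      comps h (c n) (\<zeta> n) = act X (amap (unshift T) (r n)) (\<xi> n))"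

lemma completion_Tri_iff:
  "(f, g, h) \<in> completion_Tri T \<iota> B \<longleftrightarrow>
    (\<exists>X \<in> compl_objs. \<exists>Y \<in> compl_objs. \<exists>Z \<in> compl_objs. \<exists>a \<alpha> \<xi> b \<beta> \<upsilon> c \<gamma> \<zeta> p q r.
      presented_triangle X a \<alpha> \<xi> Y b \<beta> \<upsilon> Z c \<gamma> \<zeta> p q r f g h)" (is "_ \<longleftrightarrow> ?R")
proof
  assume "(f, g, h) \<in> completion_Tri T \<iota> B"
  then obtain X Y Z a \<alpha> b \<beta> c \<gamma> p q r i j k where
    o: "X \<in> compl_objs" "Y \<in> compl_objs" "Z \<in> compl_objs" and
    f: "f \<in> Hom (PMod T) X Y" and g: "g \<in> Hom (PMod T) Y Z" and
    h: "h \<in> Hom (PMod T) Z (omap (precomp T (unshift T)) X)" and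
    gc: "good_cauchy T B a \<alpha>" "good_cauchy T B b \<beta>" "good_cauchy T B c \<gamma>" and
    t: "\<And>n. (p n, q n, r n) \<in> Tri T \<and>
            p n \<in> Hom T (a n) (b n) \<and> q n \<in> Hom T (b n) (c n) \<and>
            r n \<in> Hom T (c n) (Sigma_obj T (a n)) \<and>
            p (Suc n) \<cdot>\<^bsub>T\<^esub> \<alpha> n = \<beta> n \<cdot>\<^bsub>T\<^esub> p n \<and>
            q (Suc n) \<cdot>\<^bsub>T\<^esub> \<beta> n = \<gamma> n \<cdot>\<^bsub>T\<^esub> q n \<and>
            r (Suc n) \<cdot>\<^bsub>T\<^esub> \<gamma> n = Sigma_arr T (\<alpha> n) \<cdot>\<^bsub>T\<^esub> r n" and
    X: "is_colimit (PMod T) (\<lambda>n. omap (yoneda T \<iota>) (a n)) (\<lambda>n. amap (yoneda T \<iota>) (\<alpha> n)) X i" and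
    Y: "is_colimit (PMod T) (\<lambda>n. omap (yoneda T \<iota>) (b n)) (\<lambda>n. amap (yoneda T \<iota>) (\<beta> n)) Y j" and
    Z: "is_colimit (PMod T) (\<lambda>n. omap (yoneda T \<iota>) (c n)) (\<lambda>n. amap (yoneda T \<iota>) (\<gamma> n)) Z k" and
    sq: "\<And>n. f \<cdot>\<^bsub>PMod T\<^esub> i n = j n \<cdot>\<^bsub>PMod T\<^esub> amap (yoneda T \<iota>) (p n) \<and>
            g \<cdot>\<^bsub>PMod T\<^esub> j n = k n \<cdot>\<^bsub>PMod T\<^esub> amap (yoneda T \<iota>) (q n) \<and>
            h \<cdot>\<^bsub>PMod T\<^esub> k n =
              amap (precomp T (unshift T)) (i n) \<cdot>\<^bsub>PMod T\<^esub> yoneda_shift T \<iota> (a n)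
                \<cdot>\<^bsub>PMod T\<^esub> amap (yoneda T \<iota>) (r n)"
    unfolding completion_Tri_def mem_Collect_eq prod.case
    by (elim bexE exE conjE) (rule that; (erule spec | assumption))
  have ch: "chain T a \<alpha>" "chain T b \<beta>" "chain T c \<gamma>" using gc unfolding good_cauchy_def by auto
  obtain \<xi> where \<xi>: "presentation T X a \<alpha> \<xi>" "\<And>n. i n = ymap X (a n) (\<xi> n)"
    using is_colimit_presentation[OF ch(1) X] by blast
  obtain \<upsilon> where \<upsilon>: "presentation T Y b \<beta> \<upsilon>" "\<And>n. j n = ymap Y (b n) (\<upsilon> n)"
    using is_colimit_presentation[OF ch(2) Y] by blast
  obtain \<zeta> where \<zeta>: "presentation T Z c \<gamma> \<zeta>" "\<And>n. k n = ymap Z (c n) (\<zeta> n)"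
    using is_colimit_presentation[OF ch(3) Z] by blast
  interpret X: presentation T X a \<alpha> \<xi> by fact
  interpret Y: presentation T Y b \<beta> \<upsilon> by fact
  interpret Z: presentation T Z c \<gamma> \<zeta> by fact
  have "presented_triangle X a \<alpha> \<xi> Y b \<beta> \<upsilon> Z c \<gamma> \<zeta> p q r f g h"
    unfolding presented_triangle_def
    using f g h gc t \<xi>(1) \<upsilon>(1) \<zeta>(1) sq[unfolded \<xi>(2) \<upsilon>(2) \<zeta>(2)]
      yoneda_square_iff[OF f _ X.\<xi>_carrier Y.\<xi>_carrier]
      yoneda_square_iff[OF g _ Y.\<xi>_carrier Z.\<xi>_carrier]
      yoneda_shift_square_iff[OF h _ X.E_Obj X.additive_presheaf_axioms Z.\<xi>_carrier X.\<xi>_carrier]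
    by (simp del: PMod_simps)
  then show ?R using o by blast
next
  assume ?R
  then obtain X Y Z a \<alpha> \<xi> b \<beta> \<upsilon> c \<gamma> \<zeta> p q r where
    o: "X \<in> compl_objs" "Y \<in> compl_objs" "Z \<in> compl_objs" and
    t: "presented_triangle X a \<alpha> \<xi> Y b \<beta> \<upsilon> Z c \<gamma> \<zeta> p q r f g h" by blast
  have f: "f \<in> Hom (PMod T) X Y" and g: "g \<in> Hom (PMod T) Y Z" and
    h: "h \<in> Hom (PMod T) Z (omap (precomp T (unshift T)) X)" and
    gc: "good_cauchy T B a \<alpha>" and
    X: "presentation T X a \<alpha> \<xi>" and Y: "presentation T Y b \<beta> \<upsilon>" and Z: "presentation T Z c \<gamma> \<zeta>"
    using t unfolding presented_triangle_def by simp_all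
  interpret X: presentation T X a \<alpha> \<xi> by fact
  interpret Y: presentation T Y b \<beta> \<upsilon> by fact
  interpret Z: presentation T Z c \<gamma> \<zeta> by fact
  show "(f, g, h) \<in> completion_Tri T \<iota> B"
    unfolding completion_Tri_def mem_Collect_eq prod.case
    apply (rule bexI[OF _ o(1)], rule bexI[OF _ o(2)], rule bexI[OF _ o(3)])
    apply (rule exI[of _ a], rule exI[of _ \<alpha>], rule exI[of _ b], rule exI[of _ \<beta>], rule exI[of _ c], rule exI[of _ \<gamma>])
    apply (rule exI[of _ p], rule exI[of _ q], rule exI[of _ r])
    apply (rule exI[of _ "\<lambda>n. ymap X (a n) (\<xi> n)"], rule exI[of _ "\<lambda>n. ymap Y (b n) (\<upsilon> n)"], rule exI[of _ "\<lambda>n. ymap Z (c n) (\<zeta> n)"])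
    using t f g h good_cauchy_Sigma[OF replete gc] presentation_is_colimit[OF X] presentation_is_colimit[OF Y]
      presentation_is_colimit[OF Z] yoneda_square_iff[OF f _ X.\<xi>_carrier Y.\<xi>_carrier]
      yoneda_square_iff[OF g _ Y.\<xi>_carrier Z.\<xi>_carrier]
      yoneda_shift_square_iff[OF h _ X.E_Obj X.additive_presheaf_axioms Z.\<xi>_carrier X.\<xi>_carrier]
    unfolding presented_triangle_def
    by (simp del: PMod_simps omap_yoneda precomp_simps)
qed

lemma completion_nat_isoI:
  assumes P: "cat_functor A (completion T \<iota> B) P"
    and Q: "cat_functor A (completion T \<iota> B) Q"
    and Hom: "\<And>X. X \<in> Obj A \<Longrightarrow> \<tau> X \<in> Hom (PMod T) (omap P X) (omap Q X)"
    and bij: "\<And>X s. X \<in> Obj A \<Longrightarrow> s \<in> Obj T \<Longrightarrow>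
      bij_betw (comps (\<tau> X) s) (carrier (grp (omap P X) s)) (carrier (grp (omap Q X) s))"
    and nat: "\<And>f X Z s x. f \<in> Hom A X Z \<Longrightarrow> s \<in> Obj T \<Longrightarrow>
      x \<in> carrier (grp (omap P X) s) \<Longrightarrow>
      comps (\<tau> Z) s (comps (amap P f) s x) = comps (amap Q f) s (comps (\<tau> X) s x)"
  shows "nat_iso A (completion T \<iota> B) P Q \<tau>"
proof -
  interpret P: cat_functor A "completion T \<iota> B" P by fact
  interpret Q: cat_functor A "completion T \<iota> B" Q by fact
  have PQ: "omap P X \<in> compl_objs" "omap Q X \<in> compl_objs" if "X \<in> Obj A" for X
    using P.omap_in_Obj Q.omap_in_Obj that by simp_all
  have Hom': "\<tau> X \<in> Hom (completion T \<iota> B) (omap P X) (omap Q X)" if "X \<in> Obj A" for X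
    unfolding Hom_completion_iff using Hom PQ that by blast
  have "iso_arr (completion T \<iota> B) (\<tau> X)" if X: "X \<in> Obj A" for X
    by (rule iso_arr_completion[OF iso_arr_PModI[OF preadditive_category_axioms Hom[OF X] bij[OF X]] Hom'[OF X]])
  moreover have "\<tau> Z \<cdot>\<^bsub>completion T \<iota> B\<^esub> amap P f = amap Q f \<cdot>\<^bsub>completion T \<iota> B\<^esub> \<tau> X"
    if f: "f \<in> Hom A X Z" for f X Z
    unfolding completion_simps(5)
  proof -
    have o: "X \<in> Obj A" "Z \<in> Obj A" using P.C.Hom_Obj[OF f] by auto
    have Pf: "amap P f \<in> Hom (PMod T) (omap P X) (omap P Z)"
      and Qf: "amap Q f \<in> Hom (PMod T) (omap Q X) (omap Q Z)"
      using P.amap_in_Hom[OF f] Q.amap_in_Hom[OF f] unfolding Hom_completion_iff by auto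
    show "\<tau> Z \<cdot>\<^bsub>PMod T\<^esub> amap P f = amap Q f \<cdot>\<^bsub>PMod T\<^esub> \<tau> X"
    proof (rule presheaf_map_eqI[OF PMod_Comp_Hom[OF preadditive_category_axioms Pf Hom[OF o(2)]]
          PMod_Comp_Hom[OF preadditive_category_axioms Hom[OF o(1)] Qf]])
      fix s x assume h: "s \<in> Obj T" "x \<in> carrier (grp (omap P X) s)"
      show "comps (\<tau> Z \<cdot>\<^bsub>PMod T\<^esub> amap P f) s x = comps (amap Q f \<cdot>\<^bsub>PMod T\<^esub> \<tau> X) s x"
        unfolding comps_Comp[OF Pf h] comps_Comp[OF Hom[OF o(1)] h] by (rule nat[OF f h])
    qed
  qed
  ultimately show ?thesis
    unfolding nat_iso_def using P Q Hom' by simp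
qed

end

lemma additive_functor_completion:
  assumes "metric_category S \<kappa> BS" "metric_category T \<iota> BT"
    and "additive_functor (PMod S) (PMod T) F"
    and "\<And>X. X \<in> completion_objs S \<kappa> BS \<Longrightarrow> omap F X \<in> completion_objs T \<iota> BT"
  shows "additive_functor (completion S \<kappa> BS) (completion T \<iota> BT) F"
proof -
  interpret S: metric_category S \<kappa> BS by fact
  interpret T: metric_category T \<iota> BT by fact
  interpret F: additive_functor "PMod S" "PMod T" F by fact
  show ?thesis
    using S.category_completion T.category_completion assms(4) F.amap_in_Hom F.amap_Ident F.amap_Comp
      F.amap_Add S.compl_objs_presheaf
    by (intro additive_functor.intro cat_functor.intro cat_functor_axioms.intro
        additive_functor_axioms.intro)
      (auto simp: S.Hom_completion_iff T.Hom_completion_iff simp del: PMod_simps(2-8))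
qed

lemma (in metric_category) cat_functor_completion_shift:
  "cat_functor (completion T \<iota> B) (completion T \<iota> B) (precomp T (unshift T))"
  by (intro additive_functor.axioms(1) additive_functor_completion metric_category_axioms
      additive_functor_precomp preadditive_category_axioms additive_functor_unshift)
    (simp add: compl_objs_unshift)


section \<open>Precomposition with a left adjoint on completions\<close>

lemma (in presheaf_over) bij_betw_act:
  assumes "iso_arr C f"
  shows "bij_betw (act E f) (carrier (grp E (Cod C f))) (carrier (grp E (Dom C f)))"
proof -
  from assms obtain g where g: "g \<in> Arr C" "Dom C g = Cod C f" "Cod C g = Dom C f"
    "g \<cdot> f = Ident C (Dom C f)" "f \<cdot> g = Ident C (Cod C f)"
    by (blast elim: iso_arrE)
  have f: "f \<in> Arr C" using assms unfolding iso_arr_def by simp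
  have "act E f (act E g x) = x" if "x \<in> carrier (grp E (Dom C f))" for x
    using act_comp[of f g x] f g that by simp
  moreover have "act E g (act E f x) = x" if "x \<in> carrier (grp E (Cod C f))" for x
    using act_comp[of g f x] f g that by simp
  ultimately show ?thesis
    using f g by (intro bij_betw_byWitness[of _ "act E g"]) auto
qed

lemma (in presheaf_over) trivial_isomorphic:
  assumes "isomorphic C A A'" "carrier (grp E A) = {\<one>\<^bsub>grp E A\<^esub>}"
  shows "carrier (grp E A') = {\<one>\<^bsub>grp E A'\<^esub>}"
proof -
  from assms(1) obtain f where f: "f \<in> Hom C A A'" "iso_arr C f" unfolding isomorphic_def by blast
  have o: "A' \<in> Obj C" by (rule Hom_Obj(2)[OF f(1)])
  have "inj_on (act E f) (carrier (grp E A'))" "act E f ` carrier (grp E A') = carrier (grp E A)"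
    using bij_betw_act[OF f(2)] HomD[OF f(1)] by (auto simp: bij_betw_def)
  then have "x = \<one>\<^bsub>grp E A'\<^esub>" if "x \<in> carrier (grp E A')" for x
    using that one_carrier[OF o] assms(2) by (metis imageI inj_onD singletonD)
  then show ?thesis using one_carrier[OF o] by blast
qed

text \<open>The hypotheses are symmetric enough to cover both \<open>F \<stileturn> G\<close> and \<open>G \<stileturn> J\<close>.\<close>

locale metric_adjunction = C: metric_category C \<kappa> BC + D: metric_category D \<iota> BD +
    HT: triangulated_functor C D H + KT: triangulated_functor D C K + adjoint_pair C D H K \<eta> \<epsilon>
  for C :: "('o, 'm, 'x) tri_cat_scheme" and \<kappa> :: "'m \<Rightarrow> 'u" and BC
    and D :: "('p, 'n, 'y) tri_cat_scheme" and \<iota> :: "'n \<Rightarrow> 'u" and BD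
    and H :: "('o, 'm, 'p, 'n) func" and K :: "('p, 'n, 'o, 'm) func" and \<eta> \<epsilon> +
  assumes H_metric: "X \<in> BC i \<Longrightarrow> omap H X \<in> BD i"
    and K_metric: "Z \<in> BD i \<Longrightarrow> omap K Z \<in> BC i"
begin

sublocale additive_adjunction C D H K \<eta> \<epsilon> ..

sublocale P: additive_functor "PMod D" "PMod C" "precomp C H"
  by (rule additive_functor_precomp(1)[OF C.preadditive_category_axioms D.preadditive_category_axioms
        HT.additive_functor_axioms])

lemma presheaf_precomp: "additive_presheaf D X \<Longrightarrow> additive_presheaf C (presheaf_comp C H X)"
  by (rule additive_functor_precomp(2)[OF C.preadditive_category_axioms D.preadditive_category_axioms
        HT.additive_functor_axioms])

lemma good_cauchy_K:
  "good_cauchy D BD E e \<Longrightarrow> good_cauchy C BC (\<lambda>n. omap K (E n)) (\<lambda>n. amap K (e n))"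
  by (rule KT.good_cauchy_omap[OF D.triangulated_category_axioms C.triangulated_category_axioms _
        D.replete C.replete K_metric])

lemma precomp_compl_objs:
  assumes "X \<in> D.compl_objs"
  shows "presheaf_comp C H X \<in> C.compl_objs"
proof -
  have X: "additive_presheaf D X" by (rule D.compl_objs_presheaf[OF assms])
  interpret X: presheaf_over D X using X D.preadditive_category_axioms by (simp add: presheaf_over_def)
  have "\<exists>i. \<forall>b \<in> BC i. carrier (grp (presheaf_comp C H X) (shift_pow C j b))
      = {\<one>\<^bsub>grp (presheaf_comp C H X) (shift_pow C j b)\<^esub>}" for j
  proof -
    obtain i where i: "\<And>b. b \<in> BD i \<Longrightarrow> carrier (grp X (shift_pow D j b)) = {\<one>\<^bsub>grp X (shift_pow D j b)\<^esub>}"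
      using assms unfolding D.compl_objs_iff by blast
    have "carrier (grp X (omap H (shift_pow C j b))) = {\<one>\<^bsub>grp X (omap H (shift_pow C j b))\<^esub>}"
      if b: "b \<in> BC i" for b
      using X.trivial_isomorphic[OF D.isomorphic_sym[OF HT.shift_pow_omap[OF
            C.triangulated_category_axioms D.triangulated_category_axioms C.B_Obj[OF b]]]
          i[OF H_metric[OF b]]] .
    then show ?thesis using C.B_Obj by (intro exI[of _ i]) simp
  qed
  moreover obtain E e \<xi> where E: "good_cauchy D BD E e" "presentation D X E e \<xi>"
    using assms unfolding D.compl_objs_iff by blast
  ultimately show ?thesis
    using presheaf_precomp[OF X] good_cauchy_K[OF E(1)] presentation_precomp[OF E(2)]
    unfolding C.compl_objs_iff by blast
qed

lemma additive_functor_precomp_completion: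
  "additive_functor (completion D \<iota> BD) (completion C \<kappa> BC) (precomp C H)"
  using precomp_compl_objs
  by (intro additive_functor_completion D.metric_category_axioms C.metric_category_axioms
      P.additive_functor_axioms) simp

text \<open>Let \<open>\<phi>\<close> be an isomorphism that makes \<open>K\<close> commute with the shifts. Its
  mate \<open>\<psi>\<close> compares \<open>H \<circ> \<Sigma>\<inverse>\<close> with \<open>\<Sigma>\<inverse> \<circ> H\<close>, and restriction along
  \<open>\<psi>\<close> makes \<open>H\<^sup>*\<close> commute with the shifts of the completions. The choice of the mate is
  forced: a triangle is mapped to one presented by the triangles \<open>(K p, K q, \<phi> \<cdot> K r)\<close> and
  the elements \<open>act X (\<epsilon> (a n)) (\<xi> n)\<close>, so the comparison has to be compatible with
  \<open>\<phi>\<close> and \<open>\<epsilon>\<close>.\<close>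

context
  fixes \<phi>
  assumes \<phi>: "nat_iso D C (K \<circ>\<^sub>F Shift D) (Shift C \<circ>\<^sub>F K) \<phi>"
    and \<phi>_Tri: "\<And>f g h. (f, g, h) \<in> Tri D \<Longrightarrow>
      (amap K f, amap K g, \<phi> (Dom D f) \<cdot>\<^bsub>C\<^esub> amap K h) \<in> Tri C"
begin

definition \<psi> where
  "\<psi> s = \<epsilon> (omap (unshift D) (omap H s)) \<cdot>\<^bsub>D\<^esub>
    amap H (amap (unshift C) (\<phi> (omap (unshift D) (omap H s)) \<cdot>\<^bsub>C\<^esub> \<eta> s))"

lemma \<phi>_arr [simp]:
  assumes "X \<in> Obj D"
  shows "\<phi> X \<in> Arr C" "Dom C (\<phi> X) = omap K (Sigma_obj D X)" "Cod C (\<phi> X) = Sigma_obj C (omap K X)"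
    "iso_arr C (\<phi> X)"
  using \<phi> assms unfolding nat_iso_def func_comp_def by (auto simp: Hom_iff)

lemma \<phi>_natural:
  "u \<in> Arr D \<Longrightarrow> \<phi> (Cod D u) \<cdot>\<^bsub>C\<^esub> amap K (Sigma_arr D u) = Sigma_arr C (amap K u) \<cdot>\<^bsub>C\<^esub> \<phi> (Dom D u)"
  using \<phi> unfolding nat_iso_def func_comp_def by (auto simp: Hom_iff)

lemma \<psi>_Hom:
  assumes "s \<in> Obj C"
  shows "\<psi> s \<in> Hom D (omap H (omap (unshift C) s)) (omap (unshift D) (omap H s))"
  using assms unfolding \<psi>_def by (simp add: Hom_iff)

lemma \<psi>_arr [simp]:
  assumes "s \<in> Obj C"
  shows "\<psi> s \<in> Arr D" "Dom D (\<psi> s) = omap H (omap (unshift C) s)"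
    "Cod D (\<psi> s) = omap (unshift D) (omap H s)"
  using \<psi>_Hom[OF assms] by (auto simp: Hom_iff)

text \<open>The transpose of \<open>f \<cdot> \<psi> s\<close> in terms of the transpose of \<open>\<Sigma> f\<close>. This identity
  determines \<open>\<psi>\<close>, and all properties of \<open>\<psi>\<close> follow from it.\<close>

lemma transpose_\<psi>:
  assumes "s \<in> Obj C" "f \<in> Arr D" "Dom D f = omap (unshift D) (omap H s)"
  shows "amap K (f \<cdot>\<^bsub>D\<^esub> \<psi> s) \<cdot>\<^bsub>C\<^esub> \<eta> (omap (unshift C) s)
    = amap (unshift C) (\<phi> (Cod D f) \<cdot>\<^bsub>C\<^esub> (amap K (Sigma_arr D f) \<cdot>\<^bsub>C\<^esub> \<eta> s))"
proof -
  let ?d = "omap (unshift D) (omap H s)" and ?u = "omap (unshift C) s"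
  let ?t = "amap (unshift C) (\<phi> ?d \<cdot>\<^bsub>C\<^esub> \<eta> s)"
  have t: "?t \<in> Hom C ?u (omap K ?d)" using assms(1) by (simp add: Hom_iff)
  have "amap K (f \<cdot>\<^bsub>D\<^esub> \<psi> s) \<cdot>\<^bsub>C\<^esub> \<eta> ?u = amap K f \<cdot>\<^bsub>C\<^esub> (amap K (\<psi> s) \<cdot>\<^bsub>C\<^esub> \<eta> ?u)"
    using assms by simp
  also have "amap K (\<psi> s) \<cdot>\<^bsub>C\<^esub> \<eta> ?u = ?t"
    unfolding \<psi>_def using transpose_right[OF t] assms(1) by simp
  also have "amap K f \<cdot>\<^bsub>C\<^esub> ?t = amap (unshift C) (Sigma_arr C (amap K f) \<cdot>\<^bsub>C\<^esub> (\<phi> ?d \<cdot>\<^bsub>C\<^esub> \<eta> s))"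
    using assms by simp
  also have "Sigma_arr C (amap K f) \<cdot>\<^bsub>C\<^esub> (\<phi> ?d \<cdot>\<^bsub>C\<^esub> \<eta> s)
    = (\<phi> (Cod D f) \<cdot>\<^bsub>C\<^esub> amap K (Sigma_arr D f)) \<cdot>\<^bsub>C\<^esub> \<eta> s"
    using \<phi>_natural[OF assms(2)] assms by simp
  also have "\<dots> = \<phi> (Cod D f) \<cdot>\<^bsub>C\<^esub> (amap K (Sigma_arr D f) \<cdot>\<^bsub>C\<^esub> \<eta> s)"
    using assms by simp
  finally show ?thesis .
qed

text \<open>Composition with \<open>\<psi> s\<close> is bijective on Hom sets, because up to transposition it is the
  shift followed by composition with the isomorphism \<open>\<phi>\<close>.\<close>

lemma iso_arr_\<psi>:
  assumes s: "s \<in> Obj C"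
  shows "iso_arr D (\<psi> s)"
proof (rule D.iso_arr_if_bij_pre[OF \<psi>_Hom[OF s]])
  let ?d = "omap (unshift D) (omap H s)"
  fix u v assume uv: "u \<in> Hom D ?d ?d" "v \<in> Hom D ?d ?d" "u \<cdot>\<^bsub>D\<^esub> \<psi> s = v \<cdot>\<^bsub>D\<^esub> \<psi> s"
  note a = HomD[OF uv(1)] HomD[OF uv(2)]
  have d: "?d \<in> Obj D" using s by simp
  obtain i where i: "i \<in> Arr C" "Dom C i = Cod C (\<phi> ?d)" "i \<cdot>\<^bsub>C\<^esub> \<phi> ?d = Ident C (Dom C (\<phi> ?d))"
    using iso_arrE[OF \<phi>_arr(4)[OF d]] by metis
  let ?l = "\<lambda>u. amap K (Sigma_arr D u) \<cdot>\<^bsub>C\<^esub> \<eta> s"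
  have l: "?l u \<in> Arr C" "Dom C (?l u) = s" "Cod C (?l u) = omap K (omap H s)"
    "?l v \<in> Arr C" "Dom C (?l v) = s" "Cod C (?l v) = omap K (omap H s)"
    using a s by simp_all
  have "amap (unshift C) (\<phi> ?d \<cdot>\<^bsub>C\<^esub> ?l u) = amap (unshift C) (\<phi> ?d \<cdot>\<^bsub>C\<^esub> ?l v)"
    using transpose_\<psi>[OF s, of u] transpose_\<psi>[OF s, of v] a uv(3) by simp
  then have "\<phi> ?d \<cdot>\<^bsub>C\<^esub> ?l u = \<phi> ?d \<cdot>\<^bsub>C\<^esub> ?l v"
    using C.Sigma_unshift(5)[of "\<phi> ?d \<cdot>\<^bsub>C\<^esub> ?l u"] C.Sigma_unshift(5)[of "\<phi> ?d \<cdot>\<^bsub>C\<^esub> ?l v"] l s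
    by simp
  then have "(i \<cdot>\<^bsub>C\<^esub> \<phi> ?d) \<cdot>\<^bsub>C\<^esub> ?l u = (i \<cdot>\<^bsub>C\<^esub> \<phi> ?d) \<cdot>\<^bsub>C\<^esub> ?l v"
    using C.assoc[of "?l u" "\<phi> ?d" i] C.assoc[of "?l v" "\<phi> ?d" i] l i(1,2) s by simp
  then have "?l u = ?l v" unfolding i(3) using l s by simp
  then have "Sigma_arr D u = Sigma_arr D v"
    using a s by (intro transpose_inject[of _ s "omap H s"]) (simp_all add: Hom_iff)
  then show "u = v" using D.Sigma_arr_inject a by blast
next
  let ?u = "omap (unshift C) s" and ?d = "omap (unshift D) (omap H s)"
  let ?e = "omap H ?u"
  have e: "?e \<in> Obj D" using s by simp
  obtain i where i: "i \<in> Arr C" "Dom C i = Cod C (\<phi> ?e)" "Cod C i = Dom C (\<phi> ?e)"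
    "\<phi> ?e \<cdot>\<^bsub>C\<^esub> i = Ident C (Cod C (\<phi> ?e))"
    using iso_arrE[OF \<phi>_arr(4)[OF e]] by metis
  let ?t = "i \<cdot>\<^bsub>C\<^esub> Sigma_arr C (\<eta> ?u)"
  have t: "?t \<in> Hom C s (omap K (Sigma_obj D ?e))" using i s e by (simp add: Hom_iff)
  let ?f = "\<epsilon> (Sigma_obj D ?e) \<cdot>\<^bsub>D\<^esub> amap H ?t"
  have f: "?f \<in> Hom D (omap H s) (Sigma_obj D ?e)" using t s by (simp add: Hom_iff)
  let ?g = "amap (unshift D) ?f"
  have g: "?g \<in> Hom D ?d ?e" using HomD[OF f] e by (simp add: Hom_iff)
  note a = HomD[OF f] HomD[OF g] HomD[OF t]
  have "Sigma_arr D ?g = ?f" using a by simp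
  then have "amap K (?g \<cdot>\<^bsub>D\<^esub> \<psi> s) \<cdot>\<^bsub>C\<^esub> \<eta> ?u = amap (unshift C) (\<phi> ?e \<cdot>\<^bsub>C\<^esub> ?t)"
    using transpose_\<psi>[OF s, of ?g] a transpose_right[OF t] e by simp
  also have "\<phi> ?e \<cdot>\<^bsub>C\<^esub> ?t = (\<phi> ?e \<cdot>\<^bsub>C\<^esub> i) \<cdot>\<^bsub>C\<^esub> Sigma_arr C (\<eta> ?u)"
    using i(1-3) s e by simp
  also have "\<dots> = Sigma_arr C (\<eta> ?u)" unfolding i(4) using s e by simp
  also have "amap (unshift C) (Sigma_arr C (\<eta> ?u)) = amap K (Ident D ?e) \<cdot>\<^bsub>C\<^esub> \<eta> ?u" using s by simp
  finally have "?g \<cdot>\<^bsub>D\<^esub> \<psi> s = Ident D ?e"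
    using a s by (intro transpose_inject[of _ ?u ?e]) (simp_all add: Hom_iff)
  then show "\<exists>u \<in> Hom D ?d ?e. u \<cdot>\<^bsub>D\<^esub> \<psi> s = Ident D ?e" using g by blast
qed

lemma \<psi>_natural:
  assumes u: "u \<in> Arr C"
  shows "amap (unshift D) (amap H u) \<cdot>\<^bsub>D\<^esub> \<psi> (Dom C u) = \<psi> (Cod C u) \<cdot>\<^bsub>D\<^esub> amap H (amap (unshift C) u)"
    (is "?l = ?r")
proof -
  let ?s = "Dom C u" and ?s' = "Cod C u"
  let ?d = "omap (unshift D) (omap H ?s')"
  have "amap K ?l \<cdot>\<^bsub>C\<^esub> \<eta> (omap (unshift C) ?s)
    = amap (unshift C) (\<phi> ?d \<cdot>\<^bsub>C\<^esub> (amap K (amap H u) \<cdot>\<^bsub>C\<^esub> \<eta> ?s))"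
    using transpose_\<psi>[of ?s "amap (unshift D) (amap H u)"] u by simp
  also have "\<dots> = amap (unshift C) (\<phi> ?d \<cdot>\<^bsub>C\<^esub> (\<eta> ?s' \<cdot>\<^bsub>C\<^esub> u))" using unit_natural[OF u] by simp
  also have "\<dots> = amap (unshift C) (\<phi> ?d \<cdot>\<^bsub>C\<^esub> \<eta> ?s') \<cdot>\<^bsub>C\<^esub> amap (unshift C) u"
    using u by simp
  also have "amap (unshift C) (\<phi> ?d \<cdot>\<^bsub>C\<^esub> \<eta> ?s') = amap K (\<psi> ?s') \<cdot>\<^bsub>C\<^esub> \<eta> (omap (unshift C) ?s')"
    using transpose_\<psi>[of ?s' "Ident D ?d"] u by simp
  also have "\<dots> \<cdot>\<^bsub>C\<^esub> amap (unshift C) u = amap K ?r \<cdot>\<^bsub>C\<^esub> \<eta> (omap (unshift C) ?s)"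
    using u unit_natural[of "amap (unshift C) u"] by simp
  finally show ?thesis
    using u by (intro transpose_inject[of _ "omap (unshift C) ?s" ?d]) (simp_all add: Hom_iff)
qed

definition \<theta> where
  "\<theta> X = mk_map C (presheaf_comp C H (presheaf_comp D (unshift D) X))
    (presheaf_comp C (unshift C) (presheaf_comp C H X)) (\<lambda>s. act X (\<psi> s))"

lemma \<theta>_Hom:
  assumes "additive_presheaf D X"
  shows "\<theta> X \<in> Hom (PMod C) (presheaf_comp C H (presheaf_comp D (unshift D) X))
    (presheaf_comp C (unshift C) (presheaf_comp C H X))"
proof -
  interpret X: presheaf_over D X using assms D.preadditive_category_axioms by (simp add: presheaf_over_def)
  show ?thesis
    unfolding \<theta>_def
  proof (rule mk_map_Hom)
    fix u x
    assume u: "u \<in> Arr C"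
      and x: "x \<in> carrier (grp (presheaf_comp C H (presheaf_comp D (unshift D) X)) (Cod C u))"
    have "act X (amap (unshift D) (amap H u) \<cdot>\<^bsub>D\<^esub> \<psi> (Dom C u)) x
      = act X (\<psi> (Cod C u) \<cdot>\<^bsub>D\<^esub> amap H (amap (unshift C) u)) x"
      unfolding \<psi>_natural[OF u] ..
    then show "act X (\<psi> (Dom C u)) (act (presheaf_comp C H (presheaf_comp D (unshift D) X)) u x) =
      act (presheaf_comp C (unshift C) (presheaf_comp C H X)) u (act X (\<psi> (Cod C u)) x)"
      using u x by simp
  qed (use C.preadditive_category_axioms presheaf_precomp[OF D.presheaf_unshift[OF assms]]
        C.presheaf_unshift[OF presheaf_precomp[OF assms]] in simp_all)
qed

lemma \<theta>_apply:
  "s \<in> Obj C \<Longrightarrow> x \<in> carrier (grp X (omap (unshift D) (omap H s))) \<Longrightarrow> comps (\<theta> X) s x = act X (\<psi> s) x"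
  by (simp add: \<theta>_def)

lemma nat_iso_\<theta>:
  "nat_iso (completion D \<iota> BD) (completion C \<kappa> BC)
    (precomp C H \<circ>\<^sub>F Shift (completion D \<iota> BD)) (Shift (completion C \<kappa> BC) \<circ>\<^sub>F precomp C H) \<theta>"
  unfolding C.completion_simps(7) D.completion_simps(7)
proof (rule C.completion_nat_isoI)
  interpret Q: additive_functor "completion D \<iota> BD" "completion C \<kappa> BC" "precomp C H"
    by (rule additive_functor_precomp_completion)
  show "cat_functor (completion D \<iota> BD) (completion C \<kappa> BC) (precomp C H \<circ>\<^sub>F precomp D (unshift D))"
    by (rule cat_functor_comp[OF D.cat_functor_completion_shift Q.cat_functor_axioms])
  show "cat_functor (completion D \<iota> BD) (completion C \<kappa> BC) (precomp C (unshift C) \<circ>\<^sub>F precomp C H)"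
    by (rule cat_functor_comp[OF Q.cat_functor_axioms C.cat_functor_completion_shift])
next
  fix X assume "X \<in> Obj (completion D \<iota> BD)"
  then have X: "additive_presheaf D X" using D.compl_objs_presheaf by simp
  interpret X: presheaf_over D X using X D.preadditive_category_axioms by (simp add: presheaf_over_def)
  show "\<theta> X \<in> Hom (PMod C) (omap (precomp C H \<circ>\<^sub>F precomp D (unshift D)) X)
      (omap (precomp C (unshift C) \<circ>\<^sub>F precomp C H) X)"
    using \<theta>_Hom[OF X] by (simp add: func_comp_def)
  fix s assume s: "s \<in> Obj C"
  have "bij_betw (comps (\<theta> X) s) (carrier (grp X (omap (unshift D) (omap H s))))
      (carrier (grp X (omap H (omap (unshift C) s))))
    \<longleftrightarrow> bij_betw (act X (\<psi> s)) (carrier (grp X (omap (unshift D) (omap H s))))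
      (carrier (grp X (omap H (omap (unshift C) s))))"
    by (rule bij_betw_cong) (rule \<theta>_apply[OF s])
  then show "bij_betw (comps (\<theta> X) s)
      (carrier (grp (omap (precomp C H \<circ>\<^sub>F precomp D (unshift D)) X) s))
      (carrier (grp (omap (precomp C (unshift C) \<circ>\<^sub>F precomp C H) X) s))"
    using X.bij_betw_act[OF iso_arr_\<psi>[OF s]] s by (simp add: func_comp_def)
next
  fix f X Z s x
  assume f: "f \<in> Hom (completion D \<iota> BD) X Z" and s: "s \<in> Obj C"
    and x: "x \<in> carrier (grp (omap (precomp C H \<circ>\<^sub>F precomp D (unshift D)) X) s)"
  have x': "x \<in> carrier (grp X (omap (unshift D) (omap H s)))" using s x by (simp add: func_comp_def)
  have f': "f \<in> Hom (PMod D) X Z" using f unfolding D.Hom_completion_iff by blast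
  show "comps (\<theta> Z) s (comps (amap (precomp C H \<circ>\<^sub>F precomp D (unshift D)) f) s x)
    = comps (amap (precomp C (unshift C) \<circ>\<^sub>F precomp C H) f) s (comps (\<theta> X) s x)"
    using s x' \<theta>_apply[OF s x'] \<theta>_apply[OF s comps_closed[OF f' _ x']]
      comps_natural[OF f', of "\<psi> s"] by (simp add: func_comp_def)
qed

text \<open>The essential point is the third square, where the mate is used: both
  \<open>\<Sigma>\<inverse> (r n \<cdot> \<epsilon> (c n)) \<cdot> \<psi> (K (c n))\<close> and
  \<open>\<epsilon> (a n) \<cdot> H (\<Sigma>\<inverse> (\<phi> (a n) \<cdot> K (r n)))\<close> have the transpose
  \<open>\<Sigma>\<inverse> (\<phi> (a n) \<cdot> K (r n))\<close>.\<close>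

lemma precomp_Tri:
  assumes "(f, g, h) \<in> completion_Tri D \<iota> BD"
  shows "(amap (precomp C H) f, amap (precomp C H) g, \<theta> (src f) \<cdot>\<^bsub>PMod C\<^esub> amap (precomp C H) h)
    \<in> completion_Tri C \<kappa> BC"
proof -
  from assms obtain X Y Z a \<alpha> \<xi> b \<beta> \<upsilon> c \<gamma> \<zeta> p q r where
    o: "X \<in> D.compl_objs" "Y \<in> D.compl_objs" "Z \<in> D.compl_objs" and
    t: "D.presented_triangle X a \<alpha> \<xi> Y b \<beta> \<upsilon> Z c \<gamma> \<zeta> p q r f g h"
    unfolding D.completion_Tri_iff by blast
  have f: "f \<in> Hom (PMod D) X Y" and g: "g \<in> Hom (PMod D) Y Z" and
    h: "h \<in> Hom (PMod D) Z (presheaf_comp D (unshift D) X)" and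
    gc: "good_cauchy D BD a \<alpha>" "good_cauchy D BD b \<beta>" "good_cauchy D BD c \<gamma>" and
    tri: "\<And>n. (p n, q n, r n) \<in> Tri D" and
    p: "\<And>n. p n \<in> Hom D (a n) (b n)" and q: "\<And>n. q n \<in> Hom D (b n) (c n)" and
    r: "\<And>n. r n \<in> Hom D (c n) (Sigma_obj D (a n))" and
    pn: "\<And>n. p (Suc n) \<cdot>\<^bsub>D\<^esub> \<alpha> n = \<beta> n \<cdot>\<^bsub>D\<^esub> p n" and
    qn: "\<And>n. q (Suc n) \<cdot>\<^bsub>D\<^esub> \<beta> n = \<gamma> n \<cdot>\<^bsub>D\<^esub> q n" and
    rn: "\<And>n. r (Suc n) \<cdot>\<^bsub>D\<^esub> \<gamma> n = Sigma_arr D (\<alpha> n) \<cdot>\<^bsub>D\<^esub> r n" and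
    X: "presentation D X a \<alpha> \<xi>" and Y: "presentation D Y b \<beta> \<upsilon>" and Z: "presentation D Z c \<gamma> \<zeta>" and
    fe: "\<And>n. comps f (a n) (\<xi> n) = act Y (p n) (\<upsilon> n)" and
    ge: "\<And>n. comps g (b n) (\<upsilon> n) = act Z (q n) (\<zeta> n)" and
    he: "\<And>n. comps h (c n) (\<zeta> n) = act X (amap (unshift D) (r n)) (\<xi> n)"
    using t unfolding D.presented_triangle_def by simp_all
  interpret X: presentation D X a \<alpha> \<xi> by fact
  interpret Y: presentation D Y b \<beta> \<upsilon> by fact
  interpret Z: presentation D Z c \<gamma> \<zeta> by fact
  have pa [simp]: "p n \<in> Arr D" "Dom D (p n) = a n" "Cod D (p n) = b n" for n using HomD[OF p] by auto
  have qa [simp]: "q n \<in> Arr D" "Dom D (q n) = b n" "Cod D (q n) = c n" for n using HomD[OF q] by auto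
  have ra [simp]: "r n \<in> Arr D" "Dom D (r n) = c n" "Cod D (r n) = Sigma_obj D (a n)" for n
    using HomD[OF r] by auto
  have srcf: "src f = X" using f by (simp add: Hom_iff)
  let ?r = "\<lambda>n. \<phi> (a n) \<cdot>\<^bsub>C\<^esub> amap K (r n)"
  let ?h = "\<theta> X \<cdot>\<^bsub>PMod C\<^esub> amap (precomp C H) h"
  have Ph: "amap (precomp C H) h \<in> Hom (PMod C) (presheaf_comp C H Z)
      (presheaf_comp C H (presheaf_comp D (unshift D) X))"
    using P.amap_in_Hom[OF h] by simp
  have "C.presented_triangle (presheaf_comp C H X) (\<lambda>n. omap K (a n)) (\<lambda>n. amap K (\<alpha> n)) (\<lambda>n. act X (\<epsilon> (a n)) (\<xi> n))
     (presheaf_comp C H Y) (\<lambda>n. omap K (b n)) (\<lambda>n. amap K (\<beta> n)) (\<lambda>n. act Y (\<epsilon> (b n)) (\<upsilon> n))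
     (presheaf_comp C H Z) (\<lambda>n. omap K (c n)) (\<lambda>n. amap K (\<gamma> n)) (\<lambda>n. act Z (\<epsilon> (c n)) (\<zeta> n))
     (\<lambda>n. amap K (p n)) (\<lambda>n. amap K (q n)) ?r (amap (precomp C H) f) (amap (precomp C H) g) ?h"
    unfolding C.presented_triangle_def
  proof (intro conjI allI)
    show "amap (precomp C H) f \<in> Hom (PMod C) (presheaf_comp C H X) (presheaf_comp C H Y)"
      "amap (precomp C H) g \<in> Hom (PMod C) (presheaf_comp C H Y) (presheaf_comp C H Z)"
      using P.amap_in_Hom[OF f] P.amap_in_Hom[OF g] by simp_all
    show "?h \<in> Hom (PMod C) (presheaf_comp C H Z) (presheaf_comp C (unshift C) (presheaf_comp C H X))"
      by (rule PMod_Comp_Hom[OF C.preadditive_category_axioms Ph \<theta>_Hom[OF X.additive_presheaf_axioms]])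
    fix n
    show "(amap K (p n), amap K (q n), ?r n) \<in> Tri C" using \<phi>_Tri[OF tri] by simp
    show "amap K (p (Suc n)) \<cdot>\<^bsub>C\<^esub> amap K (\<alpha> n) = amap K (\<beta> n) \<cdot>\<^bsub>C\<^esub> amap K (p n)"
      using arg_cong[OF pn, of "amap K" n] by simp
    show "amap K (q (Suc n)) \<cdot>\<^bsub>C\<^esub> amap K (\<beta> n) = amap K (\<gamma> n) \<cdot>\<^bsub>C\<^esub> amap K (q n)"
      using arg_cong[OF qn, of "amap K" n] by simp
    have "?r (Suc n) \<cdot>\<^bsub>C\<^esub> amap K (\<gamma> n) = \<phi> (a (Suc n)) \<cdot>\<^bsub>C\<^esub> amap K (r (Suc n) \<cdot>\<^bsub>D\<^esub> \<gamma> n)" by simp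
    also have "\<dots> = (\<phi> (a (Suc n)) \<cdot>\<^bsub>C\<^esub> amap K (Sigma_arr D (\<alpha> n))) \<cdot>\<^bsub>C\<^esub> amap K (r n)"
      unfolding rn by simp
    also have "\<dots> = Sigma_arr C (amap K (\<alpha> n)) \<cdot>\<^bsub>C\<^esub> ?r n"
      using \<phi>_natural[of "\<alpha> n"] by simp
    finally show "?r (Suc n) \<cdot>\<^bsub>C\<^esub> amap K (\<gamma> n) = Sigma_arr C (amap K (\<alpha> n)) \<cdot>\<^bsub>C\<^esub> ?r n" .
    have "comps f (omap H (omap K (a n))) (act X (\<epsilon> (a n)) (\<xi> n)) = act Y (p n \<cdot>\<^bsub>D\<^esub> \<epsilon> (a n)) (\<upsilon> n)"
      using comps_natural[OF f, of "\<epsilon> (a n)"] fe by simp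
    also have "\<dots> = act Y (amap H (amap K (p n))) (act Y (\<epsilon> (b n)) (\<upsilon> n))"
      using counit_natural[of "p n", symmetric] by simp
    finally show "comps (amap (precomp C H) f) (omap K (a n)) (act X (\<epsilon> (a n)) (\<xi> n)) =
       act (presheaf_comp C H Y) (amap K (p n)) (act Y (\<epsilon> (b n)) (\<upsilon> n))" by simp
    have "comps g (omap H (omap K (b n))) (act Y (\<epsilon> (b n)) (\<upsilon> n)) = act Z (q n \<cdot>\<^bsub>D\<^esub> \<epsilon> (b n)) (\<zeta> n)"
      using comps_natural[OF g, of "\<epsilon> (b n)"] ge by simp
    also have "\<dots> = act Z (amap H (amap K (q n))) (act Z (\<epsilon> (c n)) (\<zeta> n))"
      using counit_natural[of "q n", symmetric] by simp
    finally show "comps (amap (precomp C H) g) (omap K (b n)) (act Y (\<epsilon> (b n)) (\<upsilon> n)) =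
       act (presheaf_comp C H Z) (amap K (q n)) (act Z (\<epsilon> (c n)) (\<zeta> n))" by simp
    let ?Kc = "omap K (c n)"
    have \<zeta>': "act Z (\<epsilon> (c n)) (\<zeta> n) \<in> carrier (grp (presheaf_comp C H Z) ?Kc)" by simp
    have Kc: "?Kc \<in> Obj C" by simp
    let ?f = "amap (unshift D) (r n \<cdot>\<^bsub>D\<^esub> \<epsilon> (c n))"
    have "comps h (omap H ?Kc) (act Z (\<epsilon> (c n)) (\<zeta> n)) = act X ?f (\<xi> n)"
      using comps_natural[OF h, of "\<epsilon> (c n)"] he by simp
    then have "comps ?h ?Kc (act Z (\<epsilon> (c n)) (\<zeta> n)) = comps (\<theta> X) ?Kc (act X ?f (\<xi> n))"
      unfolding comps_Comp[OF Ph Kc \<zeta>'] by simp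
    also have "\<dots> = act X (\<psi> ?Kc) (act X ?f (\<xi> n))" by (rule \<theta>_apply[OF Kc]) simp
    also have "\<dots> = act X (?f \<cdot>\<^bsub>D\<^esub> \<psi> ?Kc) (\<xi> n)" by simp
    also have "?f \<cdot>\<^bsub>D\<^esub> \<psi> ?Kc = \<epsilon> (a n) \<cdot>\<^bsub>D\<^esub> amap H (amap (unshift C) (?r n))"
    proof (rule transpose_inject[of _ "omap (unshift C) ?Kc" "a n"])
      have g: "amap (unshift C) (?r n) \<in> Hom C (omap (unshift C) ?Kc) (omap K (a n))" by (simp add: Hom_iff)
      have "amap K (r n \<cdot>\<^bsub>D\<^esub> \<epsilon> (c n)) \<cdot>\<^bsub>C\<^esub> \<eta> ?Kc = amap K (r n) \<cdot>\<^bsub>C\<^esub> (amap K (\<epsilon> (c n)) \<cdot>\<^bsub>C\<^esub> \<eta> ?Kc)" by simp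
      also have "\<dots> = amap K (r n)" unfolding triangle_right[OF Z.E_Obj] by simp
      finally have "amap K (r n \<cdot>\<^bsub>D\<^esub> \<epsilon> (c n)) \<cdot>\<^bsub>C\<^esub> \<eta> ?Kc = amap K (r n)" .
      then show "amap K (?f \<cdot>\<^bsub>D\<^esub> \<psi> ?Kc) \<cdot>\<^bsub>C\<^esub> \<eta> (omap (unshift C) ?Kc) =
          amap K (\<epsilon> (a n) \<cdot>\<^bsub>D\<^esub> amap H (amap (unshift C) (?r n))) \<cdot>\<^bsub>C\<^esub> \<eta> (omap (unshift C) ?Kc)"
        unfolding transpose_right[OF g X.E_Obj]
        using transpose_\<psi>[OF Kc, of ?f] D.Sigma_unshift(5)[of "r n \<cdot>\<^bsub>D\<^esub> \<epsilon> (c n)"]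
        by (simp del: C.U.amap_comp D.U.amap_comp HT.amap_comp KT.amap_comp)
    qed (simp_all add: Hom_iff)
    finally show "comps ?h ?Kc (act Z (\<epsilon> (c n)) (\<zeta> n)) =
      act (presheaf_comp C H X) (amap (unshift C) (?r n)) (act X (\<epsilon> (a n)) (\<xi> n))" by simp
  qed (use good_cauchy_K[OF gc(1)] good_cauchy_K[OF gc(2)] good_cauchy_K[OF gc(3)]
        presentation_precomp[OF X] presentation_precomp[OF Y] presentation_precomp[OF Z]
      in \<open>simp_all add: Hom_iff\<close>)
  then show ?thesis
    unfolding C.completion_Tri_iff srcf using precomp_compl_objs o by blast
qed

end

theorem triangulated_functor_precomp:
  "triangulated_functor (completion D \<iota> BD) (completion C \<kappa> BC) (precomp C H)"
proof -
  obtain \<phi> where \<phi>: "nat_iso D C (K \<circ>\<^sub>F Shift D) (Shift C \<circ>\<^sub>F K) \<phi>"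
    "\<And>f g h. (f, g, h) \<in> Tri D \<Longrightarrow> (amap K f, amap K g, \<phi> (Dom D f) \<cdot>\<^bsub>C\<^esub> amap K h) \<in> Tri C"
    using KT.shift_Tri by blast
  show ?thesis
    using additive_functor_precomp_completion nat_iso_\<theta>[OF \<phi>] precomp_Tri[OF \<phi>]
    by (intro triangulated_functor.intro triangulated_functor_axioms.intro) (auto simp del: PMod_simps(6))
qed

end

section \<open>Colimits of representables are cohomological\<close>

text \<open>An element of \<open>X\<close> killed by \<open>f\<close> comes from an arrow \<open>u\<close> to some \<open>E n\<close>; at a later
  stage already \<open>u \<cdot> f\<close> is zero, so that there \<open>u\<close> factors through \<open>g\<close>.\<close>

lemma (in triangulated_category) presentation_exact:
  assumes "presentation T X E e \<xi>" "(f, g, h) \<in> Tri T"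
    and "x \<in> carrier (grp X (Cod T f))" "act X f x = \<one>\<^bsub>grp X (Dom T f)\<^esub>"
  shows "\<exists>y \<in> carrier (grp X (Cod T g)). x = act X g y"
proof -
  interpret X: presentation T X E e \<xi> by fact
  note a = Tri_arr[OF assms(2)]
  obtain n u where u: "u \<in> Hom T (Cod T f) (E n)" "x = act X u (\<xi> n)"
    using X.reached[OF Cod_Obj[OF a(1)] assms(3)] by blast
  note b = HomD[OF u(1)]
  have "u \<cdot> f \<in> Hom T (Dom T f) (E n)" "act X (u \<cdot> f) (\<xi> n) = \<one>\<^bsub>grp X (Dom T f)\<^esub>"
    using a b u(2) assms(4) by (simp_all add: Hom_iff)
  then obtain k where k: "chain_map T E e n k \<cdot> (u \<cdot> f) = Zero T (Dom T f) (E (n + k))"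
    using X.dies by blast
  let ?v = "chain_map T E e n k \<cdot> u"
  have v: "?v \<in> Arr T" "Dom T ?v = Cod T f" "Cod T ?v = E (n + k)" using b by simp_all
  have "?v \<cdot> f = Zero T (Dom T f) (Cod T ?v)" using a b k v by simp
  then obtain w where w: "w \<in> Hom T (Cod T g) (E (n + k))" "w \<cdot> g = ?v"
    using weak_cokernel[OF assms(2) v(1,2)] v(3) by auto
  note c = HomD[OF w(1)]
  have "x = act X (w \<cdot> g) (\<xi> (n + k))" unfolding w(2) u(2) by (rule X.act_stage[OF u(1)])
  also have "\<dots> = act X g (act X w (\<xi> (n + k)))" using a c by simp
  finally show ?thesis using c by (intro bexI[of _ "act X w (\<xi> (n + k))"]) simp_all
qed

text \<open>An object of the completion is compactly supported, so it vanishes on all shifts of a cone that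
  lies in every member of the metric; by exactness it inverts the arrow.\<close>

lemma (in metric_category) bij_betw_act_if_cone:
  assumes X: "X \<in> compl_objs" and cone: "is_cone T f Z" and Z: "\<And>i. Z \<in> B i"
  shows "bij_betw (act X f) (carrier (grp X (Cod T f))) (carrier (grp X (Dom T f)))"
proof -
  obtain E e \<xi> where p: "presentation T X E e \<xi>" using X unfolding compl_objs_iff by blast
  interpret X: presentation T X E e \<xi> by fact
  obtain g h where t: "(f, g, h) \<in> Tri T" "Cod T g = Z" using cone unfolding is_cone_def by blast
  note a = Tri_arr[OF t(1)]
  have trivial: "carrier (grp X (shift_pow T j Z)) = {\<one>\<^bsub>grp X (shift_pow T j Z)\<^esub>}" for j
    using X Z unfolding compl_objs_iff by blast
  have ker: "x = \<one>\<^bsub>grp X (Cod T f)\<^esub>"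
    if "x \<in> carrier (grp X (Cod T f))" "act X f x = \<one>\<^bsub>grp X (Dom T f)\<^esub>" for x
    using presentation_exact[OF p t(1) that] trivial[of 0] t(2) a by auto
  interpret G: comm_group "grp X (Cod T f)" using X.grp_comm_group a by simp
  interpret G': comm_group "grp X (Dom T f)" using X.grp_comm_group a by simp
  interpret h: group_hom "grp X (Cod T f)" "grp X (Dom T f)" "act X f"
    using X.act_hom[of f "Dom T f" "Cod T f"] a
    by unfold_locales (simp add: Hom_iff)
  have inj: "inj_on (act X f) (carrier (grp X (Cod T f)))"
    unfolding h.inj_iff_trivial_ker kernel_def using ker h.hom_one by auto
  \<comment> \<open>In the triangle rotated back, the obstruction to lifting along \<open>act X f\<close> is an element of
    \<open>X\<close> at the desuspension of the cone.\<close>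
  let ?k = "Neg T (amap (unshift T) h)"
  have t': "(?k, f, g) \<in> Tri T" by (rule Tri_rotate_back[OF t(1)])
  note b = Tri_arr[OF t']
  have Dk: "Dom T ?k = shift_pow T (- 1) Z" unfolding shift_pow_minus_1 using a t(2) by simp
  have "\<exists>x \<in> carrier (grp X (Cod T f)). y = act X f x" if y: "y \<in> carrier (grp X (Dom T f))" for y
  proof (rule presentation_exact[OF p t'])
    show y': "y \<in> carrier (grp X (Cod T ?k))" using y b by simp
    have "act X ?k y \<in> carrier (grp X (Dom T ?k))" using b y' by simp
    then show "act X ?k y = \<one>\<^bsub>grp X (Dom T ?k)\<^esub>" using trivial[of "- 1"] unfolding Dk by blast
  qed
  then have "act X f ` carrier (grp X (Cod T f)) = carrier (grp X (Dom T f))" using a by auto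
  with inj show ?thesis unfolding bij_betw_def by blast
qed

section \<open>The equivalence\<close>

lemma nat_iso_inverse:
  assumes "nat_iso C D F G \<phi>"
  shows "\<exists>\<psi>. nat_iso C D G F \<psi>"
proof -
  interpret F: cat_functor C D F using assms unfolding nat_iso_def by blast
  interpret G: cat_functor C D G using assms unfolding nat_iso_def by blast
  have \<phi>: "\<phi> A \<in> Hom D (omap F A) (omap G A)" "iso_arr D (\<phi> A)" if "A \<in> Obj C" for A
    using assms that unfolding nat_iso_def by auto
  have nat: "\<phi> B \<cdot>\<^bsub>D\<^esub> amap F f = amap G f \<cdot>\<^bsub>D\<^esub> \<phi> A" if "f \<in> Hom C A B" for f A B
    using assms that unfolding nat_iso_def by blast
  have "\<exists>g. g \<in> Hom D (omap G A) (omap F A) \<and> g \<cdot>\<^bsub>D\<^esub> \<phi> A = Ident D (omap F A) \<and>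
      \<phi> A \<cdot>\<^bsub>D\<^esub> g = Ident D (omap G A)" if "A \<in> Obj C" for A
    using \<phi>[OF that] HomD[OF \<phi>(1)[OF that]] unfolding iso_arr_def by auto
  then obtain \<psi> where \<psi>: "\<And>A. A \<in> Obj C \<Longrightarrow> \<psi> A \<in> Hom D (omap G A) (omap F A)"
    "\<And>A. A \<in> Obj C \<Longrightarrow> \<psi> A \<cdot>\<^bsub>D\<^esub> \<phi> A = Ident D (omap F A)"
    "\<And>A. A \<in> Obj C \<Longrightarrow> \<phi> A \<cdot>\<^bsub>D\<^esub> \<psi> A = Ident D (omap G A)" by metis
  have "iso_arr D (\<psi> A)" if A: "A \<in> Obj C" for A
    using F.D.iso_arr_inverse[OF \<phi>(2)[OF A], of "\<psi> A"] \<psi>[OF A] HomD[OF \<phi>(1)[OF A]]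
      HomD[OF \<psi>(1)[OF A]] by simp
  moreover have "\<psi> B \<cdot>\<^bsub>D\<^esub> amap G f = amap F f \<cdot>\<^bsub>D\<^esub> \<psi> A" if f: "f \<in> Hom C A B" for f A B
  proof -
    note o = F.C.Hom_Obj[OF f]
    note a = HomD[OF f] HomD[OF \<psi>(1)[OF o(1)]] HomD[OF \<psi>(1)[OF o(2)]] HomD[OF \<phi>(1)[OF o(1)]]
      HomD[OF \<phi>(1)[OF o(2)]]
    have "\<psi> B \<cdot>\<^bsub>D\<^esub> amap G f = \<psi> B \<cdot>\<^bsub>D\<^esub> (amap G f \<cdot>\<^bsub>D\<^esub> (\<phi> A \<cdot>\<^bsub>D\<^esub> \<psi> A))"
      using a \<psi>(3)[OF o(1)] by simp
    also have "\<dots> = \<psi> B \<cdot>\<^bsub>D\<^esub> ((amap G f \<cdot>\<^bsub>D\<^esub> \<phi> A) \<cdot>\<^bsub>D\<^esub> \<psi> A)" using a by simp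
    also have "\<dots> = (\<psi> B \<cdot>\<^bsub>D\<^esub> \<phi> B) \<cdot>\<^bsub>D\<^esub> (amap F f \<cdot>\<^bsub>D\<^esub> \<psi> A)"
      unfolding nat[OF f, symmetric] using a by simp
    finally show ?thesis using a \<psi>(2)[OF o(2)] by simp
  qed
  ultimately have "nat_iso C D G F \<psi>"
    unfolding nat_iso_def using F.cat_functor_axioms G.cat_functor_axioms \<psi>(1) by blast
  then show ?thesis by blast
qed

context metric_adjunction
begin

text \<open>If the metric on \<open>D\<close> consists of all objects that \<open>K\<close> maps into the metric on
  \<open>C\<close> and \<open>H\<close> is fully faithful, then \<open>K\<close> inverts the counit, so that a cone of the
  counit lies in all members of the metric.\<close>

lemma bij_betw_act_counit:
  assumes ff: "fully_faithful C D H"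
    and zero: "\<And>i. \<exists>Z \<in> BC i. zero_object C Z"
    and reflect: "\<And>X i. X \<in> Obj D \<Longrightarrow> omap K X \<in> BC i \<Longrightarrow> X \<in> BD i"
    and X: "X \<in> D.compl_objs" and d: "d \<in> Obj D"
  shows "bij_betw (act X (\<epsilon> d)) (carrier (grp X d)) (carrier (grp X (omap H (omap K d))))"
proof -
  have Kd: "omap K d \<in> Obj C" using d by simp
  obtain i where i: "i \<in> Arr C" "Dom C i = Cod C (\<eta> (omap K d))" "Cod C i = Dom C (\<eta> (omap K d))"
    "i \<cdot>\<^bsub>C\<^esub> \<eta> (omap K d) = Ident C (Dom C (\<eta> (omap K d)))"
    "\<eta> (omap K d) \<cdot>\<^bsub>C\<^esub> i = Ident C (Cod C (\<eta> (omap K d)))"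
    using iso_arrE[OF unit_iso[OF ff Kd]] by blast
  \<comment> \<open>By a triangle identity, \<open>K\<close> maps the counit to the inverse \<open>i\<close> of the unit.\<close>
  have "amap K (\<epsilon> d) = amap K (\<epsilon> d) \<cdot>\<^bsub>C\<^esub> (\<eta> (omap K d) \<cdot>\<^bsub>C\<^esub> i)" using d i(5) by simp
  also have "\<dots> = (amap K (\<epsilon> d) \<cdot>\<^bsub>C\<^esub> \<eta> (omap K d)) \<cdot>\<^bsub>C\<^esub> i" using d i(1-3) by simp
  also have "\<dots> = i" unfolding triangle_right[OF d] using d i(1-3) by simp
  finally have iso: "iso_arr C (amap K (\<epsilon> d))"
    using C.iso_arr_inverse[OF unit_iso[OF ff Kd] i] by simp
  obtain Z where Z: "is_cone D (\<epsilon> d) Z" using D.ex_cone d by (metis counit_arr(1))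
  have "omap K Z \<in> BC i" for i
  proof -
    obtain N where O: "N \<in> BC i" "zero_object C N" using zero by blast
    have "isomorphic C N (omap K Z)"
      by (rule C.is_cone_unique[OF C.is_cone_of_iso[OF iso O(2)]
            KT.is_cone_amap[OF D.triangulated_category_axioms Z]])
    then show ?thesis using C.replete O(1) unfolding replete_def by blast
  qed
  then have "Z \<in> BD i" for i using reflect D.is_cone_arr[OF Z] by blast
  then show ?thesis using D.bij_betw_act_if_cone[OF X Z] d by simp
qed

text \<open>The two natural isomorphisms are restriction along the unit, which is invertible, and the
  inverse of restriction along the counit, which is invertible on objects of the completion.\<close>

theorem quasi_inverse_precomp:
  assumes ff: "fully_faithful C D H"
    and zero: "\<And>i. \<exists>Z \<in> BC i. zero_object C Z"
    and reflect: "\<And>X i. X \<in> Obj D \<Longrightarrow> omap K X \<in> BC i \<Longrightarrow> X \<in> BD i"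
    and L: "triangulated_functor (completion C \<kappa> BC) (completion D \<iota> BD) (precomp D K)"
  shows "quasi_inverse (completion C \<kappa> BC) (completion D \<iota> BD) (precomp D K) (precomp C H)"
proof -
  interpret L: triangulated_functor "completion C \<kappa> BC" "completion D \<iota> BD" "precomp D K" by fact
  interpret Q: triangulated_functor "completion D \<iota> BD" "completion C \<kappa> BC" "precomp C H"
    by (rule triangulated_functor_precomp)
  define \<tau> :: "('o, 'm, 'u) presheaf \<Rightarrow> ('o, 'm, 'u) presheaf_map" where
    "\<tau> X = mk_map C (presheaf_comp C H (presheaf_comp D K X)) X (\<lambda>s. act X (\<eta> s))" for X
  define \<sigma> :: "('p, 'n, 'u) presheaf \<Rightarrow> ('p, 'n, 'u) presheaf_map" where
    "\<sigma> X = mk_map D X (presheaf_comp D K (presheaf_comp C H X)) (\<lambda>d. act X (\<epsilon> d))" for X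
  have "nat_iso (completion C \<kappa> BC) (completion C \<kappa> BC) (precomp C H \<circ>\<^sub>F precomp D K) func_id \<tau>"
  proof (rule C.completion_nat_isoI)
    fix X assume "X \<in> Obj (completion C \<kappa> BC)"
    then have X: "X \<in> C.compl_objs" by simp
    interpret X: presheaf_over C X
      using C.compl_objs_presheaf[OF X] C.preadditive_category_axioms by (simp add: presheaf_over_def)
    have "presheaf_comp D K X \<in> D.compl_objs" using L.omap_in_Obj X by simp
    then have HK: "additive_presheaf C (presheaf_comp C H (presheaf_comp D K X))"
      using presheaf_precomp D.compl_objs_presheaf by blast
    have "\<tau> X \<in> Hom (PMod C) (presheaf_comp C H (presheaf_comp D K X)) X"
      unfolding \<tau>_def
    proof (rule mk_map_Hom[OF C.preadditive_category_axioms HK X.additive_presheaf_axioms])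
      fix u x
      assume u: "u \<in> Arr C" and x: "x \<in> carrier (grp (presheaf_comp C H (presheaf_comp D K X)) (Cod C u))"
      have "act X (amap K (amap H u) \<cdot>\<^bsub>C\<^esub> \<eta> (Dom C u)) x = act X (\<eta> (Cod C u) \<cdot>\<^bsub>C\<^esub> u) x"
        unfolding unit_natural[OF u] ..
      then show "act X (\<eta> (Dom C u)) (act (presheaf_comp C H (presheaf_comp D K X)) u x)
        = act X u (act X (\<eta> (Cod C u)) x)"
        using u x by simp
    qed simp_all
    then show "\<tau> X \<in> Hom (PMod C) (omap (precomp C H \<circ>\<^sub>F precomp D K) X) (omap func_id X)"
      by (simp add: func_comp_def func_id_def)
    fix s assume s: "s \<in> Obj C"
    have "bij_betw (comps (\<tau> X) s) (carrier (grp X (omap K (omap H s)))) (carrier (grp X s))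
      \<longleftrightarrow> bij_betw (act X (\<eta> s)) (carrier (grp X (omap K (omap H s)))) (carrier (grp X s))"
      by (rule bij_betw_cong) (simp add: \<tau>_def s)
    then show "bij_betw (comps (\<tau> X) s) (carrier (grp (omap (precomp C H \<circ>\<^sub>F precomp D K) X) s))
        (carrier (grp (omap func_id X) s))"
      using X.bij_betw_act[OF unit_iso[OF ff s]] s by (simp add: func_comp_def func_id_def)
  next
    fix f X Z s x
    assume f: "f \<in> Hom (completion C \<kappa> BC) X Z" and s: "s \<in> Obj C"
      and x: "x \<in> carrier (grp (omap (precomp C H \<circ>\<^sub>F precomp D K) X) s)"
    have x': "x \<in> carrier (grp X (omap K (omap H s)))" using x s by (simp add: func_comp_def)
    have f': "f \<in> Hom (PMod C) X Z" using f unfolding C.Hom_completion_iff by blast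
    show "comps (\<tau> Z) s (comps (amap (precomp C H \<circ>\<^sub>F precomp D K) f) s x)
      = comps (amap func_id f) s (comps (\<tau> X) s x)"
      using s x' comps_closed[OF f' _ x'] comps_natural[OF f', of "\<eta> s"]
      by (simp add: func_comp_def func_id_def \<tau>_def)
  qed (use cat_functor_comp[OF L.cat_functor_axioms Q.cat_functor_axioms]
        cat_functor_id[OF C.category_completion] in auto)
  moreover have "nat_iso (completion D \<iota> BD) (completion D \<iota> BD) func_id (precomp D K \<circ>\<^sub>F precomp C H) \<sigma>"
  proof (rule D.completion_nat_isoI)
    fix X assume "X \<in> Obj (completion D \<iota> BD)"
    then have X: "X \<in> D.compl_objs" by simp
    interpret X: presheaf_over D X
      using D.compl_objs_presheaf[OF X] D.preadditive_category_axioms by (simp add: presheaf_over_def)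
    have "presheaf_comp D K (presheaf_comp C H X) \<in> D.compl_objs"
      using L.omap_in_Obj Q.omap_in_Obj X by simp
    then have KH: "additive_presheaf D (presheaf_comp D K (presheaf_comp C H X))"
      by (rule D.compl_objs_presheaf)
    have "\<sigma> X \<in> Hom (PMod D) X (presheaf_comp D K (presheaf_comp C H X))"
      unfolding \<sigma>_def
    proof (rule mk_map_Hom[OF D.preadditive_category_axioms X.additive_presheaf_axioms KH])
      fix v x assume v: "v \<in> Arr D" and x: "x \<in> carrier (grp X (Cod D v))"
      have "act X (\<epsilon> (Cod D v) \<cdot>\<^bsub>D\<^esub> amap H (amap K v)) x = act X (v \<cdot>\<^bsub>D\<^esub> \<epsilon> (Dom D v)) x"
        unfolding counit_natural[OF v] ..
      then show "act X (\<epsilon> (Dom D v)) (act X v x)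
        = act (presheaf_comp D K (presheaf_comp C H X)) v (act X (\<epsilon> (Cod D v)) x)"
        using v x by simp
    qed simp_all
    then show "\<sigma> X \<in> Hom (PMod D) (omap func_id X) (omap (precomp D K \<circ>\<^sub>F precomp C H) X)"
      by (simp add: func_comp_def func_id_def)
    fix d assume d: "d \<in> Obj D"
    have "bij_betw (comps (\<sigma> X) d) (carrier (grp X d)) (carrier (grp X (omap H (omap K d))))
      \<longleftrightarrow> bij_betw (act X (\<epsilon> d)) (carrier (grp X d)) (carrier (grp X (omap H (omap K d))))"
      by (rule bij_betw_cong) (simp add: \<sigma>_def d)
    then show "bij_betw (comps (\<sigma> X) d) (carrier (grp (omap func_id X) d))
        (carrier (grp (omap (precomp D K \<circ>\<^sub>F precomp C H) X) d))"
      using bij_betw_act_counit[OF ff zero reflect X d] d by (simp add: func_comp_def func_id_def)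
  next
    fix f X Z d x
    assume f: "f \<in> Hom (completion D \<iota> BD) X Z" and d: "d \<in> Obj D"
      and x: "x \<in> carrier (grp (omap func_id X) d)"
    have x': "x \<in> carrier (grp X d)" using x by (simp add: func_id_def)
    have f': "f \<in> Hom (PMod D) X Z" using f unfolding D.Hom_completion_iff by blast
    show "comps (\<sigma> Z) d (comps (amap func_id f) d x)
      = comps (amap (precomp D K \<circ>\<^sub>F precomp C H) f) d (comps (\<sigma> X) d x)"
      using d x' comps_closed[OF f' d x'] comps_natural[OF f', of "\<epsilon> d"]
      by (simp add: func_comp_def func_id_def \<sigma>_def)
  qed (use cat_functor_comp[OF Q.cat_functor_axioms L.cat_functor_axioms]
        cat_functor_id[OF D.category_completion] in auto)
  ultimately show ?thesis
    unfolding quasi_inverse_def using L.cat_functor_axioms Q.cat_functor_axioms nat_iso_inverse by blast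
qed

end

theorem theorem1p3:
  fixes T :: "('a, 'm) tri_cat" and S :: "('b, 'n) tri_cat"
    and \<iota> :: "'m \<Rightarrow> 'u" and \<kappa> :: "'n \<Rightarrow> 'u"
    and F :: "('a, 'm, 'b, 'n) func" and G :: "('b, 'n, 'a, 'm) func"
    and J :: "('a, 'm, 'b, 'n) func"
    and B :: "nat \<Rightarrow> 'a set"
  assumes "triangulated_category T" and "triangulated_category S"
    and "locally_small T \<iota>" and "locally_small S \<kappa>"
    and "triangulated_functor T S F" and "triangulated_functor S T G"
    and "triangulated_functor T S J"
    and "left_adjoint T S F G" and "left_adjoint S T G J"
    and "is_metric T B"
    and "fully_faithful T S F" and "fully_faithful T S J"
  shows "triangulated_equivalence (completion T \<iota> B) (completion S \<kappa> (preimage_metric S G B))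
           (precomp S G)
       \<and> triangulated_inverse (completion T \<iota> B) (completion S \<kappa> (preimage_metric S G B))
           (precomp S G) (precomp T F)"
proof -
  interpret T: triangulated_category T by fact
  interpret S: triangulated_category S by fact
  interpret G: triangulated_functor S T G by fact
  let ?B = "preimage_metric S G B"
  have BT: "replete T B" by (rule T.replete_metric) fact
  have BS: "replete S ?B" by (rule replete_preimage[OF BT G.cat_functor_axioms])
  have mT: "metric_category T \<iota> B" and mS: "metric_category S \<kappa> ?B"
    using assms(1-4) BT BS T.preadditive_category_axioms S.preadditive_category_axioms
    by (simp_all add: metric_category_def metric_category_axioms_def small_category_def
        small_category_axioms_def)
  obtain \<eta> \<epsilon> where FG: "adjoint_pair T S F G \<eta> \<epsilon>" using left_adjoint_pair assms(8) by blast
  obtain \<eta>' \<epsilon>' where GJ: "adjoint_pair S T G J \<eta>' \<epsilon>'" using left_adjoint_pair assms(9) by blast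
  interpret FG: adjoint_pair T S F G \<eta> \<epsilon> by fact
  interpret GJ: adjoint_pair S T G J \<eta>' \<epsilon>' by fact
  have G_metric: "omap G X \<in> B i" if "X \<in> ?B i" for X i
    using that unfolding preimage_metric_def by blast
  have F_metric: "omap F X \<in> ?B i" if X: "X \<in> B i" for X i
  proof -
    have XO: "X \<in> Obj T" using X BT unfolding replete_def by blast
    have "isomorphic T X (omap G (omap F X))"
      unfolding isomorphic_def using FG.unit_iso[OF assms(11) XO] FG.unit_Hom[OF XO] by blast
    then show ?thesis using X BT XO FG.H.omap_Obj unfolding replete_def preimage_metric_def by blast
  qed
  have J_metric: "omap J X \<in> ?B i" if X: "X \<in> B i" for X i
  proof -
    have XO: "X \<in> Obj T" using X BT unfolding replete_def by blast
    have "isomorphic T (omap G (omap J X)) X"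
      unfolding isomorphic_def using GJ.counit_iso[OF assms(12) XO] GJ.counit_Hom[OF XO] by blast
    then show ?thesis
      using X BT XO GJ.K.omap_Obj T.isomorphic_sym unfolding replete_def preimage_metric_def by blast
  qed
  interpret FG: metric_adjunction T \<iota> B S \<kappa> ?B F G \<eta> \<epsilon>
    using mT mS assms(5,6) FG F_metric G_metric
    by (intro metric_adjunction.intro metric_adjunction_axioms.intro)
  interpret GJ: metric_adjunction S \<kappa> ?B T \<iota> B G J \<eta>' \<epsilon>'
    using mT mS assms(6,7) GJ G_metric J_metric
    by (intro metric_adjunction.intro metric_adjunction_axioms.intro)
  have "quasi_inverse (completion T \<iota> B) (completion S \<kappa> ?B) (precomp S G) (precomp T F)"
  proof (rule FG.quasi_inverse_precomp[OF assms(11) _ _ GJ.triangulated_functor_precomp])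
    show "\<exists>Z \<in> B i. zero_object T Z" for i using assms(10) unfolding is_metric_def by blast
    show "X \<in> ?B i" if "X \<in> Obj S" "omap G X \<in> B i" for X i
      using that unfolding preimage_metric_def by blast
  qed
  then show ?thesis
    unfolding triangulated_equivalence_def triangulated_inverse_def
    using FG.triangulated_functor_precomp GJ.triangulated_functor_precomp by blast
qed

end
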